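(* Let $T>0$, let $E$ be a real Banach space, $\Omega\subset E$ a non-empty open subset, $\xi_0\in\Omega$, $U$ a Hausdorff topological space, $m,q\ge 1$ integers, and let $f:[0,T]\times\Omega\times U\to E$, $g^\alpha:\Omega\to\mathbb R$ ($0\le\alpha\le m$), $h^\beta:\Omega\to\mathbb R$ ($1\le\beta\le q$) be functions. Let $(x_0,u_0)$ be a solution of the Mayer problem $(\mathcal M)$ (defined in the context). Assume: (1) $f\in C^0([0,T]\times\Omega\times U,E)$; for all $(t,\xi,\zeta)\in[0,T]\times\Omega\times U$, $D_{G,2}f(t,\xi,\zeta)$ exists; for all $(t,\zeta)\in[0,T]\times U$, $D_{F,2}f(t,x_0(t),\zeta)$ exists, and $[(t,\zeta)\mapsto D_{F,2}f(t,x_0(t),\zeta)]\in C^0([0,T]\times U,\mathcal L(E,E))$. (2) For all non-empty compact $K\subset\Omega$ and all non-empty compact $M\subset U$, $\sup_{(t,\xi,\zeta)\in[0,T]\times K\times M}\|D_{G,2}f(t,\xi,\zeta)\|<+\infty$. (3) For all $\alpha\in\{0,\dots,m\}$, $g^\alpha$ is Hadamard differentiable at $x_0(T)$. (4) For all $\beta\in\{1,\dots,q\}$, $h^\beta$ is continuous on a neighborhood of $x_0(T)$ and Hadamard differentiable at $x_0(T)$. Then there exist $(\lambda_\alpha)_{0\le\alpha\le m}\in\mathbb R^{1+m}$, $(\mu_\beta)_{1\le\beta\le q}\in\mathbb R^q$ and $p\in PC^1([0,T],E^* )$ such that, with $H_M(t,\xi,\zeta,p):=p\cdot f(t,\xi,\zeta)$: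 (i) $((\lambda_\alpha)_{0\le\alpha\le m},(\mu_\beta)_{1\le\beta\le q})$ is non-zero; (ii) $\lambda_\alpha\ge 0$ for all $\alpha\in\{0,\dots,m\}$; (iii) $\lambda_\alpha g^\alpha(x_0(T))=0$ for all $\alpha\in\{1,\dots,m\}$; (iv) $\sum_{\alpha=0}^m\lambda_\alpha D_Hg^\alpha(x_0(T))+\sum_{\beta=1}^q\mu_\beta D_Hh^\beta(x_0(T))=p(T)$; (v) $\underline d p(t)=-D_{F,2}H_M(t,x_0(t),u_0(t),p(t))$ for all $t\in[0,T]$; (vi) for all $t\in[0,T]$ and all $\zeta\in U$, $H_M(t,x_0(t),u_0(t),p(t))\ge H_M(t,x_0(t),\zeta,p(t))$; (vii) $[t\mapsto H_M(t,x_0(t),u_0(t),p(t))]\in C^0([0,T],\mathbb R)$.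
   Context: Function spaces. For a Hausdorff topological space $W$, $PC^0([0,T],W)$ is the set of $x:[0,T]\to W$ which are continuous, or for which there is a subdivision $0=\tau_0<\tau_1<\dots<\tau_{k+1}=T$ such that $x$ is continuous at every $t\notin\{\tau_i\}$, the right limit $x(\tau_i+)$ exists in $W$ for $0\le i\le k$ and the left limit $x(\tau_i-)$ exists in $W$ for $1\le i\le k+1$. $NPC^0_R([0,T],W)$ is the set of $x\in PC^0([0,T],W)$ which are right-continuous on $[0,T[$ and left-continuous at $T$. For $W$ a subset of a real normed space, $PC^1([0,T],W)$ is the set of continuous $x:[0,T]\to W$ which are continuously differentiable, or for which there is a subdivision $0=\tau_0<\tau_1<\dots<\tau_{k+1}=T$ such that $x$ is continuously differentiable at every $t\notin\{\tau_i\}$, the right derivative $x'_R(\tau_i)=x'(\tau_i+)$ exists for $0\le i\le k$ and the left derivative $x'_L(\tau_i)=x'(\tau_i-)$ exists for $1\le i\le k+1$. The extended derivative is $\underline d x(t):=x'(t)$ if $t\notin\{\tau_i\}$, $\underline d x(\tau_i):=x'_R(\tau_i)$ for $0\le i\le k$, $\underline d x(T):=x'_L(T)$. Differentials. $D_G\mathfrak f(x)$, $D_H\mathfrak f(x)$, $D_F\mathfrak f(x)$ are the Gâteaux, Hadamard, Fréchet differentials (continuous linear maps). $D_G\mathfrak f(x)\cdot v=\lim_{\theta\to0+}(\mathfrak f(x+\theta v)-\mathfrak f(x))/\theta$ for all $v$; $\mathfrak f$ is Hadamard differentiable at $x$ when moreover $\lim_{\theta\to0+,\,w\to v}(\mathfrak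 f(x+\theta w)-\mathfrak f(x))/\theta=D_H\mathfrak f(x)\cdot v$ for all $v$. A subscript $i$, as in $D_{G,i},D_{H,i},D_{F,i}$, denotes the partial differential with respect to the $i$-th variable. $E^*$ is the topological dual, $\mathcal L(E,E)$ the bounded linear operators. Problem $(\mathcal M)$: maximize $g^0(x(T))$ over the admissible processes, i.e. the pairs $(x,u)\in PC^1([0,T],\Omega)\times NPC^0_R([0,T],U)$ with $\underline d x(t)=f(t,x(t),u(t))$ for all $t\in[0,T]$, $x(0)=\xi_0$, $g^\alpha(x(T))\ge0$ for $1\le\alpha\le m$, and $h^\beta(x(T))=0$ for $1\le\beta\le q$. A solution is an admissible process attaining the maximum. *)

theory Defs
  imports "HOL-Analysis.Analysis"
begin

definition subdivision :: "real \<Rightarrow> nat \<Rightarrow> (nat \<Rightarrow> real) \<Rightarrow> bool" where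
  "subdivision T k \<tau> \<longleftrightarrow> \<tau> 0 = 0 \<and> \<tau> (Suc k) = T \<and> (\<forall>i\<le>k. \<tau> i < \<tau> (Suc i))"

text \<open>A function on the interval \<open>[0,T]\<close> is a total function on the reals of which only the values on
  \<open>{0..T}\<close> matter. A Hausdorff space \<open>W\<close> is a subset of a \<open>t2_space\<close> with the subspace topology,
  so one-sided limits are required to lie in \<open>W\<close>.\<close>

definition PC0 :: "real \<Rightarrow> 'w::t2_space set \<Rightarrow> (real \<Rightarrow> 'w) set" where
  "PC0 T W = {x. x ` {0..T} \<subseteq> W \<and>
     (continuous_on {0..T} x \<or>
      (\<exists>k \<tau>. subdivision T k \<tau> \<and>
         (\<forall>t\<in>{0..T} - \<tau> ` {0..Suc k}. continuous (at t within {0..T}) x) \<and>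
         (\<forall>i\<in>{0..k}. \<exists>l\<in>W. (x \<longlongrightarrow> l) (at_right (\<tau> i))) \<and>
         (\<forall>i\<in>{1..Suc k}. \<exists>l\<in>W. (x \<longlongrightarrow> l) (at_left (\<tau> i)))))}"

definition NPC0_R :: "real \<Rightarrow> 'w::t2_space set \<Rightarrow> (real \<Rightarrow> 'w) set" where
  "NPC0_R T W = {x \<in> PC0 T W. (\<forall>t\<in>{0..<T}. continuous (at_right t) x) \<and> continuous (at_left T) x}"

text \<open>The derivative of \<open>x\<close> as a function on \<open>[0,T]\<close>: one-sided at the two end points.\<close>

abbreviation deriv_on :: "real \<Rightarrow> (real \<Rightarrow> 'w::real_normed_vector) \<Rightarrow> real \<Rightarrow> 'w" where
  "deriv_on T x t \<equiv> vector_derivative x (at t within {0..T})"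

text \<open>Used only for sets \<open>S\<close> that are relatively open in \<open>{0..T}\<close>, so that the derivative exists
  in a neighbourhood of each point at which its continuity is required.\<close>

definition cont_diff_on :: "real \<Rightarrow> (real \<Rightarrow> 'w::real_normed_vector) \<Rightarrow> real set \<Rightarrow> bool" where
  "cont_diff_on T x S \<longleftrightarrow>
     (\<forall>t\<in>S. x differentiable (at t within {0..T}) \<and> continuous (at t within {0..T}) (deriv_on T x))"

definition PC1 :: "real \<Rightarrow> 'w::real_normed_vector set \<Rightarrow> (real \<Rightarrow> 'w) set" where
  "PC1 T W = {x. x ` {0..T} \<subseteq> W \<and> continuous_on {0..T} x \<and>
     (cont_diff_on T x {0..T} \<or>
      (\<exists>k \<tau>. subdivision T k \<tau> \<and>
         cont_diff_on T x ({0..T} - \<tau> ` {0..Suc k}) \<and>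
         (\<forall>i\<in>{0..k}. \<exists>d. (x has_vector_derivative d) (at_right (\<tau> i)) \<and>
            (deriv_on T x \<longlongrightarrow> d) (at_right (\<tau> i))) \<and>
         (\<forall>i\<in>{1..Suc k}. \<exists>d. (x has_vector_derivative d) (at_left (\<tau> i)) \<and>
            (deriv_on T x \<longlongrightarrow> d) (at_left (\<tau> i)))))}"

text \<open>The extended derivative does not depend on the subdivision: it is the right derivative on
  \<open>[0,T[\<close> and the left derivative at \<open>T\<close>. By the lemma \<open>ext_deriv_eq_deriv_on\<close> it is the ordinary
  derivative wherever the latter exists.\<close>

definition ext_deriv :: "real \<Rightarrow> (real \<Rightarrow> 'w::real_normed_vector) \<Rightarrow> real \<Rightarrow> 'w" where
  "ext_deriv T x t =
     (if t < T then vector_derivative x (at_right t) else vector_derivative x (at_left t))"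

lemma ext_deriv_eq_deriv_on:
  assumes "0 < T" "t \<in> {0..T}" "x differentiable (at t within {0..T})"
  shows "ext_deriv T x t = deriv_on T x t"
proof -
  have d: "(x has_vector_derivative deriv_on T x t) (at t within {0..T})"
    using assms(3) vector_derivative_works by blast
  show ?thesis
  proof (cases "t < T")
    case True
    have "at_right t = at t within {t..T}"
      using True by (simp add: at_within_Icc_at_right)
    moreover have "(x has_vector_derivative deriv_on T x t) (at t within {t..T})"
      by (rule has_vector_derivative_within_subset[OF d]) (use assms in auto)
    ultimately show ?thesis
      using True by (metis ext_deriv_def trivial_limit_at_right_real vector_derivative_within)
  next
    case False
    then have "t = T" using assms by auto
    have "at_left t = at t within {0..t}"
      using \<open>t = T\<close> assms by (simp add: at_within_Icc_at_left)
    moreover have "(x has_vector_derivative deriv_on T x t) (at t within {0..t})"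
      by (rule has_vector_derivative_within_subset[OF d]) (use assms in auto)
    ultimately show ?thesis
      using False by (metis ext_deriv_def trivial_limit_at_left_real vector_derivative_within)
  qed
qed

definition has_gateaux_differential ::
  "('a::real_normed_vector \<Rightarrow> 'b::real_normed_vector) \<Rightarrow> ('a \<Rightarrow>\<^sub>L 'b) \<Rightarrow> 'a \<Rightarrow> bool" where
  "has_gateaux_differential F D x \<longleftrightarrow>
     (\<forall>v. ((\<lambda>\<theta>. (F (x + \<theta> *\<^sub>R v) - F x) /\<^sub>R \<theta>) \<longlongrightarrow> blinfun_apply D v) (at_right 0))"

definition has_hadamard_differential ::
  "('a::real_normed_vector \<Rightarrow> 'b::real_normed_vector) \<Rightarrow> ('a \<Rightarrow>\<^sub>L 'b) \<Rightarrow> 'a \<Rightarrow> bool" where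
  "has_hadamard_differential F D x \<longleftrightarrow> has_gateaux_differential F D x \<and>
     (\<forall>v. ((\<lambda>(\<theta>, w). (F (x + \<theta> *\<^sub>R w) - F x) /\<^sub>R \<theta>) \<longlongrightarrow> blinfun_apply D v)
            (at_right 0 \<times>\<^sub>F nhds v))"

definition gateaux_differential ::
  "('a::real_normed_vector \<Rightarrow> 'b::real_normed_vector) \<Rightarrow> 'a \<Rightarrow> 'a \<Rightarrow>\<^sub>L 'b" where
  "gateaux_differential F x = (THE D. has_gateaux_differential F D x)"

definition hadamard_differential ::
  "('a::real_normed_vector \<Rightarrow> 'b::real_normed_vector) \<Rightarrow> 'a \<Rightarrow> 'a \<Rightarrow>\<^sub>L 'b" where
  "hadamard_differential F x = (THE D. has_hadamard_differential F D x)"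

definition frechet_differential ::
  "('a::real_normed_vector \<Rightarrow> 'b::real_normed_vector) \<Rightarrow> 'a \<Rightarrow> 'a \<Rightarrow>\<^sub>L 'b" where
  "frechet_differential F x = Blinfun (frechet_derivative F (at x))"

lemma has_gateaux_differential_unique:
  assumes "has_gateaux_differential F D x" "has_gateaux_differential F D' x"
  shows "D = D'"
proof (rule blinfun_eqI)
  fix v show "blinfun_apply D v = blinfun_apply D' v"
    using assms unfolding has_gateaux_differential_def
    by (meson tendsto_unique trivial_limit_at_right_real)
qed

lemma gateaux_differential_eq:
  "has_gateaux_differential F D x \<Longrightarrow> gateaux_differential F x = D"
  unfolding gateaux_differential_def by (blast intro: has_gateaux_differential_unique)

lemma hadamard_differential_eq:
  "has_hadamard_differential F D x \<Longrightarrow> hadamard_differential F x = D"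
  unfolding hadamard_differential_def
  by (blast intro: has_gateaux_differential_unique dest: has_hadamard_differential_def[THEN iffD1])

lemma frechet_differential_eq:
  assumes "(F has_derivative blinfun_apply D) (at x)"
  shows "frechet_differential F x = D"
  unfolding frechet_differential_def frechet_derivative_at[OF assms, symmetric]
  by (rule blinfun_apply_inverse)

definition admissible ::
  "real \<Rightarrow> 'a::real_normed_vector set \<Rightarrow> 'u::t2_space set \<Rightarrow> 'a \<Rightarrow> (real \<Rightarrow> 'a \<Rightarrow> 'u \<Rightarrow> 'a) \<Rightarrow>
   nat \<Rightarrow> (nat \<Rightarrow> 'a \<Rightarrow> real) \<Rightarrow> nat \<Rightarrow> (nat \<Rightarrow> 'a \<Rightarrow> real) \<Rightarrow> (real \<Rightarrow> 'a) \<Rightarrow> (real \<Rightarrow> 'u) \<Rightarrow> bool" where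
  "admissible T \<Omega> U \<xi>\<^sub>0 f m g q h x u \<longleftrightarrow>
     x \<in> PC1 T \<Omega> \<and> u \<in> NPC0_R T U \<and>
     (\<forall>t\<in>{0..T}. ext_deriv T x t = f t (x t) (u t)) \<and>
     x 0 = \<xi>\<^sub>0 \<and>
     (\<forall>\<alpha>\<in>{1..m}. g \<alpha> (x T) \<ge> 0) \<and>
     (\<forall>\<beta>\<in>{1..q}. h \<beta> (x T) = 0)"

definition mayer_solution ::
  "real \<Rightarrow> 'a::real_normed_vector set \<Rightarrow> 'u::t2_space set \<Rightarrow> 'a \<Rightarrow> (real \<Rightarrow> 'a \<Rightarrow> 'u \<Rightarrow> 'a) \<Rightarrow>
   nat \<Rightarrow> (nat \<Rightarrow> 'a \<Rightarrow> real) \<Rightarrow> nat \<Rightarrow> (nat \<Rightarrow> 'a \<Rightarrow> real) \<Rightarrow> (real \<Rightarrow> 'a) \<Rightarrow> (real \<Rightarrow> 'u) \<Rightarrow> bool" where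
  "mayer_solution T \<Omega> U \<xi>\<^sub>0 f m g q h x\<^sub>0 u\<^sub>0 \<longleftrightarrow>
     admissible T \<Omega> U \<xi>\<^sub>0 f m g q h x\<^sub>0 u\<^sub>0 \<and>
     (\<forall>x u. admissible T \<Omega> U \<xi>\<^sub>0 f m g q h x u \<longrightarrow> g 0 (x T) \<le> g 0 (x\<^sub>0 T))"

definition hamiltonian ::
  "(real \<Rightarrow> 'a::real_normed_vector \<Rightarrow> 'u \<Rightarrow> 'a) \<Rightarrow> real \<Rightarrow> 'a \<Rightarrow> 'u \<Rightarrow> ('a \<Rightarrow>\<^sub>L real) \<Rightarrow> real" where
  "hamiltonian f t \<xi> \<zeta> p = blinfun_apply p (f t \<xi> \<zeta>)"

end

theory Submission
  imports Defs
begin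

text \<open>The proof perturbs the optimal control by needles and reads off the multipliers from the end points
that can be reached to first order.

Fix finitely many pairs of a time \<open>\<tau>\<^sub>i < T\<close> and a control value \<open>\<zeta>\<^sub>i\<close>. For small weights \<open>a\<^sub>i \<ge> 0\<close>
let \<open>u\<^sub>a\<close> take the value \<open>\<zeta>\<^sub>i\<close> on an interval of length \<open>a\<^sub>i\<close> that starts at \<open>\<tau>\<^sub>i\<close>, shifted to the
right by the weights of the earlier needles, so that the intervals never overlap even when times
coincide. The differential equation driven by \<open>u\<^sub>a\<close> has a solution \<open>x\<^sub>a\<close> on all of \<open>[0,T]\<close>: boundedness
of the Gateaux differentials on compact sets already gives a uniform Lipschitz constant in a tube
around \<open>x\<^sub>0\<close> (\<open>lipschitz_tube\<close>), because a sequence along which the differentials blow up would,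
together with its limit, be such a compact set. A weighted contraction then solves the
integral equation inside the tube (\<open>integral_equation_tube\<close>).

The end point \<open>x\<^sub>a(T)\<close> is continuous in \<open>a\<close> and differentiable at \<open>a = 0\<close> with derivative
\<open>\<Sum>\<^sub>i a\<^sub>i v\<^sub>i\<close>, where \<open>v\<^sub>i = R(\<tau>\<^sub>i)(f(\<tau>\<^sub>i,x\<^sub>0(\<tau>\<^sub>i),\<zeta>\<^sub>i) - f(\<tau>\<^sub>i,x\<^sub>0(\<tau>\<^sub>i),u\<^sub>0(\<tau>\<^sub>i)))\<close> and \<open>R(t)\<close> is the resolvent from
time \<open>t\<close> to time \<open>T\<close> of the linearized equation, the solution of \<open>R' = - R A\<close> with \<open>R(T) = id\<close>
(\<open>backward_resolvent\<close>). Applying \<open>R\<close> to \<open>x\<^sub>a - x\<^sub>0\<close> before integrating removes the linear part,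
so that only the needles and a remainder are left. Frechet differentiability along \<open>x\<^sub>0\<close> need not be
uniform in time; dominated convergence nevertheless makes the integral of the remainder
\<open>o(|a|)\<close> (\<open>first_order_expansion\<close>).

What remains is a multiplier rule in finitely many coordinates (\<open>multiplier_rule\<close>). Let the
convex cone \<open>K\<close> consist of the values that the differentials of \<open>g\<^sup>0\<close>, of the active \<open>g\<^sup>\<alpha>\<close> and of the \<open>h\<^sup>\<beta>\<close> take at
nonnegative combinations of the \<open>v\<^sub>i\<close>, lowered arbitrarily in the \<open>g\<close>-coordinates. Either a nonzero
functional is nonpositive on \<open>K\<close>, and its coefficients are the multipliers, or \<open>K\<close> is dense
(\<open>convex_cone_dense_or_functional\<close>). In the second case one finds combinations that increase
\<open>g\<^sup>0\<close> and every active \<open>g\<^sup>\<alpha>\<close> and move \<open>h\<close> approximately along each positive and negative coordinate axis; the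
Poincare-Miranda theorem then produces a perturbation with \<open>h = 0\<close> exactly, which contradicts
optimality.

With the functional \<open>\<pi> = \<Sum> \<lambda>\<^sub>\<alpha> Dg\<^sup>\<alpha> + \<Sum> \<mu>\<^sub>\<beta> Dh\<^sup>\<beta>\<close> the adjoint state is \<open>p(t) = \<pi> R(t)\<close>. It
satisfies the adjoint equation since \<open>R\<close> does, and \<open>\<pi> v \<le> 0\<close> on the needle directions is the maximum
condition for \<open>t < T\<close>; the value at \<open>T\<close> and the continuity of the Hamiltonian follow from one-sided limits.\<close>

section \<open>Normalized piecewise continuous functions\<close>

text \<open>The elements of \<open>NPC0_R T W\<close> described by a finite set \<open>S\<close> of exceptional times in place of an
ordered subdivision: finite sets can be merged and enlarged freely when controls are modified and
functions combined. Right and left limits are required at every time, which costs nothing away from \<open>S\<close>.\<close>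

definition npc :: "real \<Rightarrow> 'w::t2_space set \<Rightarrow> real set \<Rightarrow> (real \<Rightarrow> 'w) \<Rightarrow> bool" where
  "npc T W S u \<longleftrightarrow> finite S \<and> u ` {0..T} \<subseteq> W \<and>
     (\<forall>t\<in>{0..T} - S. continuous (at t within {0..T}) u) \<and>
     (\<forall>t\<in>{0..<T}. (u \<longlongrightarrow> u t) (at_right t)) \<and>
     (\<forall>t\<in>{0<..T}. \<exists>l\<in>W. (u \<longlongrightarrow> l) (at_left t)) \<and>
     (u \<longlongrightarrow> u T) (at_left T)"

lemma subdivision_less:
  assumes "subdivision T k \<tau>" "i < j" "j \<le> Suc k"
  shows "\<tau> i < \<tau> j"
  using assms(2,3)
proof (induction j)
  case (Suc j)
  have "\<tau> j < \<tau> (Suc j)" using assms(1) Suc.prems by (auto simp: subdivision_def)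
  then show ?case using Suc by (cases "i = j") auto
qed simp

lemma subdivision_mem:
  assumes "subdivision T k \<tau>" "i \<le> Suc k"
  shows "\<tau> i \<in> {0..T}"
proof -
  have "\<tau> 0 \<le> \<tau> i" using subdivision_less[OF assms(1), of 0 i] assms(2) by (cases "i = 0") auto
  moreover have "\<tau> i \<le> \<tau> (Suc k)"
    using subdivision_less[OF assms(1), of i "Suc k"] assms(2) by (cases "i = Suc k") auto
  ultimately show ?thesis using assms(1) by (auto simp: subdivision_def)
qed

text \<open>Sorting \<open>S \<union> {0, T}\<close> turns a finite exceptional set back into a subdivision.\<close>

lemma subdivision_exists:
  assumes "finite S" "(0::real) < T"
  shows "\<exists>k \<tau>. subdivision T k \<tau> \<and> S \<inter> {0..T} \<subseteq> \<tau> ` {0..Suc k}"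
proof -
  define A where "A = insert 0 (insert T (S \<inter> {0..T}))"
  define xs where "xs = sorted_list_of_set A"
  have fA: "finite A" using assms by (simp add: A_def)
  have set: "set xs = A" and sorted: "sorted_wrt (<) xs"
    using fA by (auto simp: xs_def strict_sorted_list_of_set)
  have "card {0, T} \<le> card A" by (rule card_mono[OF fA]) (auto simp: A_def)
  then have len: "2 \<le> length xs" using assms by (simp add: xs_def)
  define k where "k = length xs - 2"
  have lenk: "length xs = Suc (Suc k)" using len by (simp add: k_def)
  have step: "xs ! i < xs ! j" if "i < j" "j \<le> Suc k" for i j
    using sorted_wrt_nth_less[OF sorted that(1)] that lenk by simp
  obtain i where i: "i \<le> Suc k" "xs ! i = 0"
    using set lenk by (metis A_def in_set_conv_nth insertI1 less_Suc_eq_le)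
  have "xs ! 0 \<in> A" "xs ! Suc k \<in> A" using set lenk by (metis nth_mem zero_less_Suc lessI)+
  then have "0 \<le> xs ! 0" "xs ! Suc k \<le> T" using assms by (auto simp: A_def)
  then have 0: "xs ! 0 = 0" using i step[of 0 i] by (cases "i = 0") auto
  obtain j where j: "j \<le> Suc k" "xs ! j = T"
    using set lenk by (metis A_def in_set_conv_nth insertI1 insertI2 less_Suc_eq_le)
  have 1: "xs ! Suc k = T" using j step[of j "Suc k"] \<open>xs ! Suc k \<le> T\<close> by (cases "j = Suc k") auto
  have "subdivision T k ((!) xs)" unfolding subdivision_def using 0 1 step by auto
  moreover have "S \<inter> {0..T} \<subseteq> (!) xs ` {0..Suc k}"
  proof
    fix x assume "x \<in> S \<inter> {0..T}"
    then have "x \<in> set xs" using set by (auto simp: A_def)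
    then obtain i where "i < length xs" "xs ! i = x" by (auto simp: in_set_conv_nth)
    then show "x \<in> (!) xs ` {0..Suc k}" using lenk by auto
  qed
  ultimately show ?thesis by blast
qed

lemma continuous_within_sing: "continuous (at x within {x}) f"
  using continuous_on_sing[of x f] by (simp add: continuous_on_eq_continuous_within)

lemma tendsto_at_left_if_continuous:
  assumes "continuous (at t within {0..T}) u" "(0::real) < t" "t \<le> T"
  shows "(u \<longlongrightarrow> u t) (at_left t)"
proof -
  have "(u \<longlongrightarrow> u t) (at t within {0..t})"
    by (rule tendsto_within_subset[OF assms(1)[unfolded continuous_within]]) (use assms in auto)
  then show ?thesis using at_within_Icc_at_left[OF assms(2)] by simp
qed

lemma NPC0_R_imp_npc:
  assumes "u \<in> NPC0_R T W" "0 < T"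
  shows "\<exists>S. npc T W S u"
proof -
  have W: "u ` {0..T} \<subseteq> W" and right: "\<And>t. t \<in> {0..<T} \<Longrightarrow> (u \<longlongrightarrow> u t) (at_right t)"
    and left: "(u \<longlongrightarrow> u T) (at_left T)"
    using assms by (auto simp: NPC0_R_def PC0_def continuous_within)
  have limW: "\<exists>l\<in>W. (u \<longlongrightarrow> l) (at_left t)" 
    if "continuous (at t within {0..T}) u" "t \<in> {0<..T}" for t
    using tendsto_at_left_if_continuous[OF that(1)] that(2) W
    by (intro bexI[of _ "u t"]) auto
  consider "continuous_on {0..T} u" | k \<tau> where "subdivision T k \<tau>"
    "\<forall>t\<in>{0..T} - \<tau> ` {0..Suc k}. continuous (at t within {0..T}) u"
    "\<forall>i\<in>{1..Suc k}. \<exists>l\<in>W. (u \<longlongrightarrow> l) (at_left (\<tau> i))"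
    using assms by (auto simp: NPC0_R_def PC0_def)
  then show ?thesis
  proof cases
    case 1
    then have "npc T W {} u"
      using W right left limW by (auto simp: npc_def continuous_on_eq_continuous_within)
    then show ?thesis by blast
  next
    case 2
    have "\<exists>l\<in>W. (u \<longlongrightarrow> l) (at_left t)" if t: "t \<in> {0<..T}" for t
    proof (cases "t \<in> \<tau> ` {0..Suc k}")
      case True
      then obtain i where "i \<le> Suc k" "t = \<tau> i" by auto
      moreover have "i \<noteq> 0" using t calculation 2(1) by (intro notI) (simp add: subdivision_def)
      ultimately show ?thesis using 2(3) by auto
    next
      case False
      then show ?thesis using 2(2) t by (intro limW) auto
    qed
    then have "npc T W (\<tau> ` {0..Suc k}) u"
      using W right left 2(2) by (auto simp: npc_def)
    then show ?thesis by blast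
  qed
qed

lemma npc_imp_NPC0_R:
  assumes "npc T W S u" "0 < T"
  shows "u \<in> NPC0_R T W"
proof -
  obtain k \<tau> where sub: "subdivision T k \<tau>" and S: "S \<inter> {0..T} \<subseteq> \<tau> ` {0..Suc k}"
    using subdivision_exists[of S T] assms by (auto simp: npc_def)
  have W: "u ` {0..T} \<subseteq> W" using assms by (simp add: npc_def)
  have "\<forall>i\<in>{0..k}. \<exists>l\<in>W. (u \<longlongrightarrow> l) (at_right (\<tau> i))"
  proof
    fix i assume i: "i \<in> {0..k}"
    have "\<tau> i \<in> {0..<T}"
      using subdivision_mem[OF sub, of i] subdivision_less[OF sub, of i "Suc k"] i sub
      by (auto simp: subdivision_def)
    then show "\<exists>l\<in>W. (u \<longlongrightarrow> l) (at_right (\<tau> i))"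
      using assms(1) W by (intro bexI[of _ "u (\<tau> i)"]) (auto simp: npc_def)
  qed
  moreover have "\<forall>i\<in>{1..Suc k}. \<exists>l\<in>W. (u \<longlongrightarrow> l) (at_left (\<tau> i))"
  proof
    fix i assume i: "i \<in> {1..Suc k}"
    have "\<tau> i \<in> {0<..T}"
      using subdivision_mem[OF sub, of i] subdivision_less[OF sub, of 0 i] i sub
      by (auto simp: subdivision_def)
    then show "\<exists>l\<in>W. (u \<longlongrightarrow> l) (at_left (\<tau> i))"
      using assms(1) by (auto simp: npc_def)
  qed
  moreover have "\<forall>t\<in>{0..T} - \<tau> ` {0..Suc k}. continuous (at t within {0..T}) u"
    using assms(1) S by (auto simp: npc_def)
  ultimately have "u \<in> PC0 T W" using sub W by (auto simp: PC0_def)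
  then show ?thesis using assms(1) by (auto simp: NPC0_R_def npc_def continuous_within)
qed

lemma eventually_at_right_mem: "\<lbrakk>0 \<le> t; t < T\<rbrakk> \<Longrightarrow> eventually (\<lambda>s. s \<in> {0..T}) (at_right (t::real))"
  by (auto simp: eventually_at_right_field intro!: exI[of _ T])

lemma eventually_at_left_mem: "\<lbrakk>0 < t; t \<le> T\<rbrakk> \<Longrightarrow> eventually (\<lambda>s. s \<in> {0..T}) (at_left (t::real))"
  by (auto simp: eventually_at_left_field intro!: exI[of _ 0])

lemma tendsto_comp_pair:
  assumes G: "continuous_on (A \<times> U) (\<lambda>(t, \<zeta>). G t \<zeta>)"
    and u: "(u \<longlongrightarrow> l) F" "eventually (\<lambda>s. u s \<in> U) F" "l \<in> U"
    and t: "((\<lambda>s. s) \<longlongrightarrow> t) F" "eventually (\<lambda>s. s \<in> A) F" "t \<in> A"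
  shows "((\<lambda>s. G s (u s)) \<longlongrightarrow> G t l) F"
proof -
  have "((\<lambda>s. (\<lambda>(t, \<zeta>). G t \<zeta>) (s, u s)) \<longlongrightarrow> (\<lambda>(t, \<zeta>). G t \<zeta>) (t, l)) F"
  proof (rule continuous_on_tendsto_compose[OF G tendsto_Pair[OF t(1) u(1)]])
    show "eventually (\<lambda>s. (s, u s) \<in> A \<times> U) F"
      using eventually_conj[OF t(2) u(2)] by simp
  qed (use assms in auto)
  then show ?thesis by simp
qed

text \<open>All piecewise continuous functions below arise by inserting a control into a function continuous in
time and control value. The one-sided limits of the control lie in \<open>U\<close>, where \<open>G\<close> is continuous.\<close>

lemma npc_comp:
  assumes u: "npc T U S u"
    and G: "continuous_on ({0..T} \<times> U) (\<lambda>(t, \<zeta>). G t \<zeta>)"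
    and W: "\<And>t \<zeta>. t \<in> {0..T} \<Longrightarrow> \<zeta> \<in> U \<Longrightarrow> G t \<zeta> \<in> W"
    and T: "0 < T"
  shows "npc T W S (\<lambda>t. G t (u t))"
proof -
  have U: "u t \<in> U" if "t \<in> {0..T}" for t using u that by (auto simp: npc_def)
  show ?thesis
    unfolding npc_def
  proof (intro conjI ballI)
    show "finite S" using u by (simp add: npc_def)
    show "(\<lambda>t. G t (u t)) ` {0..T} \<subseteq> W" using W U by auto
  next
    fix t assume t: "t \<in> {0..T} - S"
    show "continuous (at t within {0..T}) (\<lambda>t. G t (u t))"
      unfolding continuous_within
      by (rule tendsto_comp_pair[OF G])
        (use u t U in \<open>auto simp: npc_def continuous_within eventually_at_filter\<close>)
  next
    fix t assume t: "t \<in> {0..<T}"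
    have ev: "eventually (\<lambda>s. s \<in> {0..T}) (at_right t)"
      using t by (intro eventually_at_right_mem) auto
    show "((\<lambda>t. G t (u t)) \<longlongrightarrow> G t (u t)) (at_right t)"
      by (rule tendsto_comp_pair[OF G _ eventually_mono[OF ev] _ _ ev])
        (use u t U in \<open>auto simp: npc_def\<close>)
  next
    fix t assume t: "t \<in> {0<..T}"
    then obtain l where l: "l \<in> U" "(u \<longlongrightarrow> l) (at_left t)" using u unfolding npc_def by blast
    have ev: "eventually (\<lambda>s. s \<in> {0..T}) (at_left t)"
      using t by (intro eventually_at_left_mem) auto
    have "((\<lambda>t. G t (u t)) \<longlongrightarrow> G t l) (at_left t)"
      by (rule tendsto_comp_pair[OF G _ eventually_mono[OF ev] _ _ ev])
        (use t U l in auto)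
    then show "\<exists>l\<in>W. ((\<lambda>t. G t (u t)) \<longlongrightarrow> l) (at_left t)" using W l t by force
  next
    have ev: "eventually (\<lambda>s. s \<in> {0..T}) (at_left T)"
      using T by (intro eventually_at_left_mem) auto
    show "((\<lambda>t. G t (u t)) \<longlongrightarrow> G T (u T)) (at_left T)"
      by (rule tendsto_comp_pair[OF G _ eventually_mono[OF ev] _ _ ev])
        (use u U T in \<open>auto simp: npc_def\<close>)
  qed
qed

text \<open>Up to the value at \<open>x\<close>, the function \<open>u\<close> extends continuously to \<open>[a,x]\<close> and to \<open>[x,b]\<close>.\<close>

definition one_sided_extensions :: "'w::t2_space set \<Rightarrow> (real \<Rightarrow> 'w) \<Rightarrow> real \<Rightarrow> real \<Rightarrow> real \<Rightarrow> bool" where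
  "one_sided_extensions W u a x b \<longleftrightarrow> (\<exists>v w. continuous_on {a..x} v \<and> v ` {a..x} \<subseteq> W \<and> (\<forall>s\<in>{a..<x}. v s = u s) \<and>
            continuous_on {x..b} w \<and> w ` {x..b} \<subseteq> W \<and> (\<forall>s\<in>{x<..b}. w s = u s))"

text \<open>Near \<open>x\<close> the exceptional set contains at most \<open>x\<close> itself, so that on each side the function is
continuous once its value at \<open>x\<close> is replaced by the one-sided limit.\<close>

lemma npc_local:
  assumes u: "npc T W S u" and x: "0 \<le> x" "x \<le> T"
  shows "\<exists>d>0. \<forall>a b. a \<le> x \<and> x \<le> b \<and> b - a < d \<and> 0 \<le> a \<and> b \<le> T \<longrightarrow>
     one_sided_extensions W u a x b"
proof -
  have fin: "finite (S - {x})" using u by (simp add: npc_def)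
  obtain d where d: "d > 0" "\<And>s. s \<in> S \<Longrightarrow> s \<noteq> x \<Longrightarrow> d \<le> dist x s"
    using finite_set_avoid[OF fin, of x] by auto
  have W: "u s \<in> W" if "0 \<le> s" "s \<le> T" for s using u that by (auto simp: npc_def)
  show ?thesis
  proof (intro exI[of _ d] conjI allI impI)
    fix a b assume ab: "a \<le> x \<and> x \<le> b \<and> b - a < d \<and> 0 \<le> a \<and> b \<le> T"
    have cont: "continuous (at s within {0..T}) u" if "s \<in> {a..b}" "s \<noteq> x" for s
    proof -
      have "s \<notin> S" using d(2)[of s] that ab by (auto simp: dist_real_def)
      then show ?thesis using u ab that by (auto simp: npc_def)
    qed
    obtain l where l: "l \<in> W" "a < x \<Longrightarrow> (u \<longlongrightarrow> l) (at_left x)"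
    proof (cases "a < x")
      case True
      then show ?thesis using that u ab unfolding npc_def by (metis greaterThanAtMost_iff le_less_trans x(2))
    next
      case False
      then show ?thesis using that W x by blast
    qed
    define v where "v = (\<lambda>s. if s = x then l else u s)"
    have v: "continuous_on {a..x} v"
      unfolding continuous_on_eq_continuous_within
    proof
      fix s assume s: "s \<in> {a..x}"
      show "continuous (at s within {a..x}) v"
      proof (cases "s = x")
        case True
        show ?thesis
        proof (cases "a < x")
          case a: True
          have "(v \<longlongrightarrow> l) (at_left x)"
            using l(2)[OF a] by (rule Lim_transform_eventually) (auto simp: v_def eventually_at_filter)
          then show ?thesis using True at_within_Icc_at_left[OF a] by (simp add: continuous_within v_def)
        next
          case False
          then have "{a..x} = {x}" using s True by auto
          then show ?thesis
            by (simp only: True) (rule continuous_within_sing)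
        qed
      next
        case False
        have "continuous (at s within {a..x}) u"
          by (rule continuous_within_subset[OF cont]) (use s False ab in auto)
        then show ?thesis
          by (rule continuous_transform_within[where \<delta>="dist s x"])
            (use s False in \<open>auto simp: v_def dist_real_def\<close>)
      qed
    qed
    have w: "continuous_on {x..b} u"
      unfolding continuous_on_eq_continuous_within
    proof
      fix s assume s: "s \<in> {x..b}"
      show "continuous (at s within {x..b}) u"
      proof (cases "s = x")
        case True
        show ?thesis
        proof (cases "x < b")
          case b: True
          then have "(u \<longlongrightarrow> u x) (at_right x)" using u x ab by (auto simp: npc_def)
          then show ?thesis using True at_within_Icc_at_right[OF b] by (simp add: continuous_within)
        next
          case False
          then have "{x..b} = {x}" using s True by auto
          then show ?thesis
            by (simp only: True) (rule continuous_within_sing)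
        qed
      next
        case False
        show ?thesis
          by (rule continuous_within_subset[OF cont]) (use s False ab in auto)
      qed
    qed
    show "one_sided_extensions W u a x b" unfolding one_sided_extensions_def
      using v w l(1) W ab by (intro exI[of _ v] exI[of _ u]) (auto simp: v_def)
  qed (use d in auto)
qed

text \<open>The range itself need not be closed, as left limits may be missing from it. The compact set is assembled by
Bolzano bisection from images of continuous one-sided extensions.\<close>

lemma npc_compact_range:
  assumes u: "npc T W S u" and T: "0 < T"
  obtains M where "compact M" "M \<subseteq> W" "u ` {0..T} \<subseteq> M"
proof -
  define P where "P a b \<longleftrightarrow> 0 \<le> a \<and> b \<le> T \<longrightarrow> (\<exists>M. compact M \<and> M \<subseteq> W \<and> u ` {a..b} \<subseteq> M)" for a b
  have "P 0 T"
  proof (rule Bolzano)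
    fix a b c :: real assume *: "P a b" "P b c" "a \<le> b" "b \<le> c"
    show "P a c"
      unfolding P_def
    proof
      assume "0 \<le> a \<and> c \<le> T"
      then have "0 \<le> a \<and> b \<le> T" "0 \<le> b \<and> c \<le> T" using * by auto
      then obtain M N where "compact M" "M \<subseteq> W" "u ` {a..b} \<subseteq> M" "compact N" "N \<subseteq> W" "u ` {b..c} \<subseteq> N"
        using *(1,2) unfolding P_def by blast
      moreover have "{a..c} = {a..b} \<union> {b..c}" using * by auto
      ultimately show "\<exists>M. compact M \<and> M \<subseteq> W \<and> u ` {a..c} \<subseteq> M"
        by (intro exI[of _ "M \<union> N"]) (simp add: image_Un le_supI1 le_supI2 compact_Un)
    qed
  next
    fix x assume x: "0 \<le> x" "x \<le> T"
    then have ux: "u x \<in> W" using u by (auto simp: npc_def)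
    obtain d where d: "d > 0" "\<And>a b. a \<le> x \<Longrightarrow> x \<le> b \<Longrightarrow> b - a < d \<Longrightarrow> 0 \<le> a \<Longrightarrow> b \<le> T \<Longrightarrow>
     one_sided_extensions W u a x b"
      using npc_local[OF u x] by blast
    show "\<exists>d>0. \<forall>a b. a \<le> x \<and> x \<le> b \<and> b - a < d \<longrightarrow> P a b"
    proof (intro exI[of _ d] conjI allI impI d(1), unfold P_def, intro impI)
      fix a b assume ab: "a \<le> x \<and> x \<le> b \<and> b - a < d" "0 \<le> a \<and> b \<le> T"
      then obtain v w where *: "continuous_on {a..x} v" "v ` {a..x} \<subseteq> W" "\<forall>s\<in>{a..<x}. v s = u s"
        "continuous_on {x..b} w" "w ` {x..b} \<subseteq> W" "\<forall>s\<in>{x<..b}. w s = u s"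
        using d(2)[of a b] unfolding one_sided_extensions_def by auto
      have "compact (insert (u x) (v ` {a..x} \<union> w ` {x..b}))"
        by (intro compact_insert compact_Un compact_continuous_image * compact_Icc)
      moreover have "u ` {a..b} \<subseteq> insert (u x) (v ` {a..x} \<union> w ` {x..b})"
      proof (intro image_subsetI)
        fix s assume "s \<in> {a..b}"
        then consider "s = x" | "s \<in> {a..<x}" | "s \<in> {x<..b}" by force
        then show "u s \<in> insert (u x) (v ` {a..x} \<union> w ` {x..b})"
        proof cases
          case 2 then have "u s = v s" "s \<in> {a..x}" using * by auto then show ?thesis by auto
        next
          case 3 then have "u s = w s" "s \<in> {x..b}" using * by auto then show ?thesis by auto
        qed auto
      qed
      ultimately show "\<exists>M. compact M \<and> M \<subseteq> W \<and> u ` {a..b} \<subseteq> M"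
        using * ux by (intro exI[of _ "insert (u x) (v ` {a..x} \<union> w ` {x..b})"]) auto
    qed
  qed (use T in auto)
  then obtain M where "compact M" "M \<subseteq> W" "u ` {0..T} \<subseteq> M" unfolding P_def by auto
  then show ?thesis by (rule that)
qed

text \<open>Functions with values in a Banach space are integrated in the gauge sense; integrability again propagates from the
one-sided continuous extensions by bisection.\<close>

lemma npc_integrable:
  fixes u :: "real \<Rightarrow> 'b::banach"
  assumes u: "npc T W S u" and T: "0 < T"
  shows "u integrable_on {0..T}"
proof -
  define P where "P a b \<longleftrightarrow> 0 \<le> a \<and> b \<le> T \<longrightarrow> u integrable_on {a..b}" for a b
  have "P 0 T"
  proof (rule Bolzano)
    fix a b c :: real assume *: "P a b" "P b c" "a \<le> b" "b \<le> c"
    show "P a c"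
      unfolding P_def
    proof
      assume "0 \<le> a \<and> c \<le> T"
      then have "u integrable_on {a..b}" "u integrable_on {b..c}" using * by (auto simp: P_def)
      then show "u integrable_on {a..c}"
        by (rule Henstock_Kurzweil_Integration.integrable_combine[OF *(3,4)])
    qed
  next
    fix x assume x: "0 \<le> x" "x \<le> T"
    obtain d where d: "d > 0" "\<And>a b. a \<le> x \<Longrightarrow> x \<le> b \<Longrightarrow> b - a < d \<Longrightarrow> 0 \<le> a \<Longrightarrow> b \<le> T \<Longrightarrow>
     one_sided_extensions W u a x b"
      using npc_local[OF u x] by blast
    show "\<exists>d>0. \<forall>a b. a \<le> x \<and> x \<le> b \<and> b - a < d \<longrightarrow> P a b"
    proof (intro exI[of _ d] conjI allI impI d(1), unfold P_def, intro impI)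
      fix a b assume ab: "a \<le> x \<and> x \<le> b \<and> b - a < d" "0 \<le> a \<and> b \<le> T"
      then obtain v w where *: "continuous_on {a..x} v" "\<forall>s\<in>{a..<x}. v s = u s"
        "continuous_on {x..b} w" "\<forall>s\<in>{x<..b}. w s = u s"
        using d(2)[of a b] unfolding one_sided_extensions_def by auto
      have "u integrable_on {a..x}"
        by (rule integrable_spike_finite[of "{x}", OF _ _ integrable_continuous_real[OF *(1)]]) (use * in auto)
      moreover have "u integrable_on {x..b}"
        by (rule integrable_spike_finite[of "{x}", OF _ _ integrable_continuous_real[OF *(3)]]) (use * in auto)
      ultimately show "u integrable_on {a..b}"
        using ab by (intro Henstock_Kurzweil_Integration.integrable_combine[of a x b]) auto
    qed
  qed (use T in auto)
  then show ?thesis unfolding P_def by auto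
qed

lemma eventually_notin_finite:
  assumes "finite (S::real set)"
  shows "eventually (\<lambda>s. s \<notin> S) (at t within A)"
proof -
  obtain d where "d > 0" "\<And>s. s \<in> S \<Longrightarrow> s \<noteq> t \<Longrightarrow> d \<le> dist t s"
    using finite_set_avoid[OF assms, of t] by auto
  then show ?thesis
    unfolding eventually_at by (intro exI[of _ d]) (auto simp: dist_commute not_le[symmetric])
qed

text \<open>A continuous function is the integral of its derivative, the integrand being irrelevant at finitely
many times. After changing the integrand at one time to its one-sided limit there, that limit is
the one-sided derivative; this gives all the conditions in \<open>PC1\<close> at once.\<close>

lemma PC1I_npc:
  fixes x \<phi> :: "real \<Rightarrow> 'b::banach"
  assumes T: "0 < T" and W: "x ` {0..T} \<subseteq> W" and x: "continuous_on {0..T} x"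
    and fin: "finite S'"
    and deriv: "\<And>t. t \<in> {0<..<T} - S' \<Longrightarrow> (x has_vector_derivative \<phi> t) (at t)"
    and \<phi>: "npc T V S \<phi>"
  shows "x \<in> PC1 T W" "\<And>t. t \<in> {0..T} \<Longrightarrow> ext_deriv T x t = \<phi> t"
proof -
  have int: "\<phi> integrable_on {0..T}" using npc_integrable[OF \<phi> T] .
  have rep: "(\<phi> has_integral (x b - x a)) {a..b}" if "0 \<le> a" "a \<le> b" "b \<le> T" for a b
    by (rule fundamental_theorem_of_calculus_interior_strong[OF fin \<open>a \<le> b\<close>])
      (use deriv that continuous_on_subset[OF x] in auto)
  have within: "(x has_vector_derivative l) (at t within {a..b})"
    if ab: "0 \<le> a" "b \<le> T" "t \<in> {a..b}" and l: "(\<phi> \<longlongrightarrow> l) (at t within {a..b})" for a b t l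
  proof -
    define \<psi> where "\<psi> s = (if s = t then l else \<phi> s)" for s
    have r: "(\<psi> has_integral (x s - x a)) {a..s}" if "s \<in> {a..b}" for s
      by (rule has_integral_spike_finite[of "{t}", OF _ _ rep]) (use that ab in \<open>auto simp: \<psi>_def\<close>)
    have "continuous (at t within {a..b}) \<psi>"
      unfolding continuous_within
      using l by (rule Lim_transform_eventually[THEN tendsto_eq_rhs]) (auto simp: \<psi>_def eventually_at_filter)
    moreover have "\<psi> integrable_on {a..b}" using r[of b] ab by (auto simp: integrable_on_def)
    ultimately have "((\<lambda>s. integral {a..s} \<psi>) has_vector_derivative l) (at t within {a..b})"
      using integral_has_vector_derivative_continuous_at[of \<psi> a b t "{}"] ab(3) by (simp add: \<psi>_def)
    then have "((\<lambda>s. x a + integral {a..s} \<psi>) has_vector_derivative l) (at t within {a..b})"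
      by (auto intro!: derivative_eq_intros)
    then show ?thesis
      by (rule has_vector_derivative_transform[rotated 2]) (use ab integral_unique[OF r] in auto)
  qed
  have right: "(x has_vector_derivative \<phi> t) (at_right t)" if "t \<in> {0..<T}" for t
    using within[of t T t "\<phi> t"] \<phi> that by (auto simp: npc_def at_within_Icc_at_right)
  have left: "(x has_vector_derivative l) (at_left t)" if "t \<in> {0<..T}" "(\<phi> \<longlongrightarrow> l) (at_left t)" for t l
    using within[of 0 t t l] that by (auto simp: at_within_Icc_at_left)
  have full: "(x has_vector_derivative \<phi> t) (at t within {0..T})" if "t \<in> {0..T} - S" for t
    using within[of 0 T t "\<phi> t"] \<phi> that by (auto simp: npc_def continuous_within)
  have eq: "deriv_on T x t = \<phi> t" if "t \<in> {0..T} - S" for t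
    using vector_derivative_within_cbox[of 0 T t x "\<phi> t"] full[OF that] T that by auto
  have ext: "ext_deriv T x t = \<phi> t" if "t \<in> {0..T}" for t
  proof (cases "t < T")
    case True
    then show ?thesis unfolding ext_deriv_def
      using vector_derivative_within[OF _ right[of t]] that by auto
  next
    case False
    then have "t = T" using that by auto
    then show ?thesis unfolding ext_deriv_def
      using vector_derivative_within[OF _ left[of T "\<phi> T"]] T \<phi> by (auto simp: npc_def)
  qed
  then show "\<And>t. t \<in> {0..T} \<Longrightarrow> ext_deriv T x t = \<phi> t" .
  have finS: "finite S" using \<phi> by (simp add: npc_def)
  have lim: "(deriv_on T x \<longlongrightarrow> l) F"
    if "(\<phi> \<longlongrightarrow> l) F" "eventually (\<lambda>s. s \<in> {0..T}) F" "eventually (\<lambda>s. s \<notin> S) F" for l F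
    by (rule Lim_transform_eventually[OF that(1) eventually_elim2[OF that(2,3)]]) (use eq in auto)
  obtain k \<tau> where sub: "subdivision T k \<tau>" and S: "S \<inter> {0..T} \<subseteq> \<tau> ` {0..Suc k}"
    using subdivision_exists[OF finS T] by auto
  have "cont_diff_on T x ({0..T} - \<tau> ` {0..Suc k})"
    unfolding cont_diff_on_def
  proof
    fix t assume "t \<in> {0..T} - \<tau> ` {0..Suc k}"
    then have t: "t \<in> {0..T} - S" using S by auto
    have "(deriv_on T x \<longlongrightarrow> \<phi> t) (at t within {0..T})"
    proof (rule lim)
      show "(\<phi> \<longlongrightarrow> \<phi> t) (at t within {0..T})" using \<phi> t by (auto simp: npc_def continuous_within)
      show "eventually (\<lambda>s. s \<in> {0..T}) (at t within {0..T})" by (simp add: eventually_at_filter)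
    qed (rule eventually_notin_finite[OF finS])
    then show "x differentiable at t within {0..T} \<and> continuous (at t within {0..T}) (deriv_on T x)"
      using full[OF t] eq[OF t] by (auto simp: continuous_within has_vector_derivative_def differentiable_def)
  qed
  moreover have "\<forall>i\<in>{0..k}. \<exists>d. (x has_vector_derivative d) (at_right (\<tau> i)) \<and>
            (deriv_on T x \<longlongrightarrow> d) (at_right (\<tau> i))"
  proof
    fix i assume i: "i \<in> {0..k}"
    have m: "\<tau> i \<in> {0..<T}"
      using subdivision_mem[OF sub, of i] subdivision_less[OF sub, of i "Suc k"] i sub
      by (auto simp: subdivision_def)
    show "\<exists>d. (x has_vector_derivative d) (at_right (\<tau> i)) \<and> (deriv_on T x \<longlongrightarrow> d) (at_right (\<tau> i))"
      using m \<phi> right[OF m] eventually_at_right_mem[of "\<tau> i" T] eventually_notin_finite[OF finS]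
      by (intro exI[of _ "\<phi> (\<tau> i)"] conjI lim) (auto simp: npc_def)
  qed
  moreover have "\<forall>i\<in>{1..Suc k}. \<exists>d. (x has_vector_derivative d) (at_left (\<tau> i)) \<and>
            (deriv_on T x \<longlongrightarrow> d) (at_left (\<tau> i))"
  proof
    fix i assume i: "i \<in> {1..Suc k}"
    have m: "\<tau> i \<in> {0<..T}"
      using subdivision_mem[OF sub, of i] subdivision_less[OF sub, of 0 i] i sub
      by (auto simp: subdivision_def)
    then obtain l where l: "(\<phi> \<longlongrightarrow> l) (at_left (\<tau> i))" using \<phi> unfolding npc_def by blast
    show "\<exists>d. (x has_vector_derivative d) (at_left (\<tau> i)) \<and> (deriv_on T x \<longlongrightarrow> d) (at_left (\<tau> i))"
      using m l left[OF m l] eventually_at_left_mem[of "\<tau> i" T] eventually_notin_finite[OF finS]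
      by (intro exI[of _ l] conjI lim) auto
  qed
  ultimately show "x \<in> PC1 T W" unfolding PC1_def using W x sub by blast
qed

lemma PC1_has_vector_derivative:
  assumes "x \<in> PC1 T W" "0 < T"
  shows "\<exists>S. finite S \<and> (\<forall>t\<in>{0..T} - S. (x has_vector_derivative ext_deriv T x t) (at t within {0..T}))"
proof -
  have *: "(x has_vector_derivative ext_deriv T x t) (at t within {0..T})"
    if "cont_diff_on T x A" "t \<in> A" "t \<in> {0..T}" for t A
  proof -
    have "x differentiable (at t within {0..T})" using that by (auto simp: cont_diff_on_def)
    then show ?thesis
      using ext_deriv_eq_deriv_on[OF assms(2) that(3)] by (metis vector_derivative_works)
  qed
  obtain S where "finite S" "cont_diff_on T x ({0..T} - S)"
  proof -
    from assms consider "cont_diff_on T x {0..T}"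
      | k \<tau> where "cont_diff_on T x ({0..T} - \<tau> ` {0..Suc k})"
      unfolding PC1_def by blast
    then show ?thesis by cases (use that[of "{}"] that in auto)
  qed
  then show ?thesis using * by blast
qed

lemma npc_bounded:
  fixes A :: "real \<Rightarrow> 'b::real_normed_vector"
  assumes "npc T W S A" "0 < T"
  obtains C where "0 \<le> C" "\<And>t. t \<in> {0..T} \<Longrightarrow> norm (A t) \<le> C"
proof -
  obtain M where M: "compact M" "A ` {0..T} \<subseteq> M" using npc_compact_range[OF assms] by metis
  obtain C where C: "\<And>y. y \<in> M \<Longrightarrow> norm y \<le> C" using compact_imp_bounded[OF M(1)] unfolding bounded_iff by blast
  show ?thesis
  proof (rule that[of "max C 0"])
    fix t assume "t \<in> {0..T}"
    then have "norm (A t) \<le> C" using C M(2) by blast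
    then show "norm (A t) \<le> max C 0" by simp
  qed simp
qed

lemma npc_add:
  fixes u v :: "real \<Rightarrow> 'b::real_normed_vector"
  assumes "npc T UNIV S u" "npc T UNIV S' v"
  shows "npc T UNIV (S \<union> S') (\<lambda>s. u s + v s)"
  unfolding npc_def
proof (intro conjI ballI)
  fix t assume "t \<in> {0<..T}"
  then obtain l l' where "(u \<longlongrightarrow> l) (at_left t)" "(v \<longlongrightarrow> l') (at_left t)"
    using assms unfolding npc_def by blast
  then have "((\<lambda>s. u s + v s) \<longlongrightarrow> l + l') (at_left t)" by (rule tendsto_add)
  then show "\<exists>l\<in>UNIV. ((\<lambda>s. u s + v s) \<longlongrightarrow> l) (at_left t)" by blast
qed (use assms in \<open>auto simp: npc_def intro!: tendsto_add continuous_add\<close>)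

text \<open>A continuous family of operators acts jointly continuously, hence preserves piecewise continuity.\<close>

lemma npc_linear:
  fixes u :: "real \<Rightarrow> 'b::real_normed_vector" and Q :: "real \<Rightarrow> 'b \<Rightarrow>\<^sub>L 'c::real_normed_vector"
  assumes "npc T UNIV S u" "continuous_on {0..T} Q" "0 < T"
  shows "npc T UNIV S (\<lambda>s. blinfun_apply (Q s) (u s))"
proof (rule npc_comp[OF assms(1) _ _ assms(3)])
  have "continuous_on ({0..T} \<times> UNIV) (\<lambda>p::real \<times> 'b. blinfun_apply (Q (fst p)) (snd p))"
    by (intro bounded_bilinear.continuous_on[OF bounded_bilinear_blinfun_apply] continuous_on_snd[OF continuous_on_id]
        continuous_on_compose2[OF assms(2) continuous_on_fst[OF continuous_on_id]]) auto
  then show "continuous_on ({0..T} \<times> UNIV) (\<lambda>(s, y). blinfun_apply (Q s) y)" by (simp add: case_prod_beta)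
qed simp

lemma npc_minus:
  fixes u :: "real \<Rightarrow> 'b::real_normed_vector"
  assumes "npc T UNIV S u" "0 < T" shows "npc T UNIV S (\<lambda>s. - u s)"
  by (rule npc_comp[OF assms(1) _ _ assms(2)]) (auto simp: case_prod_beta intro!: continuous_intros)

lemma npc_norm:
  fixes u :: "real \<Rightarrow> 'b::real_normed_vector"
  assumes "npc T UNIV S u" "0 < T" shows "npc T UNIV S (\<lambda>s. norm (u s))"
  by (rule npc_comp[OF assms(1) _ _ assms(2)]) (auto simp: case_prod_beta intro!: continuous_intros)

lemma npc_diff:
  fixes u v :: "real \<Rightarrow> 'b::real_normed_vector"
  assumes "npc T UNIV S u" "npc T UNIV S' v" "0 < T"
  shows "npc T UNIV (S \<union> S') (\<lambda>s. u s - v s)"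
  using npc_add[OF assms(1) npc_minus[OF assms(2,3)]] by simp

lemma npc_integral_deriv:
  fixes \<phi> :: "real \<Rightarrow> 'b::banach"
  assumes T: "0 < T" and \<phi>: "npc T V S \<phi>" and x: "\<And>s. s \<in> {0..T} \<Longrightarrow> x s = \<xi> + integral {0..s} \<phi>"
    and t: "t \<in> {0<..<T} - S"
  shows "(x has_vector_derivative \<phi> t) (at t)"
proof -
  have "((\<lambda>s. integral {0..s} \<phi>) has_vector_derivative \<phi> t) (at t within {0..T})"
    using integral_has_vector_derivative_continuous_at[OF npc_integrable[OF \<phi> T], of t "{}"] \<phi> t
    by (auto simp: npc_def)
  then have "((\<lambda>s. \<xi> + integral {0..s} \<phi>) has_vector_derivative \<phi> t) (at t within {0..T})"
    by (auto intro!: derivative_eq_intros)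
  then have "(x has_vector_derivative \<phi> t) (at t within {0..T})"
    by (rule has_vector_derivative_transform[rotated 2]) (use x t in auto)
  moreover have "at t within {0..T} = at t" using t by (intro at_within_interior) simp
  ultimately show ?thesis by simp
qed

section \<open>Integral equations in a tube, and the resolvent\<close>

lemma exp_weight_has_integral:
  assumes "(0::real) \<le> t"
  shows "((\<lambda>s. 2 * L * exp (2 * L * s)) has_integral (exp (2 * L * t) - 1)) {0..t}"
proof -
  have "((\<lambda>s. 2 * L * exp (2 * L * s)) has_integral (exp (2 * L * t) - exp (2 * L * 0))) {0..t}"
    by (rule fundamental_theorem_of_calculus[OF assms])
      (auto intro!: derivative_eq_intros simp flip: has_real_derivative_iff_has_vector_derivative)
  then show ?thesis by simp
qed

text \<open>The reason for the weight \<open>exp (- 2 L t)\<close>: if \<open>\<phi>\<close> is bounded by \<open>L\<close> times a function of weighted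
supremum norm \<open>c\<close>, then its integral has weighted norm at most \<open>c / 2\<close>.\<close>

lemma exp_weight_bound:
  fixes \<phi> :: "real \<Rightarrow> 'b::banach"
  assumes "0 \<le> t" "\<phi> integrable_on {0..t}"
    and "\<And>s. s \<in> {0..t} \<Longrightarrow> norm (\<phi> s) \<le> L * (exp (2 * L * s) * c)"
  shows "exp (- (2 * L * t)) * norm (integral {0..t} \<phi>) \<le> (c / 2) * (1 - exp (- (2 * L * t)))"
proof -
  have I: "((\<lambda>s. (c / 2) * (2 * L * exp (2 * L * s))) has_integral (c / 2) * (exp (2 * L * t) - 1)) {0..t}"
    by (rule has_integral_mult_right[OF exp_weight_has_integral[OF assms(1)]])
  have "norm (integral {0..t} \<phi>) \<le> integral {0..t} (\<lambda>s. (c / 2) * (2 * L * exp (2 * L * s)))"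
    by (rule integral_norm_bound_integral[OF assms(2) has_integral_integrable[OF I]])
      (use assms(3) in \<open>simp add: algebra_simps\<close>)
  also have "\<dots> = (c / 2) * (exp (2 * L * t) - 1)" using integral_unique[OF I] .
  finally have "exp (- (2 * L * t)) * norm (integral {0..t} \<phi>)
      \<le> exp (- (2 * L * t)) * ((c / 2) * (exp (2 * L * t) - 1))" by simp
  also have "\<dots> = (c / 2) * (exp (- (2 * L * t)) * exp (2 * L * t) - exp (- (2 * L * t)))"
    by (simp add: algebra_simps)
  also have "\<dots> = (c / 2) * (1 - exp (- (2 * L * t)))" by (simp flip: exp_add)
  finally show ?thesis .
qed

text \<open>At a maximum of \<open>exp (- 2 L t) y t\<close> the weighted integral absorbs at most half of the maximum, which
leaves at most \<open>c\<close> for the other half.\<close>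

lemma gronwall:
  fixes y :: "real \<Rightarrow> real"
  assumes y: "continuous_on {0..T} y" and "0 \<le> L" "0 \<le> c"
    and le: "\<And>t. t \<in> {0..T} \<Longrightarrow> 0 \<le> y t \<and> y t \<le> c + L * integral {0..t} y"
    and t: "t \<in> {0..T}"
  shows "y t \<le> 2 * c * exp (2 * L * t)"
proof -
  have "continuous_on {0..T} (\<lambda>t. exp (- (2 * L * t)) * y t)" by (intro continuous_intros y)
  moreover have "{0..T} \<noteq> {}" using t by auto
  ultimately obtain t' where t': "t' \<in> {0..T}"
    and max: "\<And>s. s \<in> {0..T} \<Longrightarrow> exp (- (2 * L * s)) * y s \<le> exp (- (2 * L * t')) * y t'"
    using continuous_attains_sup[of "{0..T}" "\<lambda>t. exp (- (2 * L * t)) * y t"] by auto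
  define M where "M = exp (- (2 * L * t')) * y t'"
  have yM: "y s \<le> exp (2 * L * s) * M" if "s \<in> {0..T}" for s
  proof -
    have "exp (2 * L * s) * (exp (- (2 * L * s)) * y s) \<le> exp (2 * L * s) * M"
      using max[OF that] by (simp add: M_def)
    then show ?thesis by (simp add: mult.assoc[symmetric] flip: exp_add)
  qed
  have int: "y integrable_on {0..t'}"
    by (rule integrable_continuous_real, rule continuous_on_subset[OF y]) (use t' in auto)
  have "exp (- (2 * L * t')) * norm (integral {0..t'} (\<lambda>s. L * y s)) \<le> (M / 2) * (1 - exp (- (2 * L * t')))"
  proof (rule exp_weight_bound)
    show "(\<lambda>s. L * y s) integrable_on {0..t'}" using int by (rule integrable_on_mult_right)
    show "norm (L * y s) \<le> L * (exp (2 * L * s) * M)" if "s \<in> {0..t'}" for s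
    proof -
      have s: "s \<in> {0..T}" using that t' by auto
      have "norm (L * y s) = L * y s" using le[OF s] \<open>0 \<le> L\<close> by simp
      also have "\<dots> \<le> L * (exp (2 * L * s) * M)" by (rule mult_left_mono[OF yM[OF s] \<open>0 \<le> L\<close>])
      finally show ?thesis .
    qed
  qed (use t' in auto)
  moreover have "L * integral {0..t'} y \<le> norm (integral {0..t'} (\<lambda>s. L * y s))" by simp
  ultimately have *: "exp (- (2 * L * t')) * (L * integral {0..t'} y) \<le> (M / 2) * (1 - exp (- (2 * L * t')))"
    by (meson exp_ge_zero mult_left_mono order_trans)
  have M0: "0 \<le> M" unfolding M_def using le[OF t'] by simp
  have "M \<le> exp (- (2 * L * t')) * (c + L * integral {0..t'} y)"
    unfolding M_def using le[OF t'] by simp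
  also have "\<dots> \<le> exp (- (2 * L * t')) * c + (M / 2) * (1 - exp (- (2 * L * t')))"
    using * by (simp add: distrib_left)
  also have "\<dots> \<le> 1 * c + (M / 2) * 1"
    using M0 \<open>0 \<le> c\<close> \<open>0 \<le> L\<close> t' by (intro add_mono mult_mono) auto
  finally have "M \<le> 2 * c" by simp
  then have "exp (2 * L * t) * M \<le> exp (2 * L * t) * (2 * c)" by (intro mult_left_mono) auto
  with yM[OF t] have "y t \<le> exp (2 * L * t) * (2 * c)" by (rule order_trans)
  then show ?thesis by (simp only: mult.commute)
qed

text \<open>Existence on the whole interval when \<open>F\<close> is Lipschitz only in a tube around \<open>x0\<close>. If \<open>x0\<close> solves
the equation up to a defect \<open>\<eta>\<close>, the weighted ball of radius \<open>2 \<eta>\<close> is mapped to itself, since the contraction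
contributes at most half of the radius and the defect the other half. Undoing the weight turns the radius into the bound
on the distance of the solution from \<open>x0\<close>.\<close>

theorem integral_equation_tube:
  fixes F :: "real \<Rightarrow> 'b::banach \<Rightarrow> 'b"
  assumes T: "0 < T" and L: "0 \<le> L" and x0: "continuous_on {0..T} x0"
    and int: "\<And>x. continuous_on {0..T} x \<Longrightarrow> (\<And>t. t \<in> {0..T} \<Longrightarrow> norm (x t - x0 t) \<le> \<rho>)
               \<Longrightarrow> (\<lambda>s. F s (x s)) integrable_on {0..T}"
    and lip: "\<And>t y z. t \<in> {0..T} \<Longrightarrow> norm (y - x0 t) \<le> \<rho> \<Longrightarrow> norm (z - x0 t) \<le> \<rho> \<Longrightarrow>
               norm (F t y - F t z) \<le> L * norm (y - z)"
    and defect: "\<And>t. t \<in> {0..T} \<Longrightarrow> norm (\<xi> + integral {0..t} (\<lambda>s. F s (x0 s)) - x0 t) \<le> \<eta>"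
    and \<eta>: "2 * \<eta> * exp (2 * L * T) \<le> \<rho>"
  shows "\<exists>x. continuous_on {0..T} x \<and> (\<forall>t\<in>{0..T}. norm (x t - x0 t) \<le> 2 * \<eta> * exp (2 * L * T)) \<and>
             (\<forall>t\<in>{0..T}. x t = \<xi> + integral {0..t} (\<lambda>s. F s (x s)))"
proof -
  have \<eta>0: "0 \<le> \<eta>" using defect[of 0] T by (auto intro: order_trans[OF norm_ge_zero])
  \<comment> \<open>The unknown is the weighted difference to \<open>x0\<close>, extended by clamping the time, so that the space of bounded
    continuous functions on the line with its supremum norm can be used.\<close>
  define cl where "cl t = max 0 (min T t)" for t
  have cl: "cl t \<in> {0..T}" for t using T by (auto simp: cl_def)
  have cl_id: "cl t = t" if "t \<in> {0..T}" for t using that by (auto simp: cl_def)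
  have ccl: "continuous_on UNIV cl" unfolding cl_def by (intro continuous_intros)
  define X where "X y s = x0 s + exp (2 * L * s) *\<^sub>R apply_bcontfun y s" for y :: "real \<Rightarrow>\<^sub>C 'b" and s
  define P where "P y t = exp (- (2 * L * t)) *\<^sub>R (\<xi> + integral {0..t} (\<lambda>s. F s (X y s)) - x0 t)" for y t
  define B :: "(real \<Rightarrow>\<^sub>C 'b) set" where "B = PiC UNIV (\<lambda>_. cball 0 (2 * \<eta>))"
  have B: "y \<in> B \<longleftrightarrow> (\<forall>t. norm (apply_bcontfun y t) \<le> 2 * \<eta>)" for y
    by (simp add: B_def mem_PiC_iff Pi_iff)
  have XT: "norm (X y s - x0 s) \<le> 2 * \<eta> * exp (2 * L * T)" if "y \<in> B" "s \<in> {0..T}" for y s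
  proof -
    have "norm (X y s - x0 s) = exp (2 * L * s) * norm (apply_bcontfun y s)" by (simp add: X_def)
    also have "\<dots> \<le> exp (2 * L * T) * (2 * \<eta>)"
      using that B L by (intro mult_mono) (auto simp: mult_left_mono)
    finally show ?thesis by (simp add: mult.commute)
  qed
  have X\<rho>: "norm (X y s - x0 s) \<le> \<rho>" if "y \<in> B" "s \<in> {0..T}" for y s
    using XT[OF that] \<eta> by simp
  have Xc: "continuous_on {0..T} (X y)" for y
    unfolding X_def by (intro continuous_intros x0 continuous_on_apply_bcontfun)
  have iT: "(\<lambda>s. F s (X y s)) integrable_on {0..T}" if "y \<in> B" for y
    by (rule int[OF Xc X\<rho>[OF that]])
  have iT0: "(\<lambda>s. F s (x0 s)) integrable_on {0..T}"
    by (rule int[OF x0]) (use \<eta>0 \<eta> in \<open>auto intro: order_trans[rotated]\<close>)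
  have it: "\<phi> integrable_on {0..t}" if "\<phi> integrable_on {0..T}" "t \<in> {0..T}" for t and \<phi> :: "real \<Rightarrow> 'b"
    by (rule integrable_on_subinterval[OF that(1)]) (use that in auto)
  have Pc: "continuous_on {0..T} (P y)" if "y \<in> B" for y
    unfolding P_def
    by (intro continuous_intros x0 indefinite_integral_continuous_1 iT that)
  have Pn: "norm (P y t) \<le> 2 * \<eta>" if y: "y \<in> B" and t: "t \<in> {0..T}" for y t
  proof -
    have "P y t = exp (- (2 * L * t)) *\<^sub>R (\<xi> + integral {0..t} (\<lambda>s. F s (x0 s)) - x0 t)
        + exp (- (2 * L * t)) *\<^sub>R integral {0..t} (\<lambda>s. F s (X y s) - F s (x0 s))"
      unfolding P_def Henstock_Kurzweil_Integration.integral_diff[OF it[OF iT[OF y] t] it[OF iT0 t]]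
      by (simp add: algebra_simps)
    then have "norm (P y t) \<le> norm (exp (- (2 * L * t)) *\<^sub>R (\<xi> + integral {0..t} (\<lambda>s. F s (x0 s)) - x0 t))
        + norm (exp (- (2 * L * t)) *\<^sub>R integral {0..t} (\<lambda>s. F s (X y s) - F s (x0 s)))"
      by (simp only: norm_triangle_ineq)
    then have "norm (P y t) \<le> exp (- (2 * L * t)) * norm (\<xi> + integral {0..t} (\<lambda>s. F s (x0 s)) - x0 t)
        + exp (- (2 * L * t)) * norm (integral {0..t} (\<lambda>s. F s (X y s) - F s (x0 s)))"
      by simp
    moreover have "exp (- (2 * L * t)) * norm (\<xi> + integral {0..t} (\<lambda>s. F s (x0 s)) - x0 t) \<le> 1 * \<eta>"
      using L t defect[OF t] by (intro mult_mono) auto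
    moreover have "exp (- (2 * L * t)) * norm (integral {0..t} (\<lambda>s. F s (X y s) - F s (x0 s)))
        \<le> ((2 * \<eta>) / 2) * (1 - exp (- (2 * L * t)))"
    proof (rule exp_weight_bound)
      show "(\<lambda>s. F s (X y s) - F s (x0 s)) integrable_on {0..t}"
        by (rule integrable_diff[OF it[OF iT[OF y] t] it[OF iT0 t]])
      show "norm (F s (X y s) - F s (x0 s)) \<le> L * (exp (2 * L * s) * (2 * \<eta>))" if "s \<in> {0..t}" for s
      proof -
        have s: "s \<in> {0..T}" using that t by auto
        have "0 \<le> \<rho>" using X\<rho>[OF y s] norm_ge_zero order_trans by blast
        then have "norm (F s (X y s) - F s (x0 s)) \<le> L * norm (X y s - x0 s)"
          using lip[OF s X\<rho>[OF y s], of "x0 s"] by simp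
        also have "\<dots> \<le> L * (exp (2 * L * s) * (2 * \<eta>))"
          using y L B by (intro mult_left_mono) (auto simp: X_def)
        finally show ?thesis .
      qed
    qed (use t in auto)
    moreover have "((2 * \<eta>) / 2) * (1 - exp (- (2 * L * t))) \<le> \<eta>" using \<eta>0 by (simp add: mult_left_le)
    ultimately show ?thesis by linarith
  qed
  have Pd: "norm (P y t - P z t) \<le> (1 / 2) * dist y z" if y: "y \<in> B" and z: "z \<in> B" and t: "t \<in> {0..T}" for y z t
  proof -
    have "P y t - P z t = exp (- (2 * L * t)) *\<^sub>R integral {0..t} (\<lambda>s. F s (X y s) - F s (X z s))"
      unfolding P_def Henstock_Kurzweil_Integration.integral_diff[OF it[OF iT[OF y] t] it[OF iT[OF z] t]]
      by (simp add: algebra_simps)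
    then have "norm (P y t - P z t) = exp (- (2 * L * t)) * norm (integral {0..t} (\<lambda>s. F s (X y s) - F s (X z s)))"
      by simp
    also have "\<dots> \<le> (dist y z / 2) * (1 - exp (- (2 * L * t)))"
    proof (rule exp_weight_bound)
      show "(\<lambda>s. F s (X y s) - F s (X z s)) integrable_on {0..t}"
        by (rule integrable_diff[OF it[OF iT[OF y] t] it[OF iT[OF z] t]])
      show "norm (F s (X y s) - F s (X z s)) \<le> L * (exp (2 * L * s) * dist y z)" if "s \<in> {0..t}" for s
      proof -
        have s: "s \<in> {0..T}" using that t by auto
        have "norm (F s (X y s) - F s (X z s)) \<le> L * norm (X y s - X z s)"
          by (rule lip[OF s X\<rho>[OF y s] X\<rho>[OF z s]])
        also have "\<dots> = L * (exp (2 * L * s) * dist (apply_bcontfun y s) (apply_bcontfun z s))"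
          by (simp add: X_def dist_norm flip: scaleR_diff_right)
        also have "\<dots> \<le> L * (exp (2 * L * s) * dist y z)"
          using L by (intro mult_left_mono dist_bounded) auto
        finally show ?thesis .
      qed
    qed (use t in auto)
    also have "\<dots> \<le> (dist y z / 2) * 1" by (intro mult_left_mono) auto
    finally show ?thesis by simp
  qed
  define G where "G y = Bcontfun (\<lambda>t. P y (cl t))" for y
  have G: "apply_bcontfun (G y) = (\<lambda>t. P y (cl t))" if "y \<in> B" for y
    unfolding G_def
  proof (rule Bcontfun_inverse, rule bcontfun_normI)
    show "continuous_on UNIV (\<lambda>t. P y (cl t))"
      by (rule continuous_on_compose2[OF Pc[OF that] ccl]) (use cl in auto)
    show "norm (P y (cl t)) \<le> 2 * \<eta>" for t using Pn[OF that cl] .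
  qed
  have "\<exists>!y\<in>B. G y = y"
  proof (rule Banach_fix)
    show "complete B" unfolding B_def by (simp add: complete_eq_closed closed_PiC)
    have "0 \<in> B" using B \<eta>0 by simp
    then show "B \<noteq> {}" by auto
    show "G ` B \<subseteq> B" using G Pn[OF _ cl] B by auto
    show "dist (G y) (G z) \<le> (1 / 2) * dist y z" if "y \<in> B" "z \<in> B" for y z
      by (rule dist_bound) (use that G Pd[OF _ _ cl] in \<open>auto simp: dist_norm\<close>)
  qed auto
  then obtain y where y: "y \<in> B" "G y = y" by auto
  have fixpt: "apply_bcontfun y t = P y t" if "t \<in> {0..T}" for t
    using G[OF y(1)] y(2) cl_id[OF that] by metis
  have "X y t = \<xi> + integral {0..t} (\<lambda>s. F s (X y s))" if "t \<in> {0..T}" for t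
  proof -
    have "X y t = x0 t + exp (2 * L * t) *\<^sub>R P y t" using fixpt[OF that] by (simp add: X_def)
    also have "\<dots> = \<xi> + integral {0..t} (\<lambda>s. F s (X y s))"
      unfolding P_def by (simp flip: exp_add)
    finally show ?thesis .
  qed
  then show ?thesis using Xc XT[OF y(1)] by blast
qed

lemma integrable_on_time_reversal:
  fixes g :: "real \<Rightarrow> 'b::banach"
  assumes "g integrable_on {0..T}"
  shows "(\<lambda>s. g (T - s)) integrable_on {0..T}"
proof -
  have "(\<lambda>x. g (- 1 *\<^sub>R x + T)) integrable_on (\<lambda>x. (1 / - 1) *\<^sub>R x + - ((1 / - 1) *\<^sub>R T)) ` cbox 0 T"
    by (rule integrable_affinity) (use assms in auto)
  moreover have "(\<lambda>x. (1 / - 1) *\<^sub>R x + - ((1 / - 1) *\<^sub>R T)) ` cbox 0 T = {0..T}"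
  proof -
    have "(\<lambda>x. T - x) ` {0..T} = {0..T}" by (auto intro!: image_eqI[of _ _ "T - _"])
    then show ?thesis by simp
  qed
  ultimately show ?thesis by simp
qed

text \<open>\<open>R t\<close> propagates the linearized equation \<open>z' = A z\<close> from time \<open>t\<close> to time \<open>T\<close>. Solving for it directly, by time reversal,
avoids any need to invert a fundamental solution.\<close>

lemma backward_resolvent:
  fixes A :: "real \<Rightarrow> 'a::banach \<Rightarrow>\<^sub>L 'a"
  assumes T: "0 < T" and A: "npc T UNIV S A"
  shows "\<exists>R. continuous_on {0..T} R \<and> R T = id_blinfun \<and>
     (\<forall>t\<in>{0<..<T} - S. (R has_vector_derivative - (R t o\<^sub>L A t)) (at t))"
proof -
  obtain C where C: "0 \<le> C" "\<And>t. t \<in> {0..T} \<Longrightarrow> norm (A t) \<le> C" using npc_bounded[OF A T] by metis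
  have comp: "npc T UNIV S (\<lambda>t. Y (T - t) o\<^sub>L A t)" if "continuous_on {0..T} Y" for Y :: "real \<Rightarrow> 'a \<Rightarrow>\<^sub>L 'a"
  proof (rule npc_comp[OF A _ _ T])
    have "continuous_on ({0..T} \<times> UNIV) (\<lambda>x::real \<times> ('a \<Rightarrow>\<^sub>L 'a). Y (T - fst x))"
      by (rule continuous_on_compose2[OF that]) (auto intro!: continuous_intros)
    then show "continuous_on ({0..T} \<times> UNIV) (\<lambda>(t, \<zeta> :: 'a \<Rightarrow>\<^sub>L 'a). Y (T - t) o\<^sub>L \<zeta>)"
      unfolding case_prod_beta
      by (rule bounded_bilinear.continuous_on[OF bounded_bilinear_blinfun_compose _ continuous_on_snd[OF continuous_on_id]])
  qed simp
  have int: "(\<lambda>s. Y s o\<^sub>L A (T - s)) integrable_on {0..T}" if "continuous_on {0..T} Y" for Y :: "real \<Rightarrow> 'a \<Rightarrow>\<^sub>L 'a"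
    using integrable_on_time_reversal[OF npc_integrable[OF comp[OF that] T]] by simp
  have AC: "norm (Y o\<^sub>L A (T - s)) \<le> C * norm Y" if "s \<in> {0..T}" for Y :: "'a \<Rightarrow>\<^sub>L 'a" and s
  proof -
    have "norm (Y o\<^sub>L A (T - s)) \<le> norm Y * norm (A (T - s))" by (rule norm_blinfun_compose)
    also have "\<dots> \<le> norm Y * C" using C(2)[of "T - s"] that by (intro mult_left_mono) auto
    finally show ?thesis by (simp add: mult.commute)
  qed
  have "\<exists>Y. continuous_on {0..T} Y \<and> (\<forall>t\<in>{0..T}. norm (Y t - id_blinfun) \<le> 2 * (C * T) * exp (2 * C * T)) \<and>
     (\<forall>t\<in>{0..T}. Y t = (id_blinfun :: 'a \<Rightarrow>\<^sub>L 'a) + integral {0..t} (\<lambda>s. Y s o\<^sub>L A (T - s)))"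
  proof (rule integral_equation_tube[OF T C(1), where F="\<lambda>s Y. Y o\<^sub>L A (T - s)" and \<rho>="2 * (C * T) * exp (2 * C * T)"])
    fix t assume t: "t \<in> {0..T}"
    have "norm (integral {0..t} (\<lambda>s. id_blinfun o\<^sub>L A (T - s))) \<le> integral {0..t} (\<lambda>s. C)"
    proof (rule integral_norm_bound_integral)
      show "(\<lambda>s. id_blinfun o\<^sub>L A (T - s)) integrable_on {0..t}"
        by (rule integrable_on_subinterval[OF int]) (use t in auto)
      show "norm (id_blinfun o\<^sub>L A (T - s)) \<le> C" if "s \<in> {0..t}" for s
      proof -
        have "id_blinfun o\<^sub>L A (T - s) = A (T - s)" by (rule blinfun_eqI) simp
        then show ?thesis using C(2)[of "T - s"] that t by simp
      qed
    qed auto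
    also have "\<dots> \<le> C * T" using t C(1) by (simp add: mult.commute mult_left_mono)
    finally show "norm (id_blinfun + integral {0..t} (\<lambda>s. id_blinfun o\<^sub>L A (T - s)) - id_blinfun) \<le> C * T" by simp
  next
    fix t and y z :: "'a \<Rightarrow>\<^sub>L 'a" assume "t \<in> {0..T}"
    from AC[OF this, of "y - z"] show "norm ((y o\<^sub>L A (T - t)) - (z o\<^sub>L A (T - t))) \<le> C * norm (y - z)"
      by (simp add: bounded_bilinear.diff_left[OF bounded_bilinear_blinfun_compose])
  qed (use int in auto)
  then obtain Y where Yc: "continuous_on {0..T} Y"
    and Y: "\<And>t. t \<in> {0..T} \<Longrightarrow> Y t = (id_blinfun :: 'a \<Rightarrow>\<^sub>L 'a) + integral {0..t} (\<lambda>s. Y s o\<^sub>L A (T - s))" by blast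
  define R where "R t = Y (T - t)" for t
  have "continuous_on {0..T} R"
    unfolding R_def by (rule continuous_on_compose2[OF Yc]) (auto intro!: continuous_intros)
  moreover have "R T = id_blinfun" using Y[of 0] T by (simp add: R_def)
  moreover have "(R has_vector_derivative - (R t o\<^sub>L A t)) (at t)" if t: "t \<in> {0<..<T} - S" for t
  proof -
    have At: "isCont A t"
    proof -
      have "continuous (at t within {0..T}) A" using A t by (simp add: npc_def)
      then show ?thesis using at_within_interior[of t "{0..T}"] t by simp
    qed
    then have "isCont (\<lambda>s. A (T - s)) (T - t)"
      by (intro isCont_o2[where f="\<lambda>s. T - s" and g=A]) auto
    moreover have "isCont Y (T - t)"
    proof -
      have "continuous (at (T - t) within {0..T}) Y"
        using Yc t by (simp add: continuous_on_eq_continuous_within)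
      then show ?thesis using at_within_interior[of "T - t" "{0..T}"] t by simp
    qed
    ultimately have "isCont (\<lambda>s. Y s o\<^sub>L A (T - s)) (T - t)"
      by (intro bounded_bilinear.continuous[OF bounded_bilinear_blinfun_compose])
    then have "((\<lambda>u. integral {0..u} (\<lambda>s. Y s o\<^sub>L A (T - s))) has_vector_derivative (Y (T - t) o\<^sub>L A (T - (T - t)))) (at (T - t) within {0..T} - {})"
      by (intro integral_has_vector_derivative_continuous_at int Yc)
        (use t in \<open>auto intro: continuous_at_imp_continuous_at_within\<close>)
    then have "((\<lambda>u. id_blinfun + integral {0..u} (\<lambda>s. Y s o\<^sub>L A (T - s))) has_vector_derivative (Y (T - t) o\<^sub>L A t)) (at (T - t) within {0..T})"
      by (auto intro!: derivative_eq_intros)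
    then have "(Y has_vector_derivative (Y (T - t) o\<^sub>L A t)) (at (T - t) within {0..T})"
      by (rule has_vector_derivative_transform[rotated 2]) (use Y t in auto)
    then have "(Y has_vector_derivative (Y (T - t) o\<^sub>L A t)) (at (T - t))"
      using t at_within_interior[of "T - t" "{0..T}"] by auto
    moreover have "((\<lambda>t. T - t) has_vector_derivative (- 1)) (at t)"
      by (auto intro!: derivative_eq_intros)
    ultimately have "((Y \<circ> (\<lambda>t. T - t)) has_vector_derivative (- 1) *\<^sub>R (Y (T - t) o\<^sub>L A t)) (at t)"
      by (intro vector_diff_chain_at)
    then show ?thesis by (simp add: o_def R_def[abs_def])
  qed
  ultimately show ?thesis by blast
qed

section \<open>Lipschitz bounds near a compact set\<close>

text \<open>The defining limit is one-sided, but it holds for \<open>v\<close> and for \<open>- v\<close>, and the differential is linear.\<close>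

lemma gateaux_imp_has_vector_derivative_line:
  assumes "has_gateaux_differential F D (x + s *\<^sub>R v)"
  shows "((\<lambda>s. F (x + s *\<^sub>R v)) has_vector_derivative blinfun_apply D v) (at s)"
proof -
  define Q where "Q = (\<lambda>h. (F (x + (s + h) *\<^sub>R v) - F (x + s *\<^sub>R v)) /\<^sub>R h)"
  have lim: "((\<lambda>\<theta>. (F (x + s *\<^sub>R v + \<theta> *\<^sub>R w) - F (x + s *\<^sub>R v)) /\<^sub>R \<theta>) \<longlongrightarrow> blinfun_apply D w) (at_right 0)" for w
    using assms by (simp add: has_gateaux_differential_def)
  have right: "(Q \<longlongrightarrow> blinfun_apply D v) (at_right 0)"
    using lim[of v] by (simp add: Q_def scaleR_add_left add.assoc)
  have "((\<lambda>\<theta>. - Q (- \<theta>)) \<longlongrightarrow> blinfun_apply D (- v)) (at_right 0)"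
    using lim[of "- v"] by (simp add: Q_def scaleR_add_left scaleR_minus_left add.assoc algebra_simps)
  then have "((\<lambda>\<theta>. Q (- \<theta>)) \<longlongrightarrow> blinfun_apply D v) (at_right 0)"
    using tendsto_minus by (fastforce simp: blinfun.minus_right)
  then have left: "(Q \<longlongrightarrow> blinfun_apply D v) (at_left 0)"
    by (simp add: at_left_minus[of 0] filterlim_filtermap)
  have "(Q \<longlongrightarrow> blinfun_apply D v) (at 0)" using filterlim_split_at_real[OF left right] .
  then have "((\<lambda>h. norm (Q h - blinfun_apply D v)) \<longlongrightarrow> 0) (at 0)"
    using Lim_null tendsto_norm_zero by blast
  moreover have "\<forall>\<^sub>F h in at 0. norm (Q h - blinfun_apply D v) =
      norm (F (x + (s + h) *\<^sub>R v) - F (x + s *\<^sub>R v) - h *\<^sub>R blinfun_apply D v) / norm h"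
  proof (rule eventually_at_filter[THEN iffD2], rule always_eventually, intro allI impI)
    fix h :: real assume "h \<noteq> 0"
    then have "Q h - blinfun_apply D v =
        (F (x + (s + h) *\<^sub>R v) - F (x + s *\<^sub>R v) - h *\<^sub>R blinfun_apply D v) /\<^sub>R h"
      by (simp add: Q_def scaleR_diff_right)
    then show "norm (Q h - blinfun_apply D v) =
      norm (F (x + (s + h) *\<^sub>R v) - F (x + s *\<^sub>R v) - h *\<^sub>R blinfun_apply D v) / norm h"
      by (simp add: divide_inverse mult.commute)
  qed
  ultimately have "((\<lambda>h. norm (F (x + (s + h) *\<^sub>R v) - F (x + s *\<^sub>R v) - h *\<^sub>R blinfun_apply D v) / norm h) \<longlongrightarrow> 0) (at 0)"
    by (rule Lim_transform_eventually)
  then show ?thesis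
    unfolding has_vector_derivative_def has_derivative_at
    by (auto intro: bounded_linear_scaleR_left)
qed

text \<open>Mean value inequality along the segment from \<open>z\<close> to \<open>y\<close>; differentiability along lines suffices.\<close>

lemma gateaux_lipschitz:
  assumes "convex C" "y \<in> C" "z \<in> C"
    and D: "\<And>x. x \<in> C \<Longrightarrow> \<exists>D. has_gateaux_differential F D x \<and> norm D \<le> L"
  shows "norm (F y - F z) \<le> L * norm (y - z)"
proof -
  have mem: "z + s *\<^sub>R (y - z) \<in> C" if "s \<in> {0..1}" for s
  proof -
    have "z + s *\<^sub>R (y - z) = (1 - s) *\<^sub>R z + s *\<^sub>R y" by (simp add: algebra_simps)
    then show ?thesis using convexD_alt[OF assms(1,3,2)] that by auto
  qed
  have "\<exists>D. has_gateaux_differential F D (z + s *\<^sub>R (y - z)) \<and> norm D \<le> L" if "s \<in> {0..1}" for s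
    using D[OF mem[OF that]] .
  then obtain E where E: "\<And>s. s \<in> {0..1} \<Longrightarrow> has_gateaux_differential F (E s) (z + s *\<^sub>R (y - z)) \<and> norm (E s) \<le> L"
    by metis
  have "norm (F (z + 1 *\<^sub>R (y - z)) - F (z + 0 *\<^sub>R (y - z))) \<le> (L * norm (y - z)) * norm (1 - 0 :: real)"
  proof (rule differentiable_bound[where S="{0..1}" and f="\<lambda>s. F (z + s *\<^sub>R (y - z))"
        and f'="\<lambda>s h. h *\<^sub>R blinfun_apply (E s) (y - z)"])
    fix s :: real assume s: "s \<in> {0..1}"
    show "((\<lambda>s. F (z + s *\<^sub>R (y - z))) has_derivative (\<lambda>h. h *\<^sub>R blinfun_apply (E s) (y - z))) (at s within {0..1})"
      using gateaux_imp_has_vector_derivative_line[of F "E s" z s "y - z"] E[OF s]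
      by (auto simp: has_vector_derivative_def intro: has_derivative_at_withinI)
    have "norm (blinfun_apply (E s) (y - z)) \<le> L * norm (y - z)"
      using norm_blinfun[of "E s" "y - z"] E[OF s] mult_right_mono[of "norm (E s)" L "norm (y - z)"] by auto
    then show "onorm (\<lambda>h. h *\<^sub>R blinfun_apply (E s) (y - z)) \<le> L * norm (y - z)"
      by (intro onorm_le) (auto simp: mult.commute mult_left_mono)
  qed auto
  then show ?thesis by simp
qed

lemma compact_insert_range_limit:
  fixes X :: "nat \<Rightarrow> 'a::metric_space"
  assumes "X \<longlonglongrightarrow> l"
  shows "compact (insert l (range X))"
proof (rule compactI)
  fix C assume C: "\<forall>c\<in>C. open c" "insert l (range X) \<subseteq> \<Union>C"
  then obtain c where c: "c \<in> C" "l \<in> c" by auto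
  then obtain N where N: "\<And>n. n \<ge> N \<Longrightarrow> X n \<in> c"
    using topological_tendstoD[OF assms, of c] C unfolding eventually_sequentially by blast
  have "\<forall>n. \<exists>b. b \<in> C \<and> X n \<in> b" using C(2) by blast
  then obtain b where b: "\<And>n. b n \<in> C \<and> X n \<in> b n" by metis
  have "insert l (range X) \<subseteq> \<Union>(insert c (b ` {..<N}))"
    using c N b by (auto; meson lessThan_iff not_le)
  then show "\<exists>C'\<subseteq>C. finite C' \<and> insert l (range X) \<subseteq> \<Union>C'"
    using c b by (intro exI[of _ "insert c (b ` {..<N})"]) auto
qed

text \<open>Boundedness on compact sets yields a bound on a uniform neighbourhood of a compact set.
Otherwise \<open>N\<close> is unbounded along a sequence approaching \<open>K\<close>; a convergent subsequence together with
its limit is a compact set on which \<open>N\<close> is unbounded.\<close>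

lemma locally_bounded_near_compact:
  fixes N :: "'a::metric_space \<Rightarrow> 'c \<Rightarrow> real"
  assumes K: "compact K" "K \<subseteq> \<Omega>" "open \<Omega>" and "P \<noteq> {}"
    and bdd: "\<And>K'. compact K' \<Longrightarrow> K' \<noteq> {} \<Longrightarrow> K' \<subseteq> \<Omega> \<Longrightarrow> \<exists>B. \<forall>y\<in>K'. \<forall>p\<in>P. N y p \<le> B"
  obtains r L where "r > 0" "\<And>\<xi>. \<xi> \<in> K \<Longrightarrow> cball \<xi> r \<subseteq> \<Omega>"
    "\<And>\<xi> y p. \<xi> \<in> K \<Longrightarrow> y \<in> cball \<xi> r \<Longrightarrow> p \<in> P \<Longrightarrow> N y p \<le> L"
proof -
  obtain e where e: "e > 0" "(\<Union>x\<in>K. cball x e) \<subseteq> \<Omega>"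
    using compact_subset_open_imp_cball_epsilon_subset[OF K(1,3,2)] .
  \<comment> \<open>A single number \<open>n\<close> serves as bound and, inverted, as radius; if none works, the witnesses form the blow-up sequence.\<close>
  have "\<exists>n::nat. \<forall>\<xi>\<in>K. \<forall>y\<in>cball \<xi> (min e (inverse (Suc n))). \<forall>p\<in>P. N y p \<le> real n"
  proof (rule ccontr)
    assume "\<not> ?thesis"
    then have "\<forall>n. \<exists>\<xi> y p. \<xi> \<in> K \<and> y \<in> cball \<xi> (min e (inverse (Suc n))) \<and> p \<in> P \<and> real n < N y p"
      by (meson not_le)
    then obtain \<xi> y p where *: "\<And>n. \<xi> n \<in> K \<and> y n \<in> cball (\<xi> n) (min e (inverse (Suc n))) \<and> p n \<in> P \<and> real n < N (y n) (p n)"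
      by metis
    obtain l k where lk: "l \<in> K" "strict_mono (k :: nat \<Rightarrow> nat)" "(\<xi> \<circ> k) \<longlonglongrightarrow> l"
      using K(1) * unfolding compact_def by metis
    have "(\<lambda>n. dist (\<xi> (k n)) (y (k n))) \<longlonglongrightarrow> 0"
    proof (rule tendsto_sandwich[OF _ _ tendsto_const])
      show "(\<lambda>n. inverse (real (Suc (k n)))) \<longlonglongrightarrow> 0"
        using LIMSEQ_subseq_LIMSEQ[OF LIMSEQ_inverse_real_of_nat lk(2)] unfolding o_def .
      show "\<forall>\<^sub>F n in sequentially. dist (\<xi> (k n)) (y (k n)) \<le> inverse (real (Suc (k n)))"
      proof (rule always_eventually, rule allI)
        fix n
        have "y (k n) \<in> cball (\<xi> (k n)) (min e (inverse (Suc (k n))))" using * by blast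
        then show "dist (\<xi> (k n)) (y (k n)) \<le> inverse (real (Suc (k n)))" by simp
      qed
    qed (simp add: always_eventually)
    moreover have "(\<lambda>n. dist (\<xi> (k n)) l) \<longlonglongrightarrow> 0"
      using lk(3) unfolding o_def by (rule tendsto_dist_iff[THEN iffD1])
    ultimately have "(\<lambda>n. dist (\<xi> (k n)) (y (k n)) + dist (\<xi> (k n)) l) \<longlonglongrightarrow> 0"
      by (rule tendsto_add_zero)
    then have "(\<lambda>n. dist (y (k n)) l) \<longlonglongrightarrow> 0"
      by (rule Lim_null_comparison[rotated]) (simp add: always_eventually dist_triangle3)
    then have lim: "(\<lambda>n. y (k n)) \<longlonglongrightarrow> l" by (rule tendsto_dist_iff[THEN iffD2])
    define K' where "K' = insert l (range (\<lambda>n. y (k n)))"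
    have yO: "y n \<in> \<Omega>" for n
    proof -
      have "y n \<in> cball (\<xi> n) e" "\<xi> n \<in> K" using *[of n] by auto
      then show ?thesis using e(2) by blast
    qed
    have "compact K'" "K' \<noteq> {}" "K' \<subseteq> \<Omega>"
      unfolding K'_def using compact_insert_range_limit[OF lim] yO lk(1) K(2) by auto
    from bdd[OF this] obtain B where "\<forall>y\<in>K'. \<forall>p\<in>P. N y p \<le> B" ..
    then have B: "\<And>y p. y \<in> K' \<Longrightarrow> p \<in> P \<Longrightarrow> N y p \<le> B" by simp
    obtain n :: nat where n: "B \<le> real n" using real_arch_simple by blast
    have "real (k n) < N (y (k n)) (p (k n))" using * by blast
    also have "\<dots> \<le> B" by (rule B) (use * in \<open>auto simp: K'_def\<close>)
    finally show False using n seq_suble[OF lk(2), of n] by simp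
  qed
  then obtain n :: nat where n: "\<forall>\<xi>\<in>K. \<forall>y\<in>cball \<xi> (min e (inverse (Suc n))). \<forall>p\<in>P. N y p \<le> real n" ..
  show ?thesis
  proof (rule that[of "min e (inverse (Suc n))" "real n"])
    show "0 < min e (inverse (real (Suc n)))" using e by simp
    show "cball \<xi> (min e (inverse (real (Suc n)))) \<subseteq> \<Omega>" if "\<xi> \<in> K" for \<xi>
      using e(2) that by (auto intro!: subsetD[OF e(2)])
  qed (use n in auto)
qed

text \<open>The Gateaux differentials are bounded only over compact sets, and balls are not compact in infinite
dimension; the previous lemma supplies the balls, with \<open>(t, \<zeta>)\<close> as parameter.\<close>

lemma lipschitz_tube:
  fixes f :: "real \<Rightarrow> 'a::real_normed_vector \<Rightarrow> 'u::t2_space \<Rightarrow> 'b::real_normed_vector"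
  assumes "0 < T" and K: "compact K" "K \<noteq> {}" "K \<subseteq> \<Omega>" "open \<Omega>" and M: "compact M" "M \<noteq> {}" "M \<subseteq> U"
    and f_cont: "continuous_on ({0..T} \<times> \<Omega> \<times> U) (\<lambda>(t, \<xi>, \<zeta>). f t \<xi> \<zeta>)"
    and f_gateaux: "\<forall>t\<in>{0..T}. \<forall>\<xi>\<in>\<Omega>. \<forall>\<zeta>\<in>U. \<exists>D. has_gateaux_differential (\<lambda>y. f t y \<zeta>) D \<xi>"
    and f_bdd: "\<forall>K M. compact K \<and> K \<noteq> {} \<and> K \<subseteq> \<Omega> \<and> compact M \<and> M \<noteq> {} \<and> M \<subseteq> U \<longrightarrow>
           bdd_above ((\<lambda>(t, \<xi>, \<zeta>). norm (gateaux_differential (\<lambda>y. f t y \<zeta>) \<xi>)) ` ({0..T} \<times> K \<times> M))"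
  obtains r L B where "r > 0" "L \<ge> 0" "B \<ge> 0" "\<And>\<xi>. \<xi> \<in> K \<Longrightarrow> cball \<xi> r \<subseteq> \<Omega>"
    "\<And>t \<xi> \<zeta> y z. t \<in> {0..T} \<Longrightarrow> \<xi> \<in> K \<Longrightarrow> \<zeta> \<in> M \<Longrightarrow> y \<in> cball \<xi> r \<Longrightarrow> z \<in> cball \<xi> r \<Longrightarrow>
       norm (f t y \<zeta> - f t z \<zeta>) \<le> L * norm (y - z)"
    "\<And>t \<xi> \<zeta> y. t \<in> {0..T} \<Longrightarrow> \<xi> \<in> K \<Longrightarrow> \<zeta> \<in> M \<Longrightarrow> y \<in> cball \<xi> r \<Longrightarrow> norm (f t y \<zeta>) \<le> B"
proof -
  define N where "N y p = (case p of (t, \<zeta>) \<Rightarrow> norm (gateaux_differential (\<lambda>y. f t y \<zeta>) y))" for y and p :: "real \<times> 'u"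
  obtain r L where r: "r > 0" "\<And>\<xi>. \<xi> \<in> K \<Longrightarrow> cball \<xi> r \<subseteq> \<Omega>"
    and L: "\<And>\<xi> y p. \<xi> \<in> K \<Longrightarrow> y \<in> cball \<xi> r \<Longrightarrow> p \<in> {0..T} \<times> M \<Longrightarrow> N y p \<le> L"
  proof (rule locally_bounded_near_compact[OF K(1,3,4), of "{0..T} \<times> M" N])
    show "{0..T} \<times> M \<noteq> {}" using M \<open>0 < T\<close> by auto
    fix K' assume K': "compact K'" "K' \<noteq> {}" "K' \<subseteq> \<Omega>"
    have "bdd_above ((\<lambda>(t, \<xi>, \<zeta>). norm (gateaux_differential (\<lambda>y. f t y \<zeta>) \<xi>)) ` ({0..T} \<times> K' \<times> M))"
      using f_bdd[rule_format, of K' M] K' M by simp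
    then obtain B where B: "\<And>w. w \<in> (\<lambda>(t, \<xi>, \<zeta>). norm (gateaux_differential (\<lambda>y. f t y \<zeta>) \<xi>)) ` ({0..T} \<times> K' \<times> M) \<Longrightarrow> w \<le> B"
      unfolding bdd_above_def by blast
    have "N y p \<le> B" if "y \<in> K'" "p \<in> {0..T} \<times> M" for y p
    proof -
      obtain t \<zeta> where "p = (t, \<zeta>)" by (cases p)
      then show ?thesis using that by (intro B) (force simp: N_def intro!: image_eqI[of _ _ "(t, y, \<zeta>)"])
    qed
    then show "\<exists>B. \<forall>y\<in>K'. \<forall>p\<in>{0..T} \<times> M. N y p \<le> B" by blast
  qed blast
  define L' where "L' = max L 0"
  have lip: "norm (f t y \<zeta> - f t z \<zeta>) \<le> L' * norm (y - z)"
    if "t \<in> {0..T}" "\<xi> \<in> K" "\<zeta> \<in> M" "y \<in> cball \<xi> r" "z \<in> cball \<xi> r" for t \<xi> \<zeta> y z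
  proof (rule gateaux_lipschitz[where F="\<lambda>y. f t y \<zeta>" and C="cball \<xi> r"])
    fix x assume x: "x \<in> cball \<xi> r"
    have "x \<in> \<Omega>" "\<zeta> \<in> U" using x that r(2)[OF that(2)] M by auto
    from f_gateaux[rule_format, OF that(1) this]
    obtain D where D: "has_gateaux_differential (\<lambda>y. f t y \<zeta>) D x" ..
    have "norm D \<le> L" using L[OF that(2) x, of "(t, \<zeta>)"] that gateaux_differential_eq[OF D]
      by (simp add: N_def)
    then show "\<exists>D. has_gateaux_differential (\<lambda>y. f t y \<zeta>) D x \<and> norm D \<le> L'" using D by (auto simp: L'_def)
  qed (use that in auto)
  have "compact ((\<lambda>(t, \<xi>, \<zeta>). f t \<xi> \<zeta>) ` ({0..T} \<times> K \<times> M))"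
    by (intro compact_continuous_image continuous_on_subset[OF f_cont] compact_Times K M compact_Icc)
      (use K M in auto)
  then obtain B where B: "\<And>w. w \<in> (\<lambda>(t, \<xi>, \<zeta>). f t \<xi> \<zeta>) ` ({0..T} \<times> K \<times> M) \<Longrightarrow> norm w \<le> B"
    by (meson compact_imp_bounded bounded_iff)
  define B' where "B' = max B 0 + L' * r"
  show ?thesis
  proof (rule that[OF r(1) _ _ r(2) lip])
    show "0 \<le> L'" "0 \<le> B'" using r by (auto simp: L'_def B'_def)
    fix t \<xi> \<zeta> y assume *: "t \<in> {0..T}" "\<xi> \<in> K" "\<zeta> \<in> M" "y \<in> cball \<xi> r"
    have "norm (f t \<xi> \<zeta>) \<le> B" using * by (intro B) force
    moreover have "norm (f t y \<zeta> - f t \<xi> \<zeta>) \<le> L' * norm (y - \<xi>)" using * r by (intro lip) auto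
    moreover have "L' * norm (y - \<xi>) \<le> L' * r"
      using * by (intro mult_left_mono) (auto simp: L'_def dist_norm norm_minus_commute)
    moreover have "norm (f t y \<zeta>) \<le> norm (f t \<xi> \<zeta>) + norm (f t y \<zeta> - f t \<xi> \<zeta>)"
      by (metis add.commute diff_add_cancel norm_triangle_ineq)
    ultimately show "norm (f t y \<zeta>) \<le> B'" unfolding B'_def by linarith
  qed auto
qed

section \<open>Separation and zeros in coordinate spaces\<close>

text \<open>Separation without a reference to closedness. If \<open>y0\<close> has positive distance from the cone, a
minimizing sequence is Cauchy by the parallelogram identity, and the vector from its limit to \<open>y0\<close> is a
nonzero functional that is nonpositive on the cone.\<close>

lemma convex_cone_dense_or_functional:
  fixes K :: "('i \<Rightarrow> real) set"
  assumes fin: "finite I" and ne: "K \<noteq> {}"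
    and add: "\<And>y z. y \<in> K \<Longrightarrow> z \<in> K \<Longrightarrow> (\<lambda>i. y i + z i) \<in> K"
    and scale: "\<And>s y. s > 0 \<Longrightarrow> y \<in> K \<Longrightarrow> (\<lambda>i. s * y i) \<in> K"
    and nofun: "\<And>c. (\<And>y. y \<in> K \<Longrightarrow> (\<Sum>i\<in>I. c i * y i) \<le> 0) \<Longrightarrow> \<forall>i\<in>I. c i = 0"
    and "\<epsilon> > (0::real)"
  shows "\<exists>y\<in>K. \<forall>i\<in>I. \<bar>y i - y0 i\<bar> < \<epsilon>"
proof -
  define Q where "Q y = (\<Sum>i\<in>I. (y i - y0 i)\<^sup>2)" for y
  have Q0: "0 \<le> Q y" for y by (simp add: Q_def sum_nonneg)
  define d where "d = Inf (Q ` K)"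
  have bdd: "bdd_below (Q ` K)" using Q0 by (intro bdd_belowI2[of _ 0])
  have d: "d \<le> Q y" if "y \<in> K" for y unfolding d_def using bdd that by (auto intro: cInf_lower)
  have d0: "0 \<le> d" unfolding d_def using ne Q0 by (auto intro: cInf_greatest)
  have near: "\<exists>y\<in>K. Q y < d + e" if "e > 0" for e
    using cInf_lessD[of "Q ` K" "d + e"] ne that unfolding d_def by auto
  have "d = 0"
  proof (rule ccontr)
    assume "d \<noteq> 0"
    have "\<exists>y. y \<in> K \<and> Q y < d + inverse (Suc n)" for n using near[of "inverse (Suc n)"] by auto
    then obtain Y where Y: "\<And>n. Y n \<in> K" "\<And>n. Q (Y n) < d + inverse (Suc n)" by metis
    \<comment> \<open>The midpoint of two elements of the cone lies in the cone, hence is no closer than \<open>d\<close>.\<close>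
    have par: "(Y n i - Y k i)\<^sup>2 \<le> 2 * inverse (Suc n) + 2 * inverse (Suc k)" if "i \<in> I" for n k i
    proof -
      have "(\<lambda>i. (1/2) * (Y n i + Y k i)) \<in> K" using scale[OF _ add[OF Y(1) Y(1)], of "1/2"] by simp
      then have "d \<le> Q (\<lambda>i. (1/2) * (Y n i + Y k i))" by (rule d)
      moreover have "(\<Sum>i\<in>I. (Y n i - Y k i)\<^sup>2) = 2 * Q (Y n) + 2 * Q (Y k) - 4 * Q (\<lambda>i. (1/2) * (Y n i + Y k i))"
        unfolding Q_def sum_distrib_left sum.distrib[symmetric] sum_subtractf[symmetric]
        by (rule sum.cong) (auto simp: power2_eq_square algebra_simps)
      moreover have "(Y n i - Y k i)\<^sup>2 \<le> (\<Sum>i\<in>I. (Y n i - Y k i)\<^sup>2)"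
        by (rule member_le_sum[OF that _ fin]) auto
      ultimately show ?thesis using Y(2)[of n] Y(2)[of k] by linarith
    qed
    have "Cauchy (\<lambda>n. Y n i)" if "i \<in> I" for i
    proof (rule metric_CauchyI)
      fix e :: real assume "e > 0"
      then obtain N :: nat where N: "N > 0" "inverse (real N) < e\<^sup>2 / 4"
        using ex_inverse_of_nat_less[of "e\<^sup>2 / 4"] by auto
      have "dist (Y n i) (Y k i) < e" if "n \<ge> N" "k \<ge> N" for n k
      proof -
        have "inverse (real (Suc n)) \<le> inverse (real N)" "inverse (real (Suc k)) \<le> inverse (real N)"
          using that N by (auto intro!: le_imp_inverse_le)
        then have "(Y n i - Y k i)\<^sup>2 < e\<^sup>2" using par[OF \<open>i \<in> I\<close>, of n k] N(2) by linarith
        then show ?thesis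
          using power2_less_imp_less[of "\<bar>Y n i - Y k i\<bar>" e] \<open>e > 0\<close> by (simp add: dist_real_def)
      qed
      then show "\<exists>M. \<forall>m\<ge>M. \<forall>n\<ge>M. dist (Y m i) (Y n i) < e" by blast
    qed
    then have "\<forall>i. \<exists>l. i \<in> I \<longrightarrow> (\<lambda>n. Y n i) \<longlonglongrightarrow> l"
      using Cauchy_convergent convergentD by blast
    then obtain l where l: "\<And>i. i \<in> I \<Longrightarrow> (\<lambda>n. Y n i) \<longlonglongrightarrow> l i" by metis
    have lim_d: "(\<lambda>n. d + inverse (real (Suc n))) \<longlonglongrightarrow> d + 0"
      by (intro tendsto_intros LIMSEQ_inverse_real_of_nat)
    have "(\<lambda>n. Q (Y n)) \<longlonglongrightarrow> Q l" unfolding Q_def by (intro tendsto_intros l)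
    moreover have "(\<lambda>n. Q (Y n)) \<longlonglongrightarrow> d"
    proof (rule tendsto_sandwich[OF _ _ tendsto_const])
      show "(\<lambda>n. d + inverse (real (Suc n))) \<longlonglongrightarrow> d" using lim_d by simp
    qed (use d[OF Y(1)] Y(2) in \<open>auto intro!: always_eventually less_imp_le\<close>)
    ultimately have Ql: "Q l = d" using LIMSEQ_unique by blast
    define c where "c i = y0 i - l i" for i
    have "(\<Sum>i\<in>I. c i * y i) \<le> 0" if y: "y \<in> K" for y
    proof -
      \<comment> \<open>Moving from the nearest point by \<open>s y\<close> does not decrease the distance; then let \<open>s\<close> tend to \<open>0\<close>.\<close>
      have ineq: "2 * (\<Sum>i\<in>I. c i * y i) \<le> s * (\<Sum>i\<in>I. (y i)\<^sup>2)" if s: "s > 0" for s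
      proof -
        have "(\<lambda>n. Q (\<lambda>i. Y n i + s * y i)) \<longlonglongrightarrow> Q (\<lambda>i. l i + s * y i)"
          unfolding Q_def by (intro tendsto_intros l)
        then have "d \<le> Q (\<lambda>i. l i + s * y i)"
          by (rule tendsto_lowerbound) (use d[OF add[OF Y(1) scale[OF s y]]] in \<open>auto intro!: always_eventually\<close>)
        also have "\<dots> = Q l - 2 * s * (\<Sum>i\<in>I. c i * y i) + s * s * (\<Sum>i\<in>I. (y i)\<^sup>2)"
          unfolding Q_def c_def sum_distrib_left sum.distrib[symmetric] sum_subtractf[symmetric]
          by (rule sum.cong) (auto simp: power2_eq_square algebra_simps)
        finally have "s * (2 * (\<Sum>i\<in>I. c i * y i)) \<le> s * (s * (\<Sum>i\<in>I. (y i)\<^sup>2))" using Ql by (simp add: algebra_simps)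
        then show ?thesis using s by (simp only: mult_le_cancel_left_pos)
      qed
      have "((\<lambda>s. s * (\<Sum>i\<in>I. (y i)\<^sup>2)) \<longlongrightarrow> 0 * (\<Sum>i\<in>I. (y i)\<^sup>2)) (at_right 0)"
        by (intro tendsto_intros)
      then have "2 * (\<Sum>i\<in>I. c i * y i) \<le> 0 * (\<Sum>i\<in>I. (y i)\<^sup>2)"
        by (rule tendsto_lowerbound) (use ineq in \<open>auto simp: eventually_at_filter\<close>)
      then show ?thesis by simp
    qed
    then have "\<forall>i\<in>I. c i = 0" by (rule nofun)
    then have "Q l = 0" by (simp add: Q_def c_def)
    then show False using Ql \<open>d \<noteq> 0\<close> by simp
  qed
  then obtain y where y: "y \<in> K" "Q y < \<epsilon>\<^sup>2" using near[of "\<epsilon>\<^sup>2"] \<open>\<epsilon> > 0\<close> by auto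
  have "\<bar>y i - y0 i\<bar> < \<epsilon>" if "i \<in> I" for i
  proof -
    have "(y i - y0 i)\<^sup>2 \<le> Q y" unfolding Q_def by (rule member_le_sum[OF that _ fin]) auto
    then have "(y i - y0 i)\<^sup>2 < \<epsilon>\<^sup>2" using y by linarith
    then show ?thesis
      using power2_less_imp_less[of "\<bar>y i - y0 i\<bar>" \<epsilon>] \<open>\<epsilon> > 0\<close> by simp
  qed
  then show ?thesis using y(1) by blast
qed

text \<open>A cube whose dimension is a number, so that it can be the number of equality constraints. Coordinates beyond
the dimension vanish, which makes the cube compact in the product topology.\<close>

definition unit_cube :: "nat \<Rightarrow> (nat \<Rightarrow> real) set" where
  "unit_cube n = {x. (\<forall>i<n. 0 \<le> x i \<and> x i \<le> 1) \<and> (\<forall>i\<ge>n. x i = 0)}"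

lemma unit_cube_seq_compact:
  assumes "\<And>k::nat. X k \<in> unit_cube n"
  obtains x r where "x \<in> unit_cube n" "strict_mono (r :: nat \<Rightarrow> nat)" "\<And>j. (\<lambda>k. X (r k) j) \<longlonglongrightarrow> x j"
proof -
  have eq: "unit_cube n = PiE UNIV (\<lambda>i. if i < n then {0..1} else {0})"
    by (auto simp: unit_cube_def PiE_iff split: if_splits)
  have "compactin (product_topology (\<lambda>_. euclidean) UNIV) (PiE UNIV (\<lambda>i. if i < n then {0..1} else {0::real}))"
    by (simp add: compactin_PiE)
  then have "compact (unit_cube n)"
    unfolding eq euclidean_product_topology compactin_euclidean_iff .
  then obtain x r where "x \<in> unit_cube n" "strict_mono r" "(X \<circ> r) \<longlonglongrightarrow> x"
    using assms unfolding compact_def by metis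
  moreover have "(\<lambda>k. X (r k) j) \<longlonglongrightarrow> x j" if "(X \<circ> r) \<longlonglongrightarrow> x" for j
    using continuous_on_tendsto_compose[OF continuous_on_product_coordinates[of j] that] by (simp add: o_def)
  ultimately show ?thesis using that by blast
qed

text \<open>Kuhn's lemma on grids of mesh \<open>1 / k\<close> gives, for each coordinate, nearby points at which that
component of \<open>F\<close> has opposite signs. In the limit all the components vanish at a common point.\<close>

theorem poincare_miranda:
  fixes F :: "(nat \<Rightarrow> real) \<Rightarrow> nat \<Rightarrow> real"
  assumes cont: "\<And>X x i. (\<And>k. X k \<in> unit_cube n) \<Longrightarrow> x \<in> unit_cube n \<Longrightarrow> (\<And>j. (\<lambda>k. X k j) \<longlonglongrightarrow> x j) \<Longrightarrow> i < n
       \<Longrightarrow> (\<lambda>k. F (X k) i) \<longlonglongrightarrow> F x i"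
    and lo: "\<And>x i. x \<in> unit_cube n \<Longrightarrow> i < n \<Longrightarrow> x i = 0 \<Longrightarrow> F x i < 0"
    and hi: "\<And>x i. x \<in> unit_cube n \<Longrightarrow> i < n \<Longrightarrow> x i = 1 \<Longrightarrow> F x i > 0"
  shows "\<exists>x\<in>unit_cube n. \<forall>i<n. F x i = 0"
proof -
  have approx: "\<exists>z\<in>unit_cube n. \<forall>i<n. \<exists>a\<in>unit_cube n. \<exists>b\<in>unit_cube n. F a i < 0 \<and> 0 \<le> F b i \<and>
      (\<forall>j. \<bar>a j - z j\<bar> \<le> inverse (Suc k) \<and> \<bar>b j - z j\<bar> \<le> inverse (Suc k))" for k
  proof -
    define pt where "pt x = (\<lambda>i. if i < n then real (x i) / real (Suc k) else 0)" for x :: "nat \<Rightarrow> nat"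
    have pt: "pt x \<in> unit_cube n" if "\<forall>i<n. x i \<le> Suc k" for x
      using that by (auto simp: pt_def unit_cube_def divide_le_eq_1)
    \<comment> \<open>Kuhn's labels record the sign of the \<open>i\<close>-th component.\<close>
    define label where "label x i = (if F (pt x) i < 0 then 0 else 1 :: nat)" for x i
    have l0: "label x i = 0" if "\<forall>i<n. x i \<le> Suc k" "i < n" "x i = 0" for x i
      using lo[OF pt[OF that(1)] that(2)] that by (simp add: label_def pt_def)
    have l1: "label x i = 1" if "\<forall>i<n. x i \<le> Suc k" "i < n" "x i = Suc k" for x i
      using hi[OF pt[OF that(1)] that(2)] that by (simp add: label_def pt_def)
    obtain p where p: "\<forall>i<n. p i < Suc k" and
      rs: "\<forall>i<n. \<exists>r s. (\<forall>j<n. p j \<le> r j \<and> r j \<le> p j + 1) \<and> (\<forall>j<n. p j \<le> s j \<and> s j \<le> p j + 1) \<and> label r i \<noteq> label s i"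
      by (rule kuhn_lemma[of "Suc k" n label]) (use l0 l1 in \<open>auto simp: label_def\<close>)
    have close: "pt r \<in> unit_cube n" "\<bar>pt r j - pt p j\<bar> \<le> inverse (Suc k)"
      if r: "\<forall>j<n. p j \<le> r j \<and> r j \<le> p j + 1" for r j
    proof -
      show "pt r \<in> unit_cube n" by (rule pt) (use p r in \<open>metis Suc_eq_plus1 Suc_leI order_trans\<close>)
      show "\<bar>pt r j - pt p j\<bar> \<le> inverse (Suc k)"
      proof (cases "j < n")
        case True
        then have "pt r j - pt p j = (real (r j) - real (p j)) / real (Suc k)"
          by (simp add: pt_def diff_divide_distrib)
        moreover have "0 \<le> real (r j) - real (p j)" "real (r j) - real (p j) \<le> 1" using r True by fastforce+
        ultimately show ?thesis by (simp add: divide_inverse mult_left_le_one_le)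
      qed (simp add: pt_def)
    qed
    have "\<exists>a\<in>unit_cube n. \<exists>b\<in>unit_cube n. F a i < 0 \<and> 0 \<le> F b i \<and>
      (\<forall>j. \<bar>a j - pt p j\<bar> \<le> inverse (Suc k) \<and> \<bar>b j - pt p j\<bar> \<le> inverse (Suc k))" if i: "i < n" for i
    proof -
      obtain r s where *: "\<forall>j<n. p j \<le> r j \<and> r j \<le> p j + 1" "\<forall>j<n. p j \<le> s j \<and> s j \<le> p j + 1" "label r i \<noteq> label s i"
        using rs i by blast
      show ?thesis
      proof (cases "F (pt r) i < 0")
        case True
        then have "0 \<le> F (pt s) i" using *(3) by (simp add: label_def split: if_splits)
        then show ?thesis using True close[OF *(1)] close[OF *(2)]
          by (intro bexI[of _ "pt r"] bexI[of _ "pt s"]) auto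
      next
        case False
        then have "F (pt s) i < 0" using *(3) by (simp add: label_def split: if_splits)
        then show ?thesis using False close[OF *(1)] close[OF *(2)]
          by (intro bexI[of _ "pt s"] bexI[of _ "pt r"]) auto
      qed
    qed
    moreover have "pt p \<in> unit_cube n" by (rule pt) (use p in \<open>auto simp: less_imp_le\<close>)
    ultimately show ?thesis by blast
  qed
  define good where "good k z i a b \<longleftrightarrow> a \<in> unit_cube n \<and> b \<in> unit_cube n \<and> F a i < 0 \<and> 0 \<le> F b i \<and>
      (\<forall>j. \<bar>a j - z j\<bar> \<le> inverse (Suc k) \<and> \<bar>b j - z j\<bar> \<le> inverse (Suc k))" for k and z a b :: "nat \<Rightarrow> real" and i
  have "\<forall>k. \<exists>z. z \<in> unit_cube n \<and> (\<forall>i<n. \<exists>a b. good k z i a b)"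
    using approx unfolding good_def by meson
  then obtain Z where Z: "\<And>k. Z k \<in> unit_cube n" "\<And>k i. i < n \<Longrightarrow> \<exists>a b. good k (Z k) i a b" by metis
  obtain x r where x: "x \<in> unit_cube n" "strict_mono r" "\<And>j. (\<lambda>k. Z (r k) j) \<longlonglongrightarrow> x j"
    using unit_cube_seq_compact[of Z n] Z(1) by metis
  have "F x i = 0" if i: "i < n" for i
  proof -
    have "\<forall>k. \<exists>a b. good k (Z k) i a b" using Z(2)[OF i] by blast
    then obtain a b where ab: "\<And>k. good k (Z k) i (a k) (b k)" by metis
    have inv: "(\<lambda>k. inverse (real (Suc (r k)))) \<longlonglongrightarrow> 0"
      using LIMSEQ_subseq_LIMSEQ[OF LIMSEQ_inverse_real_of_nat x(2)] unfolding o_def .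
    have conv: "(\<lambda>k. c (r k) j) \<longlonglongrightarrow> x j" if c: "\<And>k j. \<bar>c k j - Z k j\<bar> \<le> inverse (Suc k)" for c j
    proof -
      have "(\<lambda>k. c (r k) j - Z (r k) j) \<longlonglongrightarrow> 0"
        by (rule Lim_null_comparison[OF _ inv]) (use c in \<open>simp add: always_eventually\<close>)
      then have "(\<lambda>k. (c (r k) j - Z (r k) j) + Z (r k) j) \<longlonglongrightarrow> 0 + x j" by (intro tendsto_add x(3))
      then show ?thesis by simp
    qed
    have "(\<lambda>k. F (a (r k)) i) \<longlonglongrightarrow> F x i"
      by (rule cont[OF _ x(1) conv i]) (use ab in \<open>auto simp: good_def\<close>)
    then have "F x i \<le> 0"
      by (rule tendsto_upperbound) (use ab in \<open>auto simp: good_def intro!: always_eventually less_imp_le\<close>)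
    moreover have "(\<lambda>k. F (b (r k)) i) \<longlonglongrightarrow> F x i"
      by (rule cont[OF _ x(1) conv i]) (use ab in \<open>auto simp: good_def\<close>)
    then have "0 \<le> F x i"
      by (rule tendsto_lowerbound) (use ab in \<open>auto simp: good_def intro!: always_eventually\<close>)
    ultimately show ?thesis by simp
  qed
  then show ?thesis using x(1) by blast
qed

text \<open>Properties that hold eventually along all converging sequences hold, by compactness, for one parameter
uniformly on the cube.\<close>

lemma unit_cube_uniform:
  assumes "\<theta>0 > (0::real)"
    and seq: "\<And>X x \<Theta>. (\<And>k. X k \<in> unit_cube n) \<Longrightarrow> x \<in> unit_cube n \<Longrightarrow> (\<And>j. (\<lambda>k. X k j) \<longlonglongrightarrow> x j) \<Longrightarrow>
       (\<And>k::nat. 0 < \<Theta> k \<and> \<Theta> k \<le> \<theta>0) \<Longrightarrow> \<Theta> \<longlonglongrightarrow> 0 \<Longrightarrow> \<forall>\<^sub>F k in sequentially. P (\<Theta> k) (X k)"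
  shows "\<exists>\<theta>>0. \<theta> \<le> \<theta>0 \<and> (\<forall>x\<in>unit_cube n. P \<theta> x)"
proof (rule ccontr)
  assume neg: "\<not> ?thesis"
  define \<Theta> where "\<Theta> k = \<theta>0 * inverse (real (Suc k))" for k
  have \<Theta>: "0 < \<Theta> k \<and> \<Theta> k \<le> \<theta>0" for k
    using assms(1) by (auto simp: \<Theta>_def field_simps)
  then have "\<forall>k. \<exists>x. x \<in> unit_cube n \<and> \<not> P (\<Theta> k) x" using neg by blast
  then obtain X where X: "\<And>k. X k \<in> unit_cube n" "\<And>k. \<not> P (\<Theta> k) (X k)" by metis
  obtain x r where x: "x \<in> unit_cube n" "strict_mono r" "\<And>j. (\<lambda>k. X (r k) j) \<longlonglongrightarrow> x j"
    using unit_cube_seq_compact[of X n] X(1) by metis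
  have "(\<lambda>k. \<theta>0 * inverse (real (Suc k))) \<longlonglongrightarrow> \<theta>0 * 0"
    by (intro tendsto_intros LIMSEQ_inverse_real_of_nat)
  then have "\<Theta> \<longlonglongrightarrow> 0" by (simp add: \<Theta>_def[abs_def])
  then have "(\<lambda>k. \<Theta> (r k)) \<longlonglongrightarrow> 0"
    using LIMSEQ_subseq_LIMSEQ[OF _ x(2), of \<Theta> 0] unfolding o_def by blast
  then have "\<forall>\<^sub>F k in sequentially. P (\<Theta> (r k)) (X (r k))"
    by (intro seq[of "\<lambda>k. X (r k)" x "\<lambda>k. \<Theta> (r k)"]) (use X x \<Theta> in auto)
  then show False using X(2) by (simp add: eventually_False)
qed

section \<open>Multipliers from families of variations\<close>

text \<open>The difference quotients of \<open>y\<close> have to converge to \<open>v\<close>, not to equal it: this is what Hadamard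
differentiability adds to Gateaux differentiability.\<close>

lemma hadamard_differential_seq:
  assumes F: "has_hadamard_differential F D x"
    and \<Theta>: "\<And>k::nat. 0 < \<Theta> k" "\<Theta> \<longlonglongrightarrow> 0"
    and y: "(\<lambda>k. (y k - x) /\<^sub>R \<Theta> k) \<longlonglongrightarrow> v"
  shows "(\<lambda>k. (F (y k) - F x) /\<^sub>R \<Theta> k) \<longlonglongrightarrow> blinfun_apply D v"
proof -
  have "filterlim \<Theta> (at_right 0) sequentially"
    by (rule tendsto_imp_filterlim_at_right[OF \<Theta>(2)]) (use \<Theta>(1) in auto)
  then have "filterlim (\<lambda>k. (\<Theta> k, (y k - x) /\<^sub>R \<Theta> k)) (at_right 0 \<times>\<^sub>F nhds v) sequentially"
    by (rule filterlim_Pair[OF _ y])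
  moreover have "((\<lambda>(\<theta>, w). (F (x + \<theta> *\<^sub>R w) - F x) /\<^sub>R \<theta>) \<longlongrightarrow> blinfun_apply D v) (at_right 0 \<times>\<^sub>F nhds v)"
    using F unfolding has_hadamard_differential_def by blast
  ultimately have "(\<lambda>k. (\<lambda>(\<theta>, w). (F (x + \<theta> *\<^sub>R w) - F x) /\<^sub>R \<theta>) (\<Theta> k, (y k - x) /\<^sub>R \<Theta> k)) \<longlonglongrightarrow> blinfun_apply D v"
    by (rule filterlim_compose[rotated])
  moreover have "x + \<Theta> k *\<^sub>R ((y k - x) /\<^sub>R \<Theta> k) = y k" for k
    using \<Theta>(1)[of k] by simp
  ultimately show ?thesis by simp
qed

lemma tendsto_of_quotient:
  fixes y :: "nat \<Rightarrow> 'a::real_normed_vector"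
  assumes "\<And>k::nat. 0 < \<Theta> k" "\<Theta> \<longlonglongrightarrow> 0" "(\<lambda>k. (y k - x) /\<^sub>R \<Theta> k) \<longlonglongrightarrow> v"
  shows "y \<longlonglongrightarrow> x"
proof -
  have "(\<lambda>k. x + \<Theta> k *\<^sub>R ((y k - x) /\<^sub>R \<Theta> k)) \<longlonglongrightarrow> x + 0 *\<^sub>R v"
    by (intro tendsto_intros assms(2,3))
  moreover have "x + \<Theta> k *\<^sub>R ((y k - x) /\<^sub>R \<Theta> k) = y k" for k
    using assms(1)[of k] by simp
  ultimately show ?thesis by simp
qed

definition weights :: "'i set \<Rightarrow> real \<Rightarrow> ('i \<Rightarrow> real) \<Rightarrow> bool" where
  "weights P \<delta> a \<longleftrightarrow> (\<forall>w\<in>P. 0 \<le> a w) \<and> sum a P \<le> \<delta>"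

text \<open>A family of elements of \<open>X\<close>, indexed by nonnegative weights on the finite set \<open>P\<close> of vectors,
that is continuous and has the right derivative \<open>a \<mapsto> \<Sum> a\<^sub>w w\<close> at the origin. The derivative is stated along
sequences \<open>\<Theta>\<^sub>k a\<^sub>k\<close> with converging \<open>a\<^sub>k\<close>, the form in which compactness of the cube and Hadamard differentiability use it.\<close>

definition variation_family ::
  "'a::real_normed_vector set \<Rightarrow> 'a \<Rightarrow> 'a set \<Rightarrow> real \<Rightarrow> (('a \<Rightarrow> real) \<Rightarrow> 'a) \<Rightarrow> bool" where
  "variation_family X e0 P \<delta> y \<longleftrightarrow> \<delta> > 0 \<and>
     (\<forall>a. weights P \<delta> a \<longrightarrow> y a \<in> X) \<and>
     (\<forall>A a. (\<forall>k::nat. weights P \<delta> (A k)) \<and> weights P \<delta> a \<and> (\<forall>w\<in>P. (\<lambda>k. A k w) \<longlonglongrightarrow> a w) \<longrightarrow>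
        (\<lambda>k. y (A k)) \<longlonglongrightarrow> y a) \<and>
     (\<forall>\<Theta> A a. (\<forall>k::nat. 0 < \<Theta> k \<and> (\<forall>w\<in>P. 0 \<le> A k w) \<and> weights P \<delta> (\<lambda>w. \<Theta> k * A k w)) \<and> \<Theta> \<longlonglongrightarrow> 0 \<and>
        (\<forall>w\<in>P. (\<lambda>k. A k w) \<longlonglongrightarrow> a w) \<longrightarrow>
        (\<lambda>k. (y (\<lambda>w. \<Theta> k * A k w) - e0) /\<^sub>R \<Theta> k) \<longlonglongrightarrow> (\<Sum>w\<in>P. a w *\<^sub>R w))"

text \<open>The coefficients are defined everywhere and vanish outside \<open>P\<close>, so that combinations over different
sets can be added and compared over the union.\<close>

definition nonneg_comb :: "'a::real_normed_vector set \<Rightarrow> 'a \<Rightarrow> 'a set \<Rightarrow> ('a \<Rightarrow> real) \<Rightarrow> bool" where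
  "nonneg_comb V v P c \<longleftrightarrow> finite P \<and> P \<subseteq> V \<and> (\<forall>w. 0 \<le> c w) \<and> (\<forall>w. w \<notin> P \<longrightarrow> c w = 0) \<and>
     v = (\<Sum>w\<in>P. c w *\<^sub>R w)"

lemma nonneg_comb_superset:
  assumes "nonneg_comb V v P c" "finite P'" "P \<subseteq> P'"
  shows "(\<Sum>w\<in>P'. c w *\<^sub>R w) = v"
proof -
  have "(\<Sum>w\<in>P'. c w *\<^sub>R w) = (\<Sum>w\<in>P. c w *\<^sub>R w)"
    by (rule sum.mono_neutral_right) (use assms in \<open>auto simp: nonneg_comb_def\<close>)
  then show ?thesis using assms(1) by (simp add: nonneg_comb_def)
qed

lemma nonneg_comb_add:
  assumes 1: "nonneg_comb V v P c" and 2: "nonneg_comb V v' P' c'"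
  shows "nonneg_comb V (v + v') (P \<union> P') (\<lambda>w. c w + c' w)"
proof -
  have fin: "finite (P \<union> P')" using 1 2 by (simp add: nonneg_comb_def)
  have "(\<Sum>w\<in>P \<union> P'. (c w + c' w) *\<^sub>R w) = v + v'"
    using nonneg_comb_superset[OF 1 fin] nonneg_comb_superset[OF 2 fin]
    by (simp add: scaleR_add_left sum.distrib)
  then show ?thesis using 1 2 fin by (auto simp: nonneg_comb_def)
qed

lemma nonneg_comb_scale:
  assumes "nonneg_comb V v P c" "0 \<le> s"
  shows "nonneg_comb V (s *\<^sub>R v) P (\<lambda>w. s * c w)"
  using assms by (auto simp: nonneg_comb_def scaleR_sum_right)

text \<open>Suppose that combinations \<open>vp i\<close> and \<open>vm i\<close> increase all active \<open>g\<close> to first order and move \<open>h\<close>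
approximately along the \<open>i\<close>-th axis in the two senses. The points \<open>z\<close> of the unit cube interpolate between them; for small \<open>\<theta>\<close>
the map \<open>z \<mapsto> h\<close> at the varied end point satisfies the sign conditions of Poincare-Miranda.
At its zero all constraints hold and \<open>g 0\<close> exceeds its maximum.\<close>

lemma spanning_directions_contradict_optimality:
  fixes g h :: "nat \<Rightarrow> 'a::real_normed_vector \<Rightarrow> real" and Dg Dh :: "nat \<Rightarrow> 'a \<Rightarrow>\<^sub>L real"
  assumes q: "1 \<le> q"
    and Dg: "\<And>\<alpha>. \<alpha> \<in> {0..m} \<Longrightarrow> has_hadamard_differential (g \<alpha>) (Dg \<alpha>) e0"
    and Dh: "\<And>\<beta>. \<beta> \<in> {1..q} \<Longrightarrow> has_hadamard_differential (h \<beta>) (Dh \<beta>) e0"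
    and hc: "\<And>\<beta>. \<beta> \<in> {1..q} \<Longrightarrow> \<exists>V. open V \<and> e0 \<in> V \<and> continuous_on V (h \<beta>)"
    and g0: "\<And>\<alpha>. \<alpha> \<in> {1..m} \<Longrightarrow> 0 \<le> g \<alpha> e0" and h0: "\<And>\<beta>. \<beta> \<in> {1..q} \<Longrightarrow> h \<beta> e0 = 0"
    and opt: "\<And>x. x \<in> X \<Longrightarrow> (\<And>\<alpha>. \<alpha> \<in> {1..m} \<Longrightarrow> 0 \<le> g \<alpha> x) \<Longrightarrow> (\<And>\<beta>. \<beta> \<in> {1..q} \<Longrightarrow> h \<beta> x = 0) \<Longrightarrow> g 0 x \<le> g 0 e0"
    and var: "\<And>P. finite P \<Longrightarrow> P \<subseteq> V0 \<Longrightarrow> \<exists>\<delta> y. variation_family X e0 P \<delta> y"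
    and A: "A \<subseteq> {0..m}" "0 \<in> A" "\<And>\<alpha>. \<alpha> \<in> {1..m} - A \<Longrightarrow> 0 < g \<alpha> e0"
    and vp: "\<And>i. i < q \<Longrightarrow> nonneg_comb V0 (vp i) (Pp i) (cp i)"
    and vm: "\<And>i. i < q \<Longrightarrow> nonneg_comb V0 (vm i) (Pm i) (cm i)"
    and gp: "\<And>i \<alpha>. i < q \<Longrightarrow> \<alpha> \<in> A \<Longrightarrow> 0 < Dg \<alpha> (vp i)"
    and gm: "\<And>i \<alpha>. i < q \<Longrightarrow> \<alpha> \<in> A \<Longrightarrow> 0 < Dg \<alpha> (vm i)"
    and hp: "\<And>i j. i < q \<Longrightarrow> j < q \<Longrightarrow> \<bar>Dh (Suc j) (vp i) - of_bool (i = j)\<bar> \<le> 1 / (4 * real q)"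
    and hm: "\<And>i j. i < q \<Longrightarrow> j < q \<Longrightarrow> \<bar>Dh (Suc j) (vm i) + of_bool (i = j)\<bar> \<le> 1 / (4 * real q)"
  shows False
proof -
  define P where "P = (\<Union>i<q. Pp i \<union> Pm i)"
  have finP: "finite P" using vp vm by (auto simp: P_def nonneg_comb_def)
  have "Pp i \<subseteq> V0" "Pm i \<subseteq> V0" if "i < q" for i
    using vp[OF that] vm[OF that] by (simp_all add: nonneg_comb_def)
  then have PV: "P \<subseteq> V0" by (auto simp: P_def)
  obtain \<delta> y where yfam: "variation_family X e0 P \<delta> y" using var[OF finP PV] by blast
  have \<delta>: "\<delta> > 0" and yX: "\<And>a. weights P \<delta> a \<Longrightarrow> y a \<in> X"
    and ycont: "\<And>A a. (\<And>k::nat. weights P \<delta> (A k)) \<Longrightarrow> weights P \<delta> a \<Longrightarrow> (\<And>w. w \<in> P \<Longrightarrow> (\<lambda>k. A k w) \<longlonglongrightarrow> a w) \<Longrightarrow>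
        (\<lambda>k. y (A k)) \<longlonglongrightarrow> y a"
    and ydiff: "\<And>\<Theta> A a. (\<And>k::nat. 0 < \<Theta> k) \<Longrightarrow> (\<And>k w. w \<in> P \<Longrightarrow> 0 \<le> A k w) \<Longrightarrow> (\<And>k. weights P \<delta> (\<lambda>w. \<Theta> k * A k w)) \<Longrightarrow>
        \<Theta> \<longlonglongrightarrow> 0 \<Longrightarrow> (\<And>w. w \<in> P \<Longrightarrow> (\<lambda>k. A k w) \<longlonglongrightarrow> a w) \<Longrightarrow>
        (\<lambda>k. (y (\<lambda>w. \<Theta> k * A k w) - e0) /\<^sub>R \<Theta> k) \<longlonglongrightarrow> (\<Sum>w\<in>P. a w *\<^sub>R w)"
    using yfam unfolding variation_family_def by simp_all
  \<comment> \<open>The coordinate \<open>z i\<close> blends from \<open>vm i\<close> at \<open>0\<close> to \<open>vp i\<close> at \<open>1\<close>; the weights stay nonnegative on the cube.\<close>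
  define b where "b z w = (\<Sum>i<q. z i * cp i w + (1 - z i) * cm i w)" for z :: "nat \<Rightarrow> real" and w
  define v where "v z = (\<Sum>i<q. z i *\<^sub>R vp i + (1 - z i) *\<^sub>R vm i)" for z :: "nat \<Rightarrow> real"
  have sub: "Pp i \<subseteq> P" "Pm i \<subseteq> P" if "i < q" for i using that by (auto simp: P_def)
  have bv: "(\<Sum>w\<in>P. b z w *\<^sub>R w) = v z" for z
  proof -
    have "(\<Sum>w\<in>P. b z w *\<^sub>R w) = (\<Sum>w\<in>P. \<Sum>i<q. z i *\<^sub>R (cp i w *\<^sub>R w) + (1 - z i) *\<^sub>R (cm i w *\<^sub>R w))"
      by (simp add: b_def scaleR_sum_left scaleR_add_left)
    also have "\<dots> = (\<Sum>i<q. \<Sum>w\<in>P. z i *\<^sub>R (cp i w *\<^sub>R w) + (1 - z i) *\<^sub>R (cm i w *\<^sub>R w))"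
      by (rule sum.swap)
    also have "\<dots> = (\<Sum>i<q. z i *\<^sub>R (\<Sum>w\<in>P. cp i w *\<^sub>R w) + (1 - z i) *\<^sub>R (\<Sum>w\<in>P. cm i w *\<^sub>R w))"
      by (simp add: sum.distrib scaleR_sum_right)
    also have "\<dots> = v z" unfolding v_def
      by (rule sum.cong) (use nonneg_comb_superset[OF vp finP sub(1)] nonneg_comb_superset[OF vm finP sub(2)] in auto)
    finally show ?thesis .
  qed
  have cp0: "0 \<le> cp i w" "0 \<le> cm i w" if "i < q" for i w
    using vp[OF that] vm[OF that] by (auto simp: nonneg_comb_def)
  have b0: "0 \<le> b z w" if "z \<in> unit_cube q" for z w
    unfolding b_def using that cp0 by (intro sum_nonneg add_nonneg_nonneg mult_nonneg_nonneg) (auto simp: unit_cube_def)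
  define C where "C = (\<Sum>w\<in>P. \<Sum>i<q. cp i w + cm i w)"
  have C0: "0 \<le> C" unfolding C_def by (intro sum_nonneg add_nonneg_nonneg) (use cp0 in auto)
  have bC: "sum (b z) P \<le> C" if "z \<in> unit_cube q" for z
    unfolding C_def b_def using that cp0
    by (intro sum_mono add_mono mult_left_le_one_le) (auto simp: unit_cube_def)
  define \<theta>0 where "\<theta>0 = \<delta> / (C + 1)"
  have \<theta>0: "\<theta>0 > 0" using \<delta> C0 by (simp add: \<theta>0_def)
  have sm: "weights P \<delta> (\<lambda>w. \<theta> * b z w)" if "z \<in> unit_cube q" "0 < \<theta>" "\<theta> \<le> \<theta>0" for z \<theta>
  proof -
    have "sum (\<lambda>w. \<theta> * b z w) P = \<theta> * sum (b z) P" by (simp add: sum_distrib_left)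
    also have "\<dots> \<le> \<theta>0 * (C + 1)" using that bC[OF that(1)] C0 \<theta>0
      by (intro mult_mono) (auto intro!: sum_nonneg b0)
    also have "\<dots> = \<delta>" using C0 by (simp add: \<theta>0_def)
    finally show ?thesis using b0[OF that(1)] that(2) by (simp add: weights_def)
  qed
  \<comment> \<open>The \<open>q\<close> errors of at most \<open>1 / (4 q)\<close> add up to \<open>1 / 4\<close>, too little to change the sign on the faces \<open>z j = 0\<close> and \<open>z j = 1\<close>.\<close>
  have Dhv: "\<bar>Dh (Suc j) (v z) - (2 * z j - 1)\<bar> \<le> 1 / 4" if z: "z \<in> unit_cube q" and j: "j < q" for z j
  proof -
    have "2 * z j - 1 = (\<Sum>i<q. of_bool (i = j) * (2 * z i - 1))"
      using j by (simp add: sum.delta of_bool_def if_distrib[of "\<lambda>x. x * _"] cong: if_cong)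
    moreover have "Dh (Suc j) (v z) = (\<Sum>i<q. z i * Dh (Suc j) (vp i) + (1 - z i) * Dh (Suc j) (vm i))"
      by (simp add: v_def blinfun.sum_right blinfun.add_right blinfun.scaleR_right)
    ultimately have "Dh (Suc j) (v z) - (2 * z j - 1) =
        (\<Sum>i<q. (z i * Dh (Suc j) (vp i) + (1 - z i) * Dh (Suc j) (vm i)) - of_bool (i = j) * (2 * z i - 1))"
      by (simp only: sum_subtractf)
    also have "\<dots> =
        (\<Sum>i<q. z i * (Dh (Suc j) (vp i) - of_bool (i = j)) + (1 - z i) * (Dh (Suc j) (vm i) + of_bool (i = j)))"
      by (rule sum.cong) (auto simp: algebra_simps)
    also have "\<bar>\<dots>\<bar> \<le> (\<Sum>i<q. 1 / (4 * real q))"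
    proof (rule order_trans[OF sum_abs sum_mono])
      fix i assume "i \<in> {..<q}"
      then have i: "i < q" "0 \<le> z i" "z i \<le> 1" using z by (auto simp: unit_cube_def)
      have "\<bar>z i * (Dh (Suc j) (vp i) - of_bool (i = j)) + (1 - z i) * (Dh (Suc j) (vm i) + of_bool (i = j))\<bar>
        \<le> \<bar>z i * (Dh (Suc j) (vp i) - of_bool (i = j))\<bar> + \<bar>(1 - z i) * (Dh (Suc j) (vm i) + of_bool (i = j))\<bar>"
        by (rule abs_triangle_ineq)
      also have "\<dots> = z i * \<bar>Dh (Suc j) (vp i) - of_bool (i = j)\<bar> + (1 - z i) * \<bar>Dh (Suc j) (vm i) + of_bool (i = j)\<bar>"
        using i by (simp add: abs_mult)
      also have "\<dots> \<le> z i * (1 / (4 * real q)) + (1 - z i) * (1 / (4 * real q))"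
        using i by (intro add_mono mult_left_mono hp hm j) auto
      also have "\<dots> = 1 / (4 * real q)" by (simp flip: distrib_right add_divide_distrib)
      finally show "\<bar>z i * (Dh (Suc j) (vp i) - of_bool (i = j)) + (1 - z i) * (Dh (Suc j) (vm i) + of_bool (i = j))\<bar>
        \<le> 1 / (4 * real q)" .
    qed
    also have "\<dots> = 1 / 4" using q by simp
    finally show ?thesis .
  qed
  have Dgv: "0 < Dg \<alpha> (v z)" if z: "z \<in> unit_cube q" and \<alpha>: "\<alpha> \<in> A" for z \<alpha>
  proof -
    have "Dg \<alpha> (v z) = (\<Sum>i<q. z i * Dg \<alpha> (vp i) + (1 - z i) * Dg \<alpha> (vm i))"
      by (simp add: v_def blinfun.sum_right blinfun.add_right blinfun.scaleR_right)
    also have "\<dots> > 0"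
    proof (rule sum_pos)
      fix i assume "i \<in> {..<q}"
      then have i: "i < q" "0 \<le> z i" "z i \<le> 1" using z by (auto simp: unit_cube_def)
      show "0 < z i * Dg \<alpha> (vp i) + (1 - z i) * Dg \<alpha> (vm i)"
      proof (cases "z i = 0")
        case True then show ?thesis using gm[OF i(1) \<alpha>] by simp
      next
        case False then show ?thesis using gp[OF i(1) \<alpha>] gm[OF i(1) \<alpha>] i
          by (intro add_pos_nonneg mult_pos_pos mult_nonneg_nonneg) auto
      qed
    qed (use q in \<open>auto simp: lessThan_empty_iff\<close>)
    finally show ?thesis .
  qed
  obtain W where W: "\<And>\<beta>. \<beta> \<in> {1..q} \<Longrightarrow> open (W \<beta>) \<and> e0 \<in> W \<beta> \<and> continuous_on (W \<beta>) (h \<beta>)"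
    using hc by metis
  define N where "N = (\<Inter>\<beta>\<in>{1..q}. W \<beta>)"
  have N: "open N" "e0 \<in> N" unfolding N_def using W by (auto intro!: open_INT)
  have hN: "continuous_on N (h \<beta>)" if "\<beta> \<in> {1..q}" for \<beta>
    by (rule continuous_on_subset[of "W \<beta>"]) (use W[OF that] that in \<open>auto simp: N_def\<close>)
  define Y where "Y \<theta> z = y (\<lambda>w. \<theta> * b z w)" for \<theta> z
  \<comment> \<open>All the open conditions that must hold for one \<open>\<theta>\<close> and every \<open>z\<close>.\<close>
  define ok where "ok \<theta> z \<longleftrightarrow> Y \<theta> z \<in> N \<and> (\<forall>\<alpha>\<in>A. g \<alpha> e0 < g \<alpha> (Y \<theta> z)) \<and>
      (\<forall>\<alpha>\<in>{1..m} - A. 0 < g \<alpha> (Y \<theta> z)) \<and>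
      (\<forall>j\<in>{..<q}. (z j = 1 \<longrightarrow> 0 < h (Suc j) (Y \<theta> z)) \<and> (z j = 0 \<longrightarrow> h (Suc j) (Y \<theta> z) < 0))" for \<theta> z
  have "\<exists>\<theta>>0. \<theta> \<le> \<theta>0 \<and> (\<forall>z\<in>unit_cube q. ok \<theta> z)"
  proof (rule unit_cube_uniform[OF \<theta>0])
    fix Z z \<Theta>
    assume Z: "\<And>k::nat. Z k \<in> unit_cube q" and z: "z \<in> unit_cube q" and Zz: "\<And>j. (\<lambda>k. Z k j) \<longlonglongrightarrow> z j"
      and \<Theta>: "\<And>k::nat. 0 < \<Theta> k \<and> \<Theta> k \<le> \<theta>0" and \<Theta>0: "\<Theta> \<longlonglongrightarrow> 0"
    have \<Theta>p: "\<And>k. 0 < \<Theta> k" using \<Theta> by blast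
    have lim: "(\<lambda>k. (Y (\<Theta> k) (Z k) - e0) /\<^sub>R \<Theta> k) \<longlonglongrightarrow> v z"
      unfolding Y_def bv[symmetric]
    proof (rule ydiff[OF \<Theta>p _ sm \<Theta>0])
      show "(\<lambda>k. b (Z k) w) \<longlonglongrightarrow> b z w" for w unfolding b_def by (intro tendsto_intros Zz)
    qed (use Z \<Theta> b0 in auto)
    have Ye0: "(\<lambda>k. Y (\<Theta> k) (Z k)) \<longlonglongrightarrow> e0" by (rule tendsto_of_quotient[OF \<Theta>p \<Theta>0 lim])
    have gq: "(\<lambda>k. (g \<alpha> (Y (\<Theta> k) (Z k)) - g \<alpha> e0) /\<^sub>R \<Theta> k) \<longlonglongrightarrow> Dg \<alpha> (v z)" if "\<alpha> \<in> {0..m}" for \<alpha>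
      by (rule hadamard_differential_seq[OF Dg[OF that] \<Theta>p \<Theta>0 lim])
    have hq: "(\<lambda>k. (h \<beta> (Y (\<Theta> k) (Z k)) - h \<beta> e0) /\<^sub>R \<Theta> k) \<longlonglongrightarrow> Dh \<beta> (v z)" if "\<beta> \<in> {1..q}" for \<beta>
      by (rule hadamard_differential_seq[OF Dh[OF that] \<Theta>p \<Theta>0 lim])
    have 1: "\<forall>\<^sub>F k in sequentially. Y (\<Theta> k) (Z k) \<in> N" by (rule topological_tendstoD[OF Ye0 N])
    have 2: "\<forall>\<^sub>F k in sequentially. \<forall>\<alpha>\<in>A. g \<alpha> e0 < g \<alpha> (Y (\<Theta> k) (Z k))"
    proof (rule eventually_ball_finite)
      show "finite A" using A(1) finite_subset by blast
      show "\<forall>\<alpha>\<in>A. \<forall>\<^sub>F k in sequentially. g \<alpha> e0 < g \<alpha> (Y (\<Theta> k) (Z k))"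
      proof
        fix \<alpha> assume \<alpha>: "\<alpha> \<in> A"
        then have "\<alpha> \<in> {0..m}" using A(1) by blast
        from order_tendstoD(1)[OF gq[OF this] Dgv[OF z \<alpha>]]
        show "\<forall>\<^sub>F k in sequentially. g \<alpha> e0 < g \<alpha> (Y (\<Theta> k) (Z k))"
          by (rule eventually_mono) (use \<Theta>p in \<open>auto simp: zero_less_mult_iff dest: less_imp_not_less\<close>)
      qed
    qed
    have 3: "\<forall>\<^sub>F k in sequentially. \<forall>\<alpha>\<in>{1..m} - A. 0 < g \<alpha> (Y (\<Theta> k) (Z k))"
    proof (rule eventually_ball_finite)
      show "\<forall>\<alpha>\<in>{1..m} - A. \<forall>\<^sub>F k in sequentially. 0 < g \<alpha> (Y (\<Theta> k) (Z k))"
      proof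
        fix \<alpha> assume \<alpha>: "\<alpha> \<in> {1..m} - A"
        then have "\<alpha> \<in> {0..m}" by auto
        from tendsto_of_quotient[OF \<Theta>p \<Theta>0 gq[OF this]]
        show "\<forall>\<^sub>F k in sequentially. 0 < g \<alpha> (Y (\<Theta> k) (Z k))"
          by (rule order_tendstoD(1)) (rule A(3)[OF \<alpha>])
      qed
    qed simp
    have 4: "\<forall>\<^sub>F k in sequentially. \<forall>j\<in>{..<q}. (Z k j = 1 \<longrightarrow> 0 < h (Suc j) (Y (\<Theta> k) (Z k))) \<and>
       (Z k j = 0 \<longrightarrow> h (Suc j) (Y (\<Theta> k) (Z k)) < 0)"
    proof (rule eventually_ball_finite)
      show "\<forall>j\<in>{..<q}. \<forall>\<^sub>F k in sequentially. (Z k j = 1 \<longrightarrow> 0 < h (Suc j) (Y (\<Theta> k) (Z k))) \<and>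
       (Z k j = 0 \<longrightarrow> h (Suc j) (Y (\<Theta> k) (Z k)) < 0)"
      proof
        fix j assume "j \<in> {..<q}"
        then have j: "j < q" "Suc j \<in> {1..q}" by auto
        have quot: "(\<lambda>k. h (Suc j) (Y (\<Theta> k) (Z k)) / \<Theta> k) \<longlonglongrightarrow> Dh (Suc j) (v z)"
          using hq[OF j(2)] h0[OF j(2)] by (simp add: divide_inverse mult.commute)
        have "\<forall>\<^sub>F k in sequentially. Z k j = 1 \<longrightarrow> 0 < h (Suc j) (Y (\<Theta> k) (Z k))"
        \<comment> \<open>If the limit is not on the face, then neither are the late elements of the sequence.\<close>
        proof (cases "z j = 1")
          case True
          then have "0 < Dh (Suc j) (v z)" using Dhv[OF z j(1)] unfolding True by linarith
          from order_tendstoD(1)[OF quot this] show ?thesis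
            by (rule eventually_mono) (use \<Theta>p in \<open>auto simp: zero_less_divide_iff dest: less_imp_not_less\<close>)
        next
          case False
          from tendsto_imp_eventually_ne[OF Zz[of j] this] show ?thesis by (rule eventually_mono) simp
        qed
        moreover have "\<forall>\<^sub>F k in sequentially. Z k j = 0 \<longrightarrow> h (Suc j) (Y (\<Theta> k) (Z k)) < 0"
        proof (cases "z j = 0")
          case True
          then have "Dh (Suc j) (v z) < 0" using Dhv[OF z j(1)] unfolding True by linarith
          from order_tendstoD(2)[OF quot this] show ?thesis
            by (rule eventually_mono) (use \<Theta>p in \<open>auto simp: divide_less_0_iff dest: less_imp_not_less\<close>)
        next
          case False
          from tendsto_imp_eventually_ne[OF Zz[of j] this] show ?thesis by (rule eventually_mono) simp
        qed
        ultimately show "\<forall>\<^sub>F k in sequentially. (Z k j = 1 \<longrightarrow> 0 < h (Suc j) (Y (\<Theta> k) (Z k))) \<and>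
            (Z k j = 0 \<longrightarrow> h (Suc j) (Y (\<Theta> k) (Z k)) < 0)" by (rule eventually_conj)
      qed
    qed simp
    show "\<forall>\<^sub>F k in sequentially. ok (\<Theta> k) (Z k)"
      unfolding ok_def by (intro eventually_conj 1 2 3 4)
  qed
  then obtain \<theta> where \<theta>: "0 < \<theta>" "\<theta> \<le> \<theta>0" and ok: "\<And>z. z \<in> unit_cube q \<Longrightarrow> ok \<theta> z" by blast
  have "\<exists>z\<in>unit_cube q. \<forall>j<q. h (Suc j) (Y \<theta> z) = 0"
  proof (rule poincare_miranda)
    fix Z z i assume Z: "\<And>k::nat. Z k \<in> unit_cube q" and z: "z \<in> unit_cube q" and Zz: "\<And>j. (\<lambda>k. Z k j) \<longlonglongrightarrow> z j"
      and i: "i < q"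
    have lim: "(\<lambda>k. Y \<theta> (Z k)) \<longlonglongrightarrow> Y \<theta> z"
      unfolding Y_def
    proof (rule ycont)
      show "(\<lambda>k. \<theta> * b (Z k) w) \<longlonglongrightarrow> \<theta> * b z w" for w unfolding b_def by (intro tendsto_intros Zz)
    qed (use sm[OF Z \<theta>] sm[OF z \<theta>] in auto)
    show "(\<lambda>k. h (Suc i) (Y \<theta> (Z k))) \<longlonglongrightarrow> h (Suc i) (Y \<theta> z)"
      by (rule continuous_on_tendsto_compose[OF hN lim])
        (use i ok[OF z] ok[OF Z] in \<open>auto simp: ok_def\<close>)
  qed (use ok in \<open>auto simp: ok_def\<close>)
  then obtain z where z: "z \<in> unit_cube q" and hz: "\<And>j. j < q \<Longrightarrow> h (Suc j) (Y \<theta> z) = 0" by blast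
  have "g 0 (Y \<theta> z) \<le> g 0 e0"
  proof (rule opt)
    show "Y \<theta> z \<in> X" unfolding Y_def by (rule yX[OF sm[OF z \<theta>]])
    show "0 \<le> g \<alpha> (Y \<theta> z)" if "\<alpha> \<in> {1..m}" for \<alpha>
      using ok[OF z] g0[OF that] that by (cases "\<alpha> \<in> A") (auto simp: ok_def less_imp_le intro: order_trans)
    show "h \<beta> (Y \<theta> z) = 0" if "\<beta> \<in> {1..q}" for \<beta> using hz[of "\<beta> - 1"] that by (cases \<beta>) auto
  qed
  then show False using ok[OF z] A(2) by (auto simp: ok_def)
qed

text \<open>The coordinates of the cone are indexed by the active inequalities (left summand) and the equalities
(right summand). Lowering the inequality coordinates keeps the cone convex and forces the multipliers of the
inequalities to be nonnegative.\<close>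

theorem multiplier_rule:
  fixes g h :: "nat \<Rightarrow> 'a::real_normed_vector \<Rightarrow> real" and Dg Dh :: "nat \<Rightarrow> 'a \<Rightarrow>\<^sub>L real"
  assumes q: "1 \<le> q"
    and Dg: "\<And>\<alpha>. \<alpha> \<in> {0..m} \<Longrightarrow> has_hadamard_differential (g \<alpha>) (Dg \<alpha>) e0"
    and Dh: "\<And>\<beta>. \<beta> \<in> {1..q} \<Longrightarrow> has_hadamard_differential (h \<beta>) (Dh \<beta>) e0"
    and hc: "\<And>\<beta>. \<beta> \<in> {1..q} \<Longrightarrow> \<exists>V. open V \<and> e0 \<in> V \<and> continuous_on V (h \<beta>)"
    and g0: "\<And>\<alpha>. \<alpha> \<in> {1..m} \<Longrightarrow> 0 \<le> g \<alpha> e0" and h0: "\<And>\<beta>. \<beta> \<in> {1..q} \<Longrightarrow> h \<beta> e0 = 0"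
    and opt: "\<And>x. x \<in> X \<Longrightarrow> (\<And>\<alpha>. \<alpha> \<in> {1..m} \<Longrightarrow> 0 \<le> g \<alpha> x) \<Longrightarrow> (\<And>\<beta>. \<beta> \<in> {1..q} \<Longrightarrow> h \<beta> x = 0) \<Longrightarrow> g 0 x \<le> g 0 e0"
    and var: "\<And>P. finite P \<Longrightarrow> P \<subseteq> V0 \<Longrightarrow> \<exists>\<delta> y. variation_family X e0 P \<delta> y"
  shows "\<exists>l \<mu> :: nat \<Rightarrow> real. ((\<exists>\<alpha>\<in>{0..m}. l \<alpha> \<noteq> 0) \<or> (\<exists>\<beta>\<in>{1..q}. \<mu> \<beta> \<noteq> 0)) \<and>
     (\<forall>\<alpha>\<in>{0..m}. 0 \<le> l \<alpha>) \<and> (\<forall>\<alpha>\<in>{1..m}. l \<alpha> * g \<alpha> e0 = 0) \<and>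
     (\<forall>v\<in>V0. (\<Sum>\<alpha>=0..m. l \<alpha> * Dg \<alpha> v) + (\<Sum>\<beta>=1..q. \<mu> \<beta> * Dh \<beta> v) \<le> 0)"
proof (rule ccontr)
  assume none: "\<not> ?thesis"
  define A where "A = insert 0 {\<alpha>\<in>{1..m}. g \<alpha> e0 = 0}"
  have A: "A \<subseteq> {0..m}" "0 \<in> A" "\<And>\<alpha>. \<alpha> \<in> {1..m} - A \<Longrightarrow> 0 < g \<alpha> e0"
  proof -
    fix \<alpha> assume "\<alpha> \<in> {1..m} - A"
    then show "0 < g \<alpha> e0" using g0[of \<alpha>] by (simp add: A_def less_le)
  qed (auto simp: A_def)
  have finA: "finite A" using A(1) finite_subset by blast
  define I where "I = (Inl ` A \<union> Inr ` {1..q} :: (nat + nat) set)"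
  have finI: "finite I" using finA by (simp add: I_def)
  define K where "K = {y :: nat + nat \<Rightarrow> real. \<exists>v P c. nonneg_comb V0 v P c \<and>
      (\<forall>\<alpha>\<in>A. y (Inl \<alpha>) \<le> Dg \<alpha> v) \<and> (\<forall>\<beta>\<in>{1..q}. y (Inr \<beta>) = Dh \<beta> v)}"
  have K_I: "y \<in> K" if "nonneg_comb V0 v P c" "\<And>\<alpha>. \<alpha> \<in> A \<Longrightarrow> y (Inl \<alpha>) \<le> Dg \<alpha> v" "\<And>\<beta>. \<beta> \<in> {1..q} \<Longrightarrow> y (Inr \<beta>) = Dh \<beta> v"
    for y v P c unfolding K_def using that by blast
  have zero: "nonneg_comb V0 0 {} (\<lambda>_. 0)" by (simp add: nonneg_comb_def)
  have sumI: "(\<Sum>i\<in>I. c i * y i) = (\<Sum>\<alpha>\<in>A. c (Inl \<alpha>) * y (Inl \<alpha>)) + (\<Sum>\<beta>\<in>{1..q}. c (Inr \<beta>) * y (Inr \<beta>))" for c y :: "nat + nat \<Rightarrow> real"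
    unfolding I_def by (subst sum.union_disjoint) (use finA in \<open>auto simp: sum.reindex\<close>)
  have dense: "\<exists>y\<in>K. \<forall>i\<in>I. \<bar>y i - y0 i\<bar> < \<epsilon>" if "\<epsilon> > 0" for y0 and \<epsilon> :: real
  proof (rule convex_cone_dense_or_functional[OF finI _ _ _ _ that])
    have "(\<lambda>_. 0) \<in> K" by (rule K_I[OF zero]) auto
    then show "K \<noteq> {}" by blast
    show "(\<lambda>i. y i + z i) \<in> K" if "y \<in> K" "z \<in> K" for y z
    proof -
      obtain v P c where 1: "nonneg_comb V0 v P c" "\<forall>\<alpha>\<in>A. y (Inl \<alpha>) \<le> Dg \<alpha> v" "\<forall>\<beta>\<in>{1..q}. y (Inr \<beta>) = Dh \<beta> v"
        using \<open>y \<in> K\<close> unfolding K_def by blast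
      obtain v' P' c' where 2: "nonneg_comb V0 v' P' c'" "\<forall>\<alpha>\<in>A. z (Inl \<alpha>) \<le> Dg \<alpha> v'" "\<forall>\<beta>\<in>{1..q}. z (Inr \<beta>) = Dh \<beta> v'"
        using \<open>z \<in> K\<close> unfolding K_def by blast
      show ?thesis by (rule K_I[OF nonneg_comb_add[OF 1(1) 2(1)]]) (use 1 2 in \<open>auto simp: blinfun.add_right add_mono\<close>)
    qed
    show "(\<lambda>i. s * y i) \<in> K" if "s > 0" "y \<in> K" for s y
    proof -
      obtain v P c where 1: "nonneg_comb V0 v P c" "\<forall>\<alpha>\<in>A. y (Inl \<alpha>) \<le> Dg \<alpha> v" "\<forall>\<beta>\<in>{1..q}. y (Inr \<beta>) = Dh \<beta> v"
        using \<open>y \<in> K\<close> unfolding K_def by blast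
      show ?thesis by (rule K_I[OF nonneg_comb_scale[OF 1(1), of s]])
          (use 1 that in \<open>auto simp: blinfun.scaleR_right\<close>)
    qed
    fix c assume c: "\<And>y. y \<in> K \<Longrightarrow> (\<Sum>i\<in>I. c i * y i) \<le> 0"
    show "\<forall>i\<in>I. c i = 0"
    proof (rule ccontr)
      assume nz: "\<not> (\<forall>i\<in>I. c i = 0)"
      define l where "l \<alpha> = (if \<alpha> \<in> A then c (Inl \<alpha>) else 0)" for \<alpha>
      define \<mu> where "\<mu> \<beta> = c (Inr \<beta>)" for \<beta>
      have "(\<exists>\<alpha>\<in>{0..m}. l \<alpha> \<noteq> 0) \<or> (\<exists>\<beta>\<in>{1..q}. \<mu> \<beta> \<noteq> 0)"
        using nz A(1) unfolding I_def l_def \<mu>_def by fastforce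
      moreover have "0 \<le> l \<alpha>" for \<alpha>
      proof (cases "\<alpha> \<in> A")
        case True
        have "(\<lambda>i. if i = Inl \<alpha> then - 1 else 0) \<in> K" by (rule K_I[OF zero]) auto
        from c[OF this] have "(\<Sum>i\<in>I. c i * (if i = Inl \<alpha> then - 1 else 0)) \<le> 0" .
        moreover have "Inl \<alpha> \<in> I" using True by (auto simp: I_def)
        ultimately have "0 \<le> c (Inl \<alpha>)" using finI by (simp add: if_distrib[of "\<lambda>x. _ * x"] sum.delta cong: if_cong)
        then show ?thesis using True by (simp add: l_def)
      qed (simp add: l_def)
      moreover have "l \<alpha> * g \<alpha> e0 = 0" if "\<alpha> \<in> {1..m}" for \<alpha> using that by (auto simp: l_def A_def)
      moreover have "(\<Sum>\<alpha>=0..m. l \<alpha> * Dg \<alpha> v) + (\<Sum>\<beta>=1..q. \<mu> \<beta> * Dh \<beta> v) \<le> 0" if "v \<in> V0" for v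
      proof -
        define y where "y i = (case i of Inl \<alpha> \<Rightarrow> Dg \<alpha> v | Inr \<beta> \<Rightarrow> Dh \<beta> v)" for i
        have "nonneg_comb V0 v {v} (\<lambda>w. of_bool (w = v))" using that by (simp add: nonneg_comb_def)
        then have "y \<in> K" by (rule K_I) (auto simp: y_def)
        from c[OF this] have "(\<Sum>\<alpha>\<in>A. c (Inl \<alpha>) * Dg \<alpha> v) + (\<Sum>\<beta>\<in>{1..q}. \<mu> \<beta> * Dh \<beta> v) \<le> 0"
          unfolding sumI by (simp add: y_def \<mu>_def)
        moreover have "(\<Sum>\<alpha>=0..m. l \<alpha> * Dg \<alpha> v) = (\<Sum>\<alpha>\<in>A. c (Inl \<alpha>) * Dg \<alpha> v)"
          by (rule sum.mono_neutral_cong_right) (use A(1) in \<open>auto simp: l_def\<close>)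
        ultimately show ?thesis by simp
      qed
      ultimately show False using none by blast
    qed
  qed
  have get: "\<exists>v P c. nonneg_comb V0 v P c \<and> (\<forall>\<alpha>\<in>A. 0 < Dg \<alpha> v) \<and> (\<forall>j<q. \<bar>Dh (Suc j) v - t j\<bar> \<le> 1 / (4 * real q))" for t :: "nat \<Rightarrow> real"
  proof -
    \<comment> \<open>The tolerance \<open>1 / (4 q)\<close> keeps the \<open>g\<close>-coordinates, with target \<open>1\<close>, positive.\<close>
    define y0 where "y0 i = (case i of Inl \<alpha> \<Rightarrow> 1 | Inr \<beta> \<Rightarrow> t (\<beta> - 1))" for i :: "nat + nat"
    have q': "0 < 1 / (4 * real q)" "1 / (4 * real q) \<le> 1" using q by (auto simp: field_simps)
    obtain y where y: "y \<in> K" "\<And>i. i \<in> I \<Longrightarrow> \<bar>y i - y0 i\<bar> < 1 / (4 * real q)"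
      using dense[OF q'(1), of y0] by blast
    obtain v P c where v: "nonneg_comb V0 v P c" "\<forall>\<alpha>\<in>A. y (Inl \<alpha>) \<le> Dg \<alpha> v" "\<forall>\<beta>\<in>{1..q}. y (Inr \<beta>) = Dh \<beta> v"
      using y(1) unfolding K_def by blast
    have "0 < Dg \<alpha> v" if "\<alpha> \<in> A" for \<alpha>
    proof -
      have "\<bar>y (Inl \<alpha>) - 1\<bar> < 1 / (4 * real q)" using y(2)[of "Inl \<alpha>"] that by (simp add: I_def y0_def)
      then have "0 < y (Inl \<alpha>)" using q'(2) by linarith
      then show ?thesis using v(2) that by fastforce
    qed
    moreover have "\<bar>Dh (Suc j) v - t j\<bar> \<le> 1 / (4 * real q)" if "j < q" for j
      using y(2)[of "Inr (Suc j)"] v(3) that by (simp add: I_def y0_def)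
    ultimately show ?thesis using v(1) by blast
  qed
  have "\<forall>i. \<exists>v P c. nonneg_comb V0 v P c \<and> (\<forall>\<alpha>\<in>A. 0 < Dg \<alpha> v) \<and> (\<forall>j<q. \<bar>Dh (Suc j) v - of_bool (i = j)\<bar> \<le> 1 / (4 * real q))"
    by (intro allI get)
  then obtain vp Pp cp where p: "\<And>i. nonneg_comb V0 (vp i) (Pp i) (cp i) \<and> (\<forall>\<alpha>\<in>A. 0 < Dg \<alpha> (vp i)) \<and>
      (\<forall>j<q. \<bar>Dh (Suc j) (vp i) - of_bool (i = j)\<bar> \<le> 1 / (4 * real q))" by metis
  have "\<forall>i. \<exists>v P c. nonneg_comb V0 v P c \<and> (\<forall>\<alpha>\<in>A. 0 < Dg \<alpha> v) \<and> (\<forall>j<q. \<bar>Dh (Suc j) v - (- of_bool (i = j))\<bar> \<le> 1 / (4 * real q))"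
    by (intro allI get)
  then obtain vm Pm cm where m: "\<And>i. nonneg_comb V0 (vm i) (Pm i) (cm i) \<and> (\<forall>\<alpha>\<in>A. 0 < Dg \<alpha> (vm i)) \<and>
      (\<forall>j<q. \<bar>Dh (Suc j) (vm i) - (- of_bool (i = j))\<bar> \<le> 1 / (4 * real q))" by metis
  show False
    by (rule spanning_directions_contradict_optimality[where m=m and q=q and g=g and h=h and Dg=Dg and Dh=Dh
          and ?e0.0=e0 and X=X and ?V0.0=V0 and A=A and vp=vp and Pp=Pp and cp=cp and vm=vm and Pm=Pm and cm=cm,
          OF q Dg Dh hc g0 h0 opt var A])
      (use p m in \<open>simp_all add: diff_minus_eq_add\<close>)
qed

section \<open>Needle controls\<close>

text \<open>The interval is closed on the left and open on the right, which preserves right-continuity, and it ends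
before \<open>T\<close>, which preserves left-continuity at \<open>T\<close>.\<close>

lemma npc_modify:
  assumes u: "npc T U S u" and "\<zeta> \<in> U" and "d < T"
  shows "npc T U (insert c (insert d S)) (\<lambda>s. if s \<in> {c..<d} then \<zeta> else u s)" (is "npc T U _ ?v")
proof (cases "c < d")
  case False
  then have "?v = u" by auto
  then show ?thesis using u by (auto simp: npc_def)
next
  case True
  have same: "(?v \<longlongrightarrow> l) F" if "(u \<longlongrightarrow> l) F" "eventually (\<lambda>s. s \<notin> {c..<d}) F" for l F
    using that(1) by (rule Lim_transform_eventually) (use that(2) in \<open>auto elim: eventually_mono\<close>)
  have const: "(?v \<longlongrightarrow> \<zeta>) F" if "eventually (\<lambda>s. s \<in> {c..<d}) F" for F
    using tendsto_const by (rule Lim_transform_eventually) (use that in \<open>auto elim: eventually_mono\<close>)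
  show ?thesis
    unfolding npc_def
  proof (intro conjI ballI)
    show "finite (insert c (insert d S))" using u by (simp add: npc_def)
    show "?v ` {0..T} \<subseteq> U" using u \<open>\<zeta> \<in> U\<close> by (auto simp: npc_def)
  next
    fix t assume t: "t \<in> {0..T} - insert c (insert d S)"
    have ut: "(u \<longlongrightarrow> u t) (at t within {0..T})" using u t by (auto simp: npc_def continuous_within)
    consider "t \<in> {c<..<d}" | "t < c" | "d < t" using t by force
    then have "(?v \<longlongrightarrow> ?v t) (at t within {0..T})"
    proof cases
      case 1
      have "eventually (\<lambda>s. s \<in> {c<..<d}) (at t within {0..T})"
        using 1 by (intro eventually_at_topological[THEN iffD2] exI[of _ "{c<..<d}"]) auto
      then have "eventually (\<lambda>s. s \<in> {c..<d}) (at t within {0..T})" by (rule eventually_mono) auto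
      from const[OF this] show ?thesis using 1 by simp
    next
      case 2
      have "eventually (\<lambda>s. s \<notin> {c..<d}) (at t within {0..T})"
        using 2 by (intro eventually_at_topological[THEN iffD2] exI[of _ "{..<c}"]) auto
      from same[OF ut this] show ?thesis using 2 by simp
    next
      case 3
      have "eventually (\<lambda>s. s \<notin> {c..<d}) (at t within {0..T})"
        using 3 by (intro eventually_at_topological[THEN iffD2] exI[of _ "{d<..}"]) auto
      from same[OF ut this] show ?thesis using 3 by simp
    qed
    then show "continuous (at t within {0..T}) ?v" by (simp add: continuous_within)
  next
    fix t assume t: "t \<in> {0..<T}"
    have ut: "(u \<longlongrightarrow> u t) (at_right t)" using u t by (auto simp: npc_def)
    consider "t \<in> {c..<d}" | "t < c" | "d \<le> t" by force
    then show "(?v \<longlongrightarrow> ?v t) (at_right t)"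
    proof cases
      case 1
      have "eventually (\<lambda>s. s \<in> {c..<d}) (at_right t)"
        using 1 by (auto simp: eventually_at_right_field intro!: exI[of _ d])
      from const[OF this] show ?thesis using 1 by simp
    next
      case 2
      have "eventually (\<lambda>s. s \<notin> {c..<d}) (at_right t)"
        using 2 by (auto simp: eventually_at_right_field intro!: exI[of _ c])
      from same[OF ut this] show ?thesis using 2 by simp
    next
      case 3
      have "eventually (\<lambda>s. s \<notin> {c..<d}) (at_right t)"
        using 3 by (auto simp: eventually_at_right_field intro!: exI[of _ "t + 1"])
      from same[OF ut this] show ?thesis using 3 by simp
    qed
  next
    fix t assume t: "t \<in> {0<..T}"
    then obtain l where l: "l \<in> U" "(u \<longlongrightarrow> l) (at_left t)" using u unfolding npc_def by blast
    consider "t \<in> {c<..d}" | "t \<le> c" | "d < t" by force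
    then show "\<exists>l\<in>U. (?v \<longlongrightarrow> l) (at_left t)"
    proof cases
      case 1
      have "eventually (\<lambda>s. s \<in> {c..<d}) (at_left t)"
        using 1 by (auto simp: eventually_at_left_field intro!: exI[of _ c])
      from const[OF this] show ?thesis using \<open>\<zeta> \<in> U\<close> by blast
    next
      case 2
      have "eventually (\<lambda>s. s \<notin> {c..<d}) (at_left t)"
        using 2 by (auto simp: eventually_at_left_field intro!: exI[of _ "t - 1"])
      from same[OF l(2) this] show ?thesis using l(1) by blast
    next
      case 3
      have "eventually (\<lambda>s. s \<notin> {c..<d}) (at_left t)"
        using 3 by (auto simp: eventually_at_left_field intro!: exI[of _ d])
      from same[OF l(2) this] show ?thesis using l(1) by blast
    qed
  next
    have uT: "(u \<longlongrightarrow> u T) (at_left T)" using u by (simp add: npc_def)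
    have "eventually (\<lambda>s. s \<notin> {c..<d}) (at_left T)"
      using \<open>d < T\<close> by (auto simp: eventually_at_left_field intro!: exI[of _ d])
    from same[OF uT this] show "(?v \<longlongrightarrow> ?v T) (at_left T)" using \<open>d < T\<close> by simp
  qed
qed

text \<open>The integral of a bounded function is at most the bound times the total length of intervals that contain its support. This
turns a change of the needle intervals into an estimate linear in the weights.\<close>

lemma integral_on_few_intervals:
  fixes \<phi> :: "real \<Rightarrow> 'b::banach"
  assumes fin: "finite I" and t: "0 \<le> t" and \<phi>: "\<phi> integrable_on {0..t}" and c: "0 \<le> c" and len: "\<And>i. i \<in> I \<Longrightarrow> hi i - lo i \<le> d"
    and d: "0 \<le> d"
    and bound: "\<And>s. s \<in> {0..t} \<Longrightarrow> norm (\<phi> s) \<le> c"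
    and zero: "\<And>s. s \<in> {0..t} \<Longrightarrow> \<phi> s \<noteq> 0 \<Longrightarrow> \<exists>i\<in>I. s \<in> {lo i..hi i}"
  shows "norm (integral {0..t} \<phi>) \<le> c * (real (card I) * d)"
proof -
  define J where "J i = {max 0 (lo i)..min t (hi i)}" for i
  have ind: "((\<lambda>s. if s \<in> J i then (1::real) else 0) has_integral measure lborel (J i)) {0..t}" for i
  proof (rule has_integral_restrict[THEN iffD2])
    show "J i \<subseteq> {0..t}" by (auto simp: J_def)
    show "((\<lambda>s. 1::real) has_integral measure lborel (J i)) (J i)"
      using has_integral_const_real[of "1::real" "max 0 (lo i)" "min t (hi i)"] by (simp add: J_def)
  qed
  have le: "measure lborel (J i) \<le> d" if "i \<in> I" for i
    using len[OF that] d by (auto simp: J_def content_real_if)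
  have S: "((\<lambda>s. c * (\<Sum>i\<in>I. if s \<in> J i then 1 else 0)) has_integral c * (\<Sum>i\<in>I. measure lborel (J i))) {0..t}"
    by (intro has_integral_mult_right has_integral_sum fin ind)
  have "norm (integral {0..t} \<phi>) \<le> integral {0..t} (\<lambda>s. c * (\<Sum>i\<in>I. if s \<in> J i then 1 else 0))"
  proof (rule integral_norm_bound_integral[OF \<phi> has_integral_integrable[OF S]])
    fix s assume s: "s \<in> {0..t}"
    show "norm (\<phi> s) \<le> c * (\<Sum>i\<in>I. if s \<in> J i then 1 else 0)"
    proof (cases "\<phi> s = 0")
      case True
      then show ?thesis using c by (auto intro!: mult_nonneg_nonneg sum_nonneg)
    next
      case False
      then obtain i where i: "i \<in> I" "s \<in> {lo i..hi i}" using zero[OF s] by blast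
      then have "s \<in> J i" using s by (auto simp: J_def)
      then have "1 \<le> (\<Sum>i\<in>I. if s \<in> J i then 1 else (0::real))"
        using member_le_sum[OF i(1) _ fin, of "\<lambda>i. if s \<in> J i then 1 else (0::real)"] by auto
      then have "c * 1 \<le> c * (\<Sum>i\<in>I. if s \<in> J i then 1 else 0)" using c by (rule mult_left_mono)
      then show ?thesis using bound[OF s] by simp
    qed
  qed
  also have "\<dots> = c * (\<Sum>i\<in>I. measure lborel (J i))" using integral_unique[OF S] .
  also have "\<dots> \<le> c * (\<Sum>i\<in>I. d)" using c le by (intro mult_left_mono sum_mono) auto
  also have "\<dots> = c * (real (card I) * d)" by simp
  finally show ?thesis .
qed

text \<open>The \<open>i\<close>-th needle occupies the times from \<open>breakpt \<tau> i i a\<close> up to \<open>breakpt \<tau> i (Suc i) a\<close>: it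
starts at its nominal time, delayed by the total length of the preceding needles.\<close>

definition breakpt :: "(nat \<Rightarrow> real) \<Rightarrow> nat \<Rightarrow> nat \<Rightarrow> (nat \<Rightarrow> real) \<Rightarrow> real" where
  "breakpt \<tau> i k a = \<tau> i + (\<Sum>j<k. a j)"

primrec needle_ctrl :: "(real \<Rightarrow> 'u) \<Rightarrow> (nat \<Rightarrow> real) \<Rightarrow> (nat \<Rightarrow> 'u) \<Rightarrow> nat \<Rightarrow> (nat \<Rightarrow> real) \<Rightarrow> real \<Rightarrow> 'u" where
  "needle_ctrl u \<tau> \<zeta> 0 a = u"
| "needle_ctrl u \<tau> \<zeta> (Suc n) a = (\<lambda>s. if s \<in> {breakpt \<tau> n n a..<breakpt \<tau> n (Suc n) a} then \<zeta> n else needle_ctrl u \<tau> \<zeta> n a s)"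

lemma needle_ctrl_npc:
  assumes "npc T U S u" "\<And>i. i < n \<Longrightarrow> \<zeta> i \<in> U" "\<And>i. i < n \<Longrightarrow> breakpt \<tau> i (Suc i) a < T"
  shows "\<exists>S'. npc T U S' (needle_ctrl u \<tau> \<zeta> n a)"
  using assms(2,3)
proof (induction n)
  case 0
  then show ?case using assms(1) by auto
next
  case (Suc n)
  then obtain S' where "npc T U S' (needle_ctrl u \<tau> \<zeta> n a)" by auto
  from npc_modify[OF this, of "\<zeta> n" "breakpt \<tau> n (Suc n) a" "breakpt \<tau> n n a"] Suc.prems show ?case
    by (intro exI) simp
qed

lemma needle_ctrl_values: "needle_ctrl u \<tau> \<zeta> n a s \<in> insert (u s) (\<zeta> ` {..<n})"
  by (induction n) auto

lemma needle_ctrl_outside: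
  "(\<And>i. i < n \<Longrightarrow> s \<notin> {breakpt \<tau> i i a..<breakpt \<tau> i (Suc i) a}) \<Longrightarrow> needle_ctrl u \<tau> \<zeta> n a s = u s"
  by (induction n) auto

lemma needle_ctrl_agree:
  "(\<And>i. i < n \<Longrightarrow> s \<in> {breakpt \<tau> i i a..<breakpt \<tau> i (Suc i) a} \<longleftrightarrow> s \<in> {breakpt \<tau> i i b..<breakpt \<tau> i (Suc i) b}) \<Longrightarrow>
    needle_ctrl u \<tau> \<zeta> n a s = needle_ctrl u \<tau> \<zeta> n b s"
  by (induction n) auto

text \<open>The delay by the preceding weights keeps the needles disjoint even if their nominal times coincide.\<close>

lemma breakpt_disjoint:
  assumes "i < j" "\<tau> i \<le> \<tau> j" "\<And>k. k < j \<Longrightarrow> 0 \<le> a k"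
  shows "breakpt \<tau> i (Suc i) a \<le> breakpt \<tau> j j a"
proof -
  have "(\<Sum>k<Suc i. a k) \<le> (\<Sum>k<j. a k)" using assms by (intro sum_mono2) auto
  then show ?thesis using assms(2) by (simp only: breakpt_def add_mono)
qed

lemma needle_ctrl_inside:
  assumes "\<And>i j. i < j \<Longrightarrow> j < n \<Longrightarrow> \<tau> i \<le> \<tau> j" "\<And>k. k < n \<Longrightarrow> 0 \<le> a k"
    and "i < n" "s \<in> {breakpt \<tau> i i a..<breakpt \<tau> i (Suc i) a}"
  shows "needle_ctrl u \<tau> \<zeta> n a s = \<zeta> i"
  using assms
proof (induction n)
  case (Suc n)
  show ?case
  proof (cases "i = n")
    case True
    then show ?thesis using Suc.prems(4) by simp
  next
    case False
    then have i: "i < n" using Suc.prems(3) by simp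
    have "breakpt \<tau> i (Suc i) a \<le> breakpt \<tau> n n a" by (rule breakpt_disjoint[OF i]) (use Suc.prems i in auto)
    then have "s \<notin> {breakpt \<tau> n n a..<breakpt \<tau> n (Suc n) a}" using Suc.prems(4) by auto
    moreover have "needle_ctrl u \<tau> \<zeta> n a s = \<zeta> i" by (rule Suc.IH) (use Suc.prems i in auto)
    ultimately show ?thesis by (simp only: needle_ctrl.simps if_False)
  qed
qed simp

text \<open>Two perturbed controls differ only between corresponding end points of needles. The end
points of the \<open>i\<close>-th needle are the break points with \<open>k = i\<close> and \<open>k = Suc i\<close>; letting \<open>k\<close> range up to
\<open>n\<close> keeps the index set a product.\<close>

lemma needle_ctrl_differ:
  assumes "needle_ctrl u \<tau> \<zeta> n a s \<noteq> needle_ctrl u \<tau> \<zeta> n b s"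
  shows "\<exists>(i, k)\<in>{..<n} \<times> {..n}. s \<in> {min (breakpt \<tau> i k a) (breakpt \<tau> i k b)..max (breakpt \<tau> i k a) (breakpt \<tau> i k b)}"
proof -
  have "\<exists>i<n. (s \<in> {breakpt \<tau> i i a..<breakpt \<tau> i (Suc i) a}) \<noteq> (s \<in> {breakpt \<tau> i i b..<breakpt \<tau> i (Suc i) b})"
    using needle_ctrl_agree[of n s \<tau> a b u \<zeta>] assms by blast
  then obtain i where i: "i < n" "(s \<in> {breakpt \<tau> i i a..<breakpt \<tau> i (Suc i) a}) \<noteq> (s \<in> {breakpt \<tau> i i b..<breakpt \<tau> i (Suc i) b})" by blast
  define c d c' d' where cd: "c = breakpt \<tau> i i a" "d = breakpt \<tau> i (Suc i) a" "c' = breakpt \<tau> i i b" "d' = breakpt \<tau> i (Suc i) b"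
  have "(c \<le> s \<and> s < d) \<noteq> (c' \<le> s \<and> s < d')" using i(2) by (simp add: cd)
  then have "(min c c' \<le> s \<and> s \<le> max c c') \<or> (min d d' \<le> s \<and> s \<le> max d d')"
    by (auto simp: min_le_iff_disj le_max_iff_disj not_le not_less)
  then consider "s \<in> {min c c'..max c c'}" | "s \<in> {min d d'..max d d'}" by auto
  then show ?thesis
  proof cases
    case 1 then show ?thesis using i(1) by (intro bexI[of _ "(i, i)"]) (auto simp: cd)
  next
    case 2 then show ?thesis using i(1) by (intro bexI[of _ "(i, Suc i)"]) (auto simp: cd)
  qed
qed

lemma breakpt_diff:
  assumes "k \<le> n"
  shows "\<bar>breakpt \<tau> i k a - breakpt \<tau> i k b\<bar> \<le> (\<Sum>j<n. \<bar>a j - b j\<bar>)"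
proof -
  have "breakpt \<tau> i k a - breakpt \<tau> i k b = (\<Sum>j<k. a j - b j)" by (simp add: breakpt_def sum_subtractf)
  then have "\<bar>breakpt \<tau> i k a - breakpt \<tau> i k b\<bar> \<le> (\<Sum>j<k. \<bar>a j - b j\<bar>)" by (simp add: sum_abs)
  also have "\<dots> \<le> (\<Sum>j<n. \<bar>a j - b j\<bar>)" using assms by (intro sum_mono2) auto
  finally show ?thesis .
qed

section \<open>Perturbed trajectories\<close>

text \<open>A control and its trajectory, the differentials \<open>A\<close> of the dynamics along it, and the resolvent \<open>R\<close> of the
linearized equation.\<close>

locale reference_process =
  fixes T :: real and \<Omega> :: "'a::banach set" and U :: "'u::t2_space set"
    and f :: "real \<Rightarrow> 'a \<Rightarrow> 'u \<Rightarrow> 'a" and x0 :: "real \<Rightarrow> 'a" and u0 :: "real \<Rightarrow> 'u"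
    and S0 Su SR :: "real set" and A R :: "real \<Rightarrow> 'a \<Rightarrow>\<^sub>L 'a"
  assumes T: "0 < T" and opn: "open \<Omega>"
    and x0c: "continuous_on {0..T} x0" and x0O: "\<And>s. s \<in> {0..T} \<Longrightarrow> x0 s \<in> \<Omega>"
    and u0: "npc T U Su u0"
    and S0: "finite S0" and x0d: "\<And>s. s \<in> {0<..<T} - S0 \<Longrightarrow> (x0 has_vector_derivative f s (x0 s) (u0 s)) (at s)"
    and f_cont: "continuous_on ({0..T} \<times> \<Omega> \<times> U) (\<lambda>(t, \<xi>, \<zeta>). f t \<xi> \<zeta>)"
    and A: "npc T UNIV Su A"
    and Ad: "\<And>s. s \<in> {0..T} \<Longrightarrow> ((\<lambda>y. f s y (u0 s)) has_derivative blinfun_apply (A s)) (at (x0 s))"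
    and Rc: "continuous_on {0..T} R" and RT: "R T = id_blinfun"
    and SR: "finite SR" and Rd: "\<And>s. s \<in> {0<..<T} - SR \<Longrightarrow> (R has_vector_derivative - (R s o\<^sub>L A s)) (at s)"
begin

lemma f_cont_along:
  assumes "continuous_on {0..T} x" "\<And>s. s \<in> {0..T} \<Longrightarrow> x s \<in> \<Omega>"
  shows "continuous_on ({0..T} \<times> U) (\<lambda>(s, \<zeta>). f s (x s) \<zeta>)"
proof -
  have "continuous_on ({0..T} \<times> U) (\<lambda>p. (\<lambda>(t, \<xi>, \<zeta>). f t \<xi> \<zeta>) (fst p, x (fst p), snd p))"
  proof (rule continuous_on_compose2[OF f_cont])
    show "continuous_on ({0..T} \<times> U) (\<lambda>p. (fst p, x (fst p), snd p))"
      by (intro continuous_intros continuous_on_compose2[OF assms(1)]) auto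
  qed (use assms(2) in auto)
  then show ?thesis by (simp add: case_prod_beta)
qed

lemma f_npc:
  assumes "continuous_on {0..T} x" "\<And>s. s \<in> {0..T} \<Longrightarrow> x s \<in> \<Omega>" "npc T U S u"
  shows "npc T UNIV S (\<lambda>s. f s (x s) (u s))"
  by (rule npc_comp[OF assms(3) f_cont_along[OF assms(1,2)] _ T]) auto

lemma x0_eq: "s \<in> {0..T} \<Longrightarrow> x0 s = x0 0 + integral {0..s} (\<lambda>r. f r (x0 r) (u0 r))"
proof -
  assume s: "s \<in> {0..T}"
  have "((\<lambda>r. f r (x0 r) (u0 r)) has_integral (x0 s - x0 0)) {0..s}"
    by (rule fundamental_theorem_of_calculus_interior_strong[OF S0])
      (use s x0d continuous_on_subset[OF x0c] in auto)
  from integral_unique[OF this] show ?thesis by simp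
qed

text \<open>The effect on the end point, per unit length, of a needle with value \<open>\<zeta>\<close> at time \<open>s\<close>.\<close>

definition needle_direction :: "real \<Rightarrow> 'u \<Rightarrow> 'a" where
  "needle_direction s \<zeta> = R s (f s (x0 s) \<zeta> - f s (x0 s) (u0 s))"

end

text \<open>Finitely many needles in order of time, a tube of radius \<open>r\<close> in which the dynamics are bounded by \<open>B\<close> and
Lipschitz with constant \<open>L\<close> for all control values that occur, and a bound \<open>\<delta>\<close> on the
total weight that keeps the perturbed trajectories in the tube and the needles before \<open>T\<close>.\<close>

locale needle_data = reference_process T \<Omega> U f x0 u0 S0 Su SR A R
  for T :: real and \<Omega> :: "'a::banach set" and U :: "'u::t2_space set" and f x0 u0 S0 Su SR A R +
  fixes N :: nat and \<tau> :: "nat \<Rightarrow> real" and \<zeta> :: "nat \<Rightarrow> 'u" and r L B \<delta> :: real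
  assumes \<tau>: "\<And>i. i < N \<Longrightarrow> \<tau> i \<in> {0..<T}" and \<zeta>: "\<And>i. i < N \<Longrightarrow> \<zeta> i \<in> U"
    and sorted: "\<And>i j. i < j \<Longrightarrow> j < N \<Longrightarrow> \<tau> i \<le> \<tau> j"
    and r: "0 < r" and L: "0 \<le> L" and B: "0 \<le> B" and \<delta>: "0 < \<delta>"
    and tube: "\<And>s. s \<in> {0..T} \<Longrightarrow> cball (x0 s) r \<subseteq> \<Omega>"
    and lip: "\<And>s z y y'. s \<in> {0..T} \<Longrightarrow> z \<in> insert (u0 s) (\<zeta> ` {..<N}) \<Longrightarrow> norm (y - x0 s) \<le> r \<Longrightarrow> norm (y' - x0 s) \<le> r \<Longrightarrow>
         norm (f s y z - f s y' z) \<le> L * norm (y - y')"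
    and bnd: "\<And>s z y. s \<in> {0..T} \<Longrightarrow> z \<in> insert (u0 s) (\<zeta> ` {..<N}) \<Longrightarrow> norm (y - x0 s) \<le> r \<Longrightarrow> norm (f s y z) \<le> B"
    and \<delta>r: "2 * (2 * B * real (N * Suc N)) * exp (2 * L * T) * \<delta> \<le> r"
    and \<delta>T: "\<And>i. i < N \<Longrightarrow> \<tau> i + \<delta> < T"
begin

text \<open>\<open>K\<close> bounds how fast the integrated right-hand side changes with the weights: \<open>2 B\<close> bounds the jump, and
\<open>N (N + 1)\<close> is the number of pairs of break points. The Gronwall factor turns it into the Lipschitz constant \<open>C\<close> of the
trajectory in the weights.\<close>

definition "K = 2 * B * real (N * Suc N)"
definition "C = 2 * K * exp (2 * L * T)"
abbreviation "u a \<equiv> needle_ctrl u0 \<tau> \<zeta> N a"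
abbreviation "sm a \<equiv> weights {..<N} \<delta> a"

lemma u_values: "u a s \<in> insert (u0 s) (\<zeta> ` {..<N})" by (rule needle_ctrl_values)

lemma K0: "0 \<le> K" and C0: "0 \<le> C" using B by (auto simp: K_def C_def)

lemma tubeO: "s \<in> {0..T} \<Longrightarrow> norm (y - x0 s) \<le> r \<Longrightarrow> y \<in> \<Omega>"
  using tube[of s] by (auto simp: dist_norm norm_minus_commute)

lemma u_npc: assumes "sm a" shows "\<exists>S. npc T U S (u a)"
proof (rule needle_ctrl_npc[OF u0 \<zeta>])
  fix i assume i: "i < N"
  have "(\<Sum>j<Suc i. a j) \<le> (\<Sum>j<N. a j)" using assms i by (intro sum_mono2) (auto simp: weights_def)
  then show "breakpt \<tau> i (Suc i) a < T" using \<delta>T[OF i] assms unfolding breakpt_def weights_def by linarith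
qed auto

lemma u_zero: "u (\<lambda>_. 0) = u0"
  by (rule ext, rule needle_ctrl_outside) (simp add: breakpt_def)

lemma fu_npc:
  assumes "sm a" "continuous_on {0..T} x" "\<And>s. s \<in> {0..T} \<Longrightarrow> norm (x s - x0 s) \<le> r"
  shows "\<exists>S. npc T UNIV S (\<lambda>s. f s (x s) (u a s))"
  using u_npc[OF assms(1)] f_npc[OF assms(2) tubeO[OF _ assms(3)]] by blast

lemma fu_int:
  assumes "sm a" "continuous_on {0..T} x" "\<And>s. s \<in> {0..T} \<Longrightarrow> norm (x s - x0 s) \<le> r" "s \<in> {0..T}"
  shows "(\<lambda>s. f s (x s) (u a s)) integrable_on {0..s}"
proof -
  obtain S where "npc T UNIV S (\<lambda>s. f s (x s) (u a s))" using fu_npc[OF assms(1-3)] by blast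
  from npc_integrable[OF this T] show ?thesis
    by (rule integrable_on_subinterval) (use assms(4) in auto)
qed

text \<open>Along a fixed trajectory, changing the weights changes the right-hand side only on the intervals
between corresponding break points, by at most \<open>2 B\<close>.\<close>

lemma control_change:
  assumes a: "sm a" and b: "sm b" and x: "continuous_on {0..T} x" "\<And>s. s \<in> {0..T} \<Longrightarrow> norm (x s - x0 s) \<le> r" and s: "s \<in> {0..T}"
  shows "norm (integral {0..s} (\<lambda>s. f s (x s) (u a s) - f s (x s) (u b s))) \<le> K * (\<Sum>j<N. \<bar>a j - b j\<bar>)"
proof -
  let ?lo = "\<lambda>(i, k). min (breakpt \<tau> i k a) (breakpt \<tau> i k b)" and ?hi = "\<lambda>(i, k). max (breakpt \<tau> i k a) (breakpt \<tau> i k b)"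
  have "norm (integral {0..s} (\<lambda>s. f s (x s) (u a s) - f s (x s) (u b s))) \<le> 2 * B * (real (card ({..<N} \<times> {..N})) * (\<Sum>j<N. \<bar>a j - b j\<bar>))"
  proof (rule integral_on_few_intervals[where lo="?lo" and hi="?hi"])
    show "(\<lambda>s. f s (x s) (u a s) - f s (x s) (u b s)) integrable_on {0..s}"
      by (intro integrable_diff fu_int a b x s)
    fix p assume "p \<in> {..<N} \<times> {..N}"
    then show "?hi p - ?lo p \<le> (\<Sum>j<N. \<bar>a j - b j\<bar>)"
      using breakpt_diff[of "snd p" N \<tau> "fst p" a b] by (auto simp: case_prod_beta)
  next
    fix s' assume s': "s' \<in> {0..s}"
    then have s'T: "s' \<in> {0..T}" using s by auto
    have "norm (f s' (x s') (u a s')) \<le> B" "norm (f s' (x s') (u b s')) \<le> B"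
      using bnd[OF s'T u_values[of a s'] x(2)[OF s'T]] bnd[OF s'T u_values[of b s'] x(2)[OF s'T]] by auto
    then show "norm (f s' (x s') (u a s') - f s' (x s') (u b s')) \<le> 2 * B"
      using norm_triangle_ineq4[of "f s' (x s') (u a s')" "f s' (x s') (u b s')"] by linarith
    assume "f s' (x s') (u a s') - f s' (x s') (u b s') \<noteq> 0"
    then have "u a s' \<noteq> u b s'" by auto
    from needle_ctrl_differ[OF this] show "\<exists>p\<in>{..<N} \<times> {..N}. s' \<in> {?lo p..?hi p}"
      by (simp add: case_prod_beta)
  qed (use s B in \<open>auto intro: sum_nonneg\<close>)
  then show ?thesis by (simp add: K_def mult.assoc)
qed

lemma weights_zero: "sm (\<lambda>_. 0)" using \<delta> by (simp add: weights_def)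

lemma sum_weights: "sm a \<Longrightarrow> (\<Sum>j<N. \<bar>a j\<bar>) = sum a {..<N}"
  by (rule sum.cong) (auto simp: weights_def)

lemma C_weights: "sm a \<Longrightarrow> C * sum a {..<N} \<le> r"
proof -
  assume a: "sm a"
  then have "C * sum a {..<N} \<le> C * \<delta>" using C0 by (intro mult_left_mono) (auto simp: weights_def)
  then show ?thesis using \<delta>r by (simp add: C_def K_def)
qed

text \<open>The reference trajectory solves the perturbed equation up to a defect that is linear in the weights.\<close>

lemma trajectory_exists:
  assumes a: "sm a"
  shows "\<exists>x. continuous_on {0..T} x \<and> (\<forall>s\<in>{0..T}. norm (x s - x0 s) \<le> C * sum a {..<N}) \<and>
    (\<forall>s\<in>{0..T}. x s = x0 0 + integral {0..s} (\<lambda>s. f s (x s) (u a s)))"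
proof -
  have "\<exists>x. continuous_on {0..T} x \<and> (\<forall>s\<in>{0..T}. norm (x s - x0 s) \<le> 2 * (K * sum a {..<N}) * exp (2 * L * T)) \<and>
    (\<forall>s\<in>{0..T}. x s = x0 0 + integral {0..s} (\<lambda>s. f s (x s) (u a s)))"
  proof (rule integral_equation_tube[OF T L x0c, where \<rho>=r])
    show "(\<lambda>s. f s (x s) (u a s)) integrable_on {0..T}" if "continuous_on {0..T} x" "\<And>t. t \<in> {0..T} \<Longrightarrow> norm (x t - x0 t) \<le> r" for x
      using fu_int[OF a that, of T] T by simp
    show "norm (f t y (u a t) - f t z (u a t)) \<le> L * norm (y - z)"
      if "t \<in> {0..T}" "norm (y - x0 t) \<le> r" "norm (z - x0 t) \<le> r" for t y z
      by (rule lip[OF that(1) u_values that(2,3)])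
    fix s assume s: "s \<in> {0..T}"
    have x0r: "norm (x0 s - x0 s) \<le> r" for s using r by simp
    have "x0 0 + integral {0..s} (\<lambda>s. f s (x0 s) (u a s)) - x0 s =
        integral {0..s} (\<lambda>s. f s (x0 s) (u a s) - f s (x0 s) (u (\<lambda>_. 0) s))"
      unfolding Henstock_Kurzweil_Integration.integral_diff[OF fu_int[OF a x0c x0r s] fu_int[OF weights_zero x0c x0r s]]
      using x0_eq[OF s] by (simp add: u_zero)
    then show "norm (x0 0 + integral {0..s} (\<lambda>s. f s (x0 s) (u a s)) - x0 s) \<le> K * sum a {..<N}"
      using control_change[OF a weights_zero x0c x0r s] sum_weights[OF a] by simp
  next
    show "2 * (K * sum a {..<N}) * exp (2 * L * T) \<le> r"
      using C_weights[OF a] by (simp add: C_def mult_ac)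
  qed
  then show ?thesis by (simp add: C_def mult_ac)
qed

definition traj where
  "traj a = (SOME x. continuous_on {0..T} x \<and> (\<forall>s\<in>{0..T}. norm (x s - x0 s) \<le> C * sum a {..<N}) \<and>
    (\<forall>s\<in>{0..T}. x s = x0 0 + integral {0..s} (\<lambda>s. f s (x s) (u a s))))"

lemma traj:
  assumes "sm a"
  shows "continuous_on {0..T} (traj a)" "\<And>s. s \<in> {0..T} \<Longrightarrow> norm (traj a s - x0 s) \<le> C * sum a {..<N}"
    "\<And>s. s \<in> {0..T} \<Longrightarrow> traj a s = x0 0 + integral {0..s} (\<lambda>s. f s (traj a s) (u a s))"
    "\<And>s. s \<in> {0..T} \<Longrightarrow> norm (traj a s - x0 s) \<le> r"
proof -
  note * = someI_ex[OF trajectory_exists[OF assms], folded traj_def]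
  show "continuous_on {0..T} (traj a)" "\<And>s. s \<in> {0..T} \<Longrightarrow> norm (traj a s - x0 s) \<le> C * sum a {..<N}"
    "\<And>s. s \<in> {0..T} \<Longrightarrow> traj a s = x0 0 + integral {0..s} (\<lambda>s. f s (traj a s) (u a s))"
    using * by blast+
  then show "norm (traj a s - x0 s) \<le> r" if "s \<in> {0..T}" for s
    using C_weights[OF assms] that by (meson order_trans)
qed

lemma traj_deriv:
  assumes a: "sm a"
  shows "\<exists>S. finite S \<and> (\<forall>s\<in>{0<..<T} - S. (traj a has_vector_derivative f s (traj a s) (u a s)) (at s))"
proof -
  obtain S where S: "npc T UNIV S (\<lambda>s. f s (traj a s) (u a s))" using fu_npc[OF a traj(1,4)[OF a]] by blast
  then show ?thesis using npc_integral_deriv[OF T S traj(3)[OF a]] by (auto simp: npc_def)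
qed

lemma traj_PC1:
  assumes a: "sm a"
  shows "traj a \<in> PC1 T \<Omega>" "\<And>s. s \<in> {0..T} \<Longrightarrow> ext_deriv T (traj a) s = f s (traj a s) (u a s)" "u a \<in> NPC0_R T U" "traj a 0 = x0 0"
proof -
  obtain S where S: "npc T UNIV S (\<lambda>s. f s (traj a s) (u a s))" using fu_npc[OF a traj(1,4)[OF a]] by blast
  obtain S' where S': "finite S'" "\<forall>s\<in>{0<..<T} - S'. (traj a has_vector_derivative f s (traj a s) (u a s)) (at s)"
    using traj_deriv[OF a] by blast
  have XO: "traj a ` {0..T} \<subseteq> \<Omega>" using tubeO[OF _ traj(4)[OF a]] by blast
  show "traj a \<in> PC1 T \<Omega>" "\<And>s. s \<in> {0..T} \<Longrightarrow> ext_deriv T (traj a) s = f s (traj a s) (u a s)"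
    using PC1I_npc[OF T XO traj(1)[OF a] S'(1) _ S] S'(2) by blast+
  show "u a \<in> NPC0_R T U" using u_npc[OF a] npc_imp_NPC0_R T by blast
  show "traj a 0 = x0 0" using traj(3)[OF a, of 0] T by simp
qed

text \<open>The two trajectories satisfy a Gronwall inequality whose inhomogeneity is the effect of the change of control.\<close>

lemma traj_continuous:
  assumes a: "sm a" and b: "sm b" and s: "s \<in> {0..T}"
  shows "norm (traj a s - traj b s) \<le> C * (\<Sum>j<N. \<bar>a j - b j\<bar>)"
proof -
  let ?D = "\<Sum>j<N. \<bar>a j - b j\<bar>"
  have D0: "0 \<le> ?D" by (simp add: sum_nonneg)
  have yc: "continuous_on {0..T} (\<lambda>s. norm (traj a s - traj b s))" by (intro continuous_intros traj a b)
  have "norm (traj a s - traj b s) \<le> 2 * (K * ?D) * exp (2 * L * s)"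
  proof (rule gronwall[OF yc L _ _ s])
    show "0 \<le> K * ?D" using K0 D0 by simp
    fix s assume s: "s \<in> {0..T}"
    have i1: "(\<lambda>s. f s (traj a s) (u a s)) integrable_on {0..s}" by (rule fu_int[OF a traj(1,4)[OF a] s])
    have i2: "(\<lambda>s. f s (traj b s) (u a s)) integrable_on {0..s}" by (rule fu_int[OF a traj(1,4)[OF b] s])
    have i3: "(\<lambda>s. f s (traj b s) (u b s)) integrable_on {0..s}" by (rule fu_int[OF b traj(1,4)[OF b] s])
    have ys: "(\<lambda>s. L * norm (traj a s - traj b s)) integrable_on {0..s}"
      by (intro integrable_continuous_real continuous_intros continuous_on_subset[OF traj(1)[OF a]] continuous_on_subset[OF traj(1)[OF b]])
        (use s in auto)
    have "traj a s - traj b s = integral {0..s} (\<lambda>s. f s (traj a s) (u a s) - f s (traj b s) (u a s))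
        + integral {0..s} (\<lambda>s. f s (traj b s) (u a s) - f s (traj b s) (u b s))"
      unfolding Henstock_Kurzweil_Integration.integral_diff[OF i1 i2] Henstock_Kurzweil_Integration.integral_diff[OF i2 i3]
      using traj(3)[OF a s] traj(3)[OF b s] by simp
    then have "norm (traj a s - traj b s) \<le> norm (integral {0..s} (\<lambda>s. f s (traj a s) (u a s) - f s (traj b s) (u a s)))
        + norm (integral {0..s} (\<lambda>s. f s (traj b s) (u a s) - f s (traj b s) (u b s)))"
      by (simp only: norm_triangle_ineq)
    moreover have "norm (integral {0..s} (\<lambda>s. f s (traj b s) (u a s) - f s (traj b s) (u b s))) \<le> K * ?D"
      by (rule control_change[OF a b traj(1,4)[OF b] s])
    moreover have "norm (integral {0..s} (\<lambda>s. f s (traj a s) (u a s) - f s (traj b s) (u a s))) \<le> integral {0..s} (\<lambda>s. L * norm (traj a s - traj b s))"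
    proof (rule integral_norm_bound_integral[OF integrable_diff[OF i1 i2] ys])
      fix s' assume "s' \<in> {0..s}"
      then have "s' \<in> {0..T}" using s by auto
      then show "norm (f s' (traj a s') (u a s') - f s' (traj b s') (u a s')) \<le> L * norm (traj a s' - traj b s')"
        by (intro lip u_values traj(4) a b)
    qed
    ultimately show "0 \<le> norm (traj a s - traj b s) \<and> norm (traj a s - traj b s) \<le> K * ?D + L * integral {0..s} (\<lambda>s. norm (traj a s - traj b s))"
      by simp
  qed
  also have "\<dots> \<le> 2 * (K * ?D) * exp (2 * L * T)"
    using s L K0 D0 by (intro mult_left_mono) (auto intro: mult_left_mono)
  finally show ?thesis by (simp add: C_def mult_ac)
qed

section \<open>First-order expansion of the end point\<close>

abbreviation "v i \<equiv> needle_direction (\<tau> i) (\<zeta> i)"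

text \<open>The two parts of the derivative of \<open>R s (traj a s - x0 s)\<close>: the nonlinear remainder along the reference
control, and the effect of the needles.\<close>

definition "remainder a s = R s (f s (traj a s) (u0 s) - f s (x0 s) (u0 s) - A s (traj a s - x0 s))"
definition "needle_term a s = R s (f s (traj a s) (u a s) - f s (traj a s) (u0 s))"

lemma remainder_needle_term_npc:
  assumes a: "sm a"
  shows "\<exists>S. npc T UNIV S (remainder a)" "\<exists>S. npc T UNIV S (needle_term a)"
proof -
  obtain S1 where 1: "npc T UNIV S1 (\<lambda>s. f s (traj a s) (u a s))" using fu_npc[OF a traj(1,4)[OF a]] by blast
  have 2: "npc T UNIV Su (\<lambda>s. f s (traj a s) (u0 s))"
    by (rule f_npc[OF traj(1)[OF a] tubeO[OF _ traj(4)[OF a]] u0])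
  have 3: "npc T UNIV Su (\<lambda>s. f s (x0 s) (u0 s))" by (rule f_npc[OF x0c x0O u0])
  have 4: "npc T UNIV Su (\<lambda>s. A s (traj a s - x0 s))"
  proof (rule npc_comp[OF A _ _ T])
    have "continuous_on {0..T} (\<lambda>s. traj a s - x0 s)" by (intro continuous_intros traj(1)[OF a] x0c)
    then have "continuous_on ({0..T} \<times> UNIV) (\<lambda>p::real \<times> ('a \<Rightarrow>\<^sub>L 'a). traj a (fst p) - x0 (fst p))"
      by (rule continuous_on_compose2[OF _ continuous_on_fst[OF continuous_on_id]]) auto
    then have "continuous_on ({0..T} \<times> UNIV) (\<lambda>p::real \<times> ('a \<Rightarrow>\<^sub>L 'a). blinfun_apply (snd p) (traj a (fst p) - x0 (fst p)))"
      by (rule bounded_bilinear.continuous_on[OF bounded_bilinear_blinfun_apply continuous_on_snd[OF continuous_on_id]])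
    then show "continuous_on ({0..T} \<times> UNIV) (\<lambda>(s, Z :: 'a \<Rightarrow>\<^sub>L 'a). blinfun_apply Z (traj a s - x0 s))"
      by (simp add: case_prod_beta)
  qed simp
  show "\<exists>S. npc T UNIV S (remainder a)"
    unfolding remainder_def[abs_def] using npc_linear[OF npc_diff[OF npc_diff[OF 2 3 T] 4 T] Rc T] by blast
  show "\<exists>S. npc T UNIV S (needle_term a)"
    unfolding needle_term_def[abs_def] using npc_linear[OF npc_diff[OF 1 2 T] Rc T] by blast
qed

lemma remainder_needle_term_int:
  assumes a: "sm a"
  shows "remainder a integrable_on {0..T}" "(\<lambda>s. norm (remainder a s)) integrable_on {0..T}" "needle_term a integrable_on {0..T}"
  using remainder_needle_term_npc[OF a] npc_integrable[OF _ T] npc_integrable[OF npc_norm[OF _ T] T] by blast+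

text \<open>Differentiating \<open>R s (traj a s - x0 s)\<close> cancels the linear term \<open>A s (traj a s - x0 s)\<close>, as
\<open>R' = - R A\<close>. At \<open>s = 0\<close> the trajectories agree and at \<open>s = T\<close> the resolvent is the identity.\<close>

lemma endpoint_representation:
  assumes a: "sm a"
  shows "traj a T - x0 T = integral {0..T} (remainder a) + integral {0..T} (needle_term a)"
proof -
  obtain S where S: "finite S" "\<And>s. s \<in> {0<..<T} - S \<Longrightarrow> (traj a has_vector_derivative f s (traj a s) (u a s)) (at s)"
    using traj_deriv[OF a] by blast
  have "((\<lambda>s. remainder a s + needle_term a s) has_integral (R T (traj a T - x0 T) - R 0 (traj a 0 - x0 0))) {0..T}"
  proof (rule fundamental_theorem_of_calculus_interior_strong[where S="S \<union> S0 \<union> SR"])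
    show "finite (S \<union> S0 \<union> SR)" using S(1) S0 SR by simp
    show "continuous_on {0..T} (\<lambda>s. R s (traj a s - x0 s))"
      by (intro bounded_bilinear.continuous_on[OF bounded_bilinear_blinfun_apply] Rc continuous_intros traj(1)[OF a] x0c)
    fix s assume s: "s \<in> {0<..<T} - (S \<union> S0 \<union> SR)"
    have "((\<lambda>s. traj a s - x0 s) has_vector_derivative f s (traj a s) (u a s) - f s (x0 s) (u0 s)) (at s)"
      using S(2)[of s] x0d[of s] s by (intro has_vector_derivative_diff) auto
    moreover have "(R has_vector_derivative - (R s o\<^sub>L A s)) (at s)" using Rd[of s] s by auto
    ultimately have "((\<lambda>s. R s (traj a s - x0 s)) has_vector_derivative
        R s (f s (traj a s) (u a s) - f s (x0 s) (u0 s)) + (- (R s o\<^sub>L A s)) (traj a s - x0 s)) (at s)"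
      by (intro bounded_bilinear.has_vector_derivative[OF bounded_bilinear_blinfun_apply])
    then show "((\<lambda>s. R s (traj a s - x0 s)) has_vector_derivative remainder a s + needle_term a s) (at s)"
      by (simp add: remainder_def needle_term_def blinfun.diff_right blinfun.minus_left blinfun.add_right algebra_simps)
  qed (use T in auto)
  moreover have "R T (traj a T - x0 T) - R 0 (traj a 0 - x0 0) = traj a T - x0 T"
    using traj_PC1(4)[OF a] by (simp add: RT)
  ultimately have "((\<lambda>s. remainder a s + needle_term a s) has_integral (traj a T - x0 T)) {0..T}" by simp
  from integral_unique[OF this] show ?thesis
    by (simp add: Henstock_Kurzweil_Integration.integral_add[OF remainder_needle_term_int(1,3)[OF a]])
qed

lemma R_bounded: obtains CR where "0 \<le> CR" "\<And>s. s \<in> {0..T} \<Longrightarrow> norm (R s) \<le> CR"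
proof -
  have "bounded (R ` {0..T})" by (intro compact_imp_bounded compact_continuous_image Rc compact_Icc)
  then obtain c where "\<And>s. s \<in> {0..T} \<Longrightarrow> norm (R s) \<le> c" unfolding bounded_iff by blast
  then show ?thesis using T by (intro that[of c]) (auto intro: order_trans[OF norm_ge_zero, of "R 0"])
qed

lemma needle_direction_right_limit:
  assumes "z \<in> U" "s \<in> {0..<T}"
  shows "((\<lambda>s. needle_direction s z) \<longlongrightarrow> needle_direction s z) (at_right s)"
proof -
  have "npc T U {} (\<lambda>_. z)" using assms(1) by (auto simp: npc_def)
  from f_npc[OF x0c x0O this] have "npc T UNIV {} (\<lambda>s. f s (x0 s) z)" .
  from npc_linear[OF npc_diff[OF this f_npc[OF x0c x0O u0] T] Rc T]
  show ?thesis using assms(2) unfolding npc_def needle_direction_def by auto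
qed

text \<open>Right-continuity of the control at \<open>\<tau> i\<close> is enough, since a needle lies to the right of its nominal
time; the Lipschitz bound replaces \<open>x0 s\<close> by a nearby \<open>y\<close>.\<close>

lemma needle_pointwise:
  assumes i: "i < N" and \<epsilon>: "0 < (\<epsilon>::real)"
  shows "\<exists>d>0. \<forall>s y. s \<in> {0..T} \<and> \<tau> i \<le> s \<and> s < \<tau> i + d \<and> norm (y - x0 s) \<le> d \<and> norm (y - x0 s) \<le> r \<longrightarrow>
    norm (R s (f s y (\<zeta> i) - f s y (u0 s)) - v i) \<le> \<epsilon>"
proof -
  obtain CR where CR: "0 \<le> CR" "\<And>s. s \<in> {0..T} \<Longrightarrow> norm (R s) \<le> CR" by (rule R_bounded) blast
  have "\<forall>\<^sub>F s in at_right (\<tau> i). dist (needle_direction s (\<zeta> i)) (v i) < \<epsilon> / 2"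
    by (rule tendstoD[OF needle_direction_right_limit[OF \<zeta>[OF i] \<tau>[OF i]]]) (use \<epsilon> in simp)
  then obtain b where b: "b > \<tau> i" "\<And>s. \<tau> i < s \<Longrightarrow> s < b \<Longrightarrow> dist (needle_direction s (\<zeta> i)) (v i) < \<epsilon> / 2"
    unfolding eventually_at_right_field by blast
  define d where "d = min (b - \<tau> i) (\<epsilon> / (4 * (CR * L + 1)))"
  have CL: "0 \<le> CR * L" using CR(1) L by simp
  have d: "0 < d" "CR * (2 * L * d) \<le> \<epsilon> / 2"
  proof -
    show "0 < d" using b(1) \<epsilon> CL by (simp add: d_def)
    have "d \<le> \<epsilon> / (4 * (CR * L + 1))" by (simp add: d_def)
    then have "4 * (CR * L + 1) * d \<le> \<epsilon>" using CL by (simp add: field_simps)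
    then show "CR * (2 * L * d) \<le> \<epsilon> / 2" using \<open>0 < d\<close> by (simp add: algebra_simps)
  qed
  have "norm (R s (f s y (\<zeta> i) - f s y (u0 s)) - v i) \<le> \<epsilon>"
    if s: "s \<in> {0..T}" "\<tau> i \<le> s" "s < \<tau> i + d" and y: "norm (y - x0 s) \<le> d" "norm (y - x0 s) \<le> r" for s y
  proof -
    have x0r: "norm (x0 s - x0 s) \<le> r" using r by simp
    have near: "norm (needle_direction s (\<zeta> i) - v i) \<le> \<epsilon> / 2"
    proof (cases "s = \<tau> i")
      case False
      then have "dist (needle_direction s (\<zeta> i)) (v i) < \<epsilon> / 2" using s by (intro b(2)) (auto simp: d_def)
      then show ?thesis by (simp add: dist_norm)
    qed (use \<epsilon> in simp)
    let ?p = "f s y (\<zeta> i) - f s (x0 s) (\<zeta> i)" and ?q = "f s y (u0 s) - f s (x0 s) (u0 s)"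
    have "norm ?p \<le> L * norm (y - x0 s)" using i by (intro lip s y x0r) auto
    moreover have "norm ?q \<le> L * norm (y - x0 s)" by (intro lip s y x0r) auto
    moreover have "L * norm (y - x0 s) \<le> L * d" using y L by (intro mult_left_mono)
    ultimately have pq: "norm (?p - ?q) \<le> 2 * L * d" using norm_triangle_ineq4[of ?p ?q] by linarith
    have "norm (R s (?p - ?q)) \<le> norm (R s) * norm (?p - ?q)" by (rule norm_blinfun)
    also have "\<dots> \<le> CR * (2 * L * d)" using CR s pq by (intro mult_mono) auto
    finally have Rpq: "norm (R s (?p - ?q)) \<le> \<epsilon> / 2" using d(2) by linarith
    have "R s (f s y (\<zeta> i) - f s y (u0 s)) - v i = R s (?p - ?q) + (needle_direction s (\<zeta> i) - v i)"
      unfolding needle_direction_def by (simp add: blinfun.diff_right)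
    then have "norm (R s (f s y (\<zeta> i) - f s y (u0 s)) - v i) \<le> norm (R s (?p - ?q)) + norm (needle_direction s (\<zeta> i) - v i)"
      by (simp only: norm_triangle_ineq)
    then show ?thesis using Rpq near by linarith
  qed
  then show ?thesis using d(1) by blast
qed

lemma step_has_integral:
  fixes c :: "'c::banach"
  assumes "0 \<le> p" "p \<le> q" "q \<le> T"
  shows "((\<lambda>s. if s \<in> {p..<q} then c else 0) has_integral (q - p) *\<^sub>R c) {0..T}"
proof -
  have "((\<lambda>s. c) has_integral (q - p) *\<^sub>R c) {p..q}" using has_integral_const_real[of c p q] assms by simp
  then have "((\<lambda>s. if s \<in> {p..q} then c else 0) has_integral (q - p) *\<^sub>R c) {0..T}"
    using assms by (subst has_integral_restrict) auto
  then show ?thesis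
    by (rule has_integral_spike_finite[of "{q}", rotated 2]) auto
qed

text \<open>On the \<open>i\<close>-th needle the integrand is within \<open>\<epsilon>\<close> of the constant \<open>v i\<close>, elsewhere it vanishes;
it is compared with the corresponding step function, whose integral is \<open>\<Sum> a i v i\<close>.\<close>

lemma needle_integral:
  assumes \<epsilon>: "0 < (\<epsilon>::real)"
  shows "\<exists>d>0. \<forall>a. sm a \<and> sum a {..<N} \<le> d \<longrightarrow>
     norm (integral {0..T} (needle_term a) - (\<Sum>i<N. a i *\<^sub>R v i)) \<le> \<epsilon> * sum a {..<N}"
proof -
  have "\<forall>i. \<exists>d. i < N \<longrightarrow> d > 0 \<and> (\<forall>s y. s \<in> {0..T} \<and> \<tau> i \<le> s \<and> s < \<tau> i + d \<and> norm (y - x0 s) \<le> d \<and> norm (y - x0 s) \<le> r \<longrightarrow>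
    norm (R s (f s y (\<zeta> i) - f s y (u0 s)) - v i) \<le> \<epsilon>)"
    using needle_pointwise[OF _ \<epsilon>] by blast
  then obtain dd where dd: "\<And>i. i < N \<Longrightarrow> 0 < dd i"
    "\<And>i s y. i < N \<Longrightarrow> s \<in> {0..T} \<Longrightarrow> \<tau> i \<le> s \<Longrightarrow> s < \<tau> i + dd i \<Longrightarrow> norm (y - x0 s) \<le> dd i \<Longrightarrow> norm (y - x0 s) \<le> r \<Longrightarrow>
      norm (R s (f s y (\<zeta> i) - f s y (u0 s)) - v i) \<le> \<epsilon>" by metis
  define e where "e = Min (insert 1 (dd ` {..<N}))"
  have e: "0 < e" "\<And>i. i < N \<Longrightarrow> e \<le> dd i" using dd(1) by (auto simp: e_def)
  define d where "d = e / (C + 2)"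
  have d: "0 < d" "d < e" "C * d \<le> e" using e(1) C0 by (auto simp: d_def field_simps add_pos_nonneg)
  have "norm (integral {0..T} (needle_term a) - (\<Sum>i<N. a i *\<^sub>R v i)) \<le> \<epsilon> * sum a {..<N}"
    if a: "sm a" and ad: "sum a {..<N} \<le> d" for a
  proof -
    define p q where "p i = breakpt \<tau> i i a" and "q i = breakpt \<tau> i (Suc i) a" for i
    have a0: "0 \<le> a i" if "i < N" for i using a that by (simp add: weights_def)
    have qp: "q i - p i = a i" for i by (simp add: p_def q_def breakpt_def)
    have bounds: "0 \<le> p i" "p i \<le> q i" "q i \<le> T" "\<tau> i \<le> p i" "q i \<le> \<tau> i + d" if i: "i < N" for i
    proof -
      have "0 \<le> (\<Sum>j<i. a j)" using a0 i by (intro sum_nonneg) auto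
      then show t: "\<tau> i \<le> p i" by (simp add: p_def breakpt_def)
      then show "0 \<le> p i" using \<tau>[OF i] by auto
      show "p i \<le> q i" using qp[of i] a0[OF i] by simp
      have s: "(\<Sum>j<Suc i. a j) \<le> (\<Sum>j<N. a j)" using a0 i by (intro sum_mono2) auto
      show "q i \<le> \<tau> i + d" using s ad unfolding q_def breakpt_def by linarith
      show "q i \<le> T" using s a \<delta>T[OF i] unfolding q_def breakpt_def weights_def by linarith
    qed
    \<comment> \<open>At most one term of the step function is nonzero at a time.\<close>
    have disj: "s \<notin> {p j..<q j}" if "s \<in> {p i..<q i}" "i < N" "j < N" "i \<noteq> j" for s i j
    proof (cases "i < j")
      case True
      have "q i \<le> p j" unfolding p_def q_def
        by (rule breakpt_disjoint[OF True sorted[OF True that(3)]]) (use a0 that True in auto)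
      then show ?thesis using that(1) by auto
    next
      case False
      then have ji: "j < i" using that(4) by simp
      have "q j \<le> p i" unfolding p_def q_def
        by (rule breakpt_disjoint[OF ji sorted[OF ji that(2)]]) (use a0 that ji in auto)
      then show ?thesis using that(1) by auto
    qed
    define \<sigma> where "\<sigma> s = (\<Sum>i<N. if s \<in> {p i..<q i} then v i else 0)" for s
    define \<iota> where "\<iota> s = (\<Sum>i<N. if s \<in> {p i..<q i} then (1::real) else 0)" for s
    have \<sigma>: "(\<sigma> has_integral (\<Sum>i<N. a i *\<^sub>R v i)) {0..T}"
      unfolding \<sigma>_def[abs_def] qp[symmetric] by (rule has_integral_sum[OF finite_lessThan step_has_integral]) (simp_all add: bounds)
    have "(\<iota> has_integral (\<Sum>i<N. a i *\<^sub>R 1)) {0..T}"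
      unfolding \<iota>_def[abs_def] qp[symmetric] by (rule has_integral_sum[OF finite_lessThan step_has_integral]) (simp_all add: bounds)
    from has_integral_mult_right[OF this, of \<epsilon>]
    have \<iota>: "((\<lambda>s. \<epsilon> * \<iota> s) has_integral \<epsilon> * sum a {..<N}) {0..T}" by simp
    have "norm (integral {0..T} (\<lambda>s. needle_term a s - \<sigma> s)) \<le> integral {0..T} (\<lambda>s. \<epsilon> * \<iota> s)"
    proof (rule integral_norm_bound_integral)
      show "(\<lambda>s. needle_term a s - \<sigma> s) integrable_on {0..T}"
        by (intro integrable_diff remainder_needle_term_int a has_integral_integrable[OF \<sigma>])
      show "(\<lambda>s. \<epsilon> * \<iota> s) integrable_on {0..T}" by (rule has_integral_integrable[OF \<iota>])
      fix s assume s: "s \<in> {0..T}"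
      show "norm (needle_term a s - \<sigma> s) \<le> \<epsilon> * \<iota> s"
      proof (cases "\<exists>i<N. s \<in> {p i..<q i}")
        case False
        then have "u a s = u0 s" by (intro needle_ctrl_outside) (auto simp: p_def q_def)
        moreover have "\<sigma> s = 0" unfolding \<sigma>_def by (rule sum.neutral) (use False in auto)
        moreover have "\<iota> s = 0" unfolding \<iota>_def by (rule sum.neutral) (use False in auto)
        ultimately show ?thesis by (simp add: needle_term_def)
      next
        case True
        then obtain i where i: "i < N" "s \<in> {p i..<q i}" by blast
        have "u a s = \<zeta> i" by (rule needle_ctrl_inside[OF sorted a0 i(1)]) (use i in \<open>auto simp: p_def q_def\<close>)
        moreover have "\<sigma> s = (\<Sum>j\<in>{i}. if s \<in> {p j..<q j} then v j else 0)"
          unfolding \<sigma>_def by (rule sum.mono_neutral_right) (use i disj[OF i(2,1)] in auto)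
        then have "\<sigma> s = v i" using i by simp
        moreover have "\<iota> s = (\<Sum>j\<in>{i}. if s \<in> {p j..<q j} then 1 else 0)"
          unfolding \<iota>_def by (rule sum.mono_neutral_right) (use i disj[OF i(2,1)] in auto)
        then have "\<iota> s = 1" using i by simp
        moreover have "norm (R s (f s (traj a s) (\<zeta> i) - f s (traj a s) (u0 s)) - v i) \<le> \<epsilon>"
        proof (rule dd(2)[OF i(1) s])
          show "\<tau> i \<le> s" "s < \<tau> i + dd i" using i bounds[OF i(1)] d(2) e(2)[OF i(1)] by auto
          have "C * sum a {..<N} \<le> C * d" using C0 ad by (intro mult_left_mono)
          then show "norm (traj a s - x0 s) \<le> dd i" using traj(2)[OF a s] d(3) e(2)[OF i(1)] by linarith
          show "norm (traj a s - x0 s) \<le> r" by (rule traj(4)[OF a s])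
        qed
        ultimately show ?thesis by (simp add: needle_term_def)
      qed
    qed
    then show ?thesis
      by (simp only: integral_unique[OF \<iota>] integral_unique[OF \<sigma>]
        Henstock_Kurzweil_Integration.integral_diff[OF remainder_needle_term_int(3)[OF a] has_integral_integrable[OF \<sigma>]])
  qed
  then show ?thesis using d(1) by blast
qed

text \<open>For fixed \<open>s\<close> the quotient of the remainder by \<open>\<Theta> k\<close> tends to \<open>0\<close> by Frechet differentiability at \<open>x0 s\<close>, but the rate
depends on \<open>s\<close>. The Lipschitz bound dominates it by a constant, since \<open>traj a s - x0 s\<close> is of order \<open>\<Theta> k\<close>.\<close>

lemma remainder_integral:
  assumes \<Theta>: "\<And>k::nat. 0 < \<Theta> k" "\<Theta> \<longlonglongrightarrow> 0" and sm: "\<And>k. sm (\<lambda>i. \<Theta> k * Q k i)"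
    and M: "\<And>k. sum (Q k) {..<N} \<le> M"
  shows "(\<lambda>k. integral {0..T} (remainder (\<lambda>i. \<Theta> k * Q k i)) /\<^sub>R \<Theta> k) \<longlonglongrightarrow> 0"
proof -
  obtain CR where CR: "0 \<le> CR" "\<And>s. s \<in> {0..T} \<Longrightarrow> norm (R s) \<le> CR" by (rule R_bounded) blast
  obtain CA where CA: "0 \<le> CA" "\<And>s. s \<in> {0..T} \<Longrightarrow> norm (A s) \<le> CA" using npc_bounded[OF A T] by metis
  define a where "a k = (\<lambda>i. \<Theta> k * Q k i)" for k
  have sm: "sm (a k)" for k using sm by (simp add: a_def)
  have M0: "0 \<le> M"
  proof -
    have "0 \<le> \<Theta> 0 * sum (Q 0) {..<N}"
      unfolding sum_distrib_left by (rule sum_nonneg) (use sm[of 0] in \<open>auto simp: weights_def a_def\<close>)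
    then show ?thesis using \<Theta>(1)[of 0] M[of 0] by (simp add: zero_le_mult_iff)
  qed
  have z: "norm (traj (a k) s - x0 s) \<le> \<Theta> k * (C * M)" if "s \<in> {0..T}" for k s
  proof -
    have "norm (traj (a k) s - x0 s) \<le> C * sum (a k) {..<N}" by (rule traj(2)[OF sm that])
    also have "sum (a k) {..<N} = \<Theta> k * sum (Q k) {..<N}" by (simp add: a_def sum_distrib_left)
    also have "C * (\<Theta> k * sum (Q k) {..<N}) \<le> C * (\<Theta> k * M)"
      using C0 \<Theta>(1)[of k] M[of k] by (intro mult_left_mono) auto
    finally show ?thesis by (simp add: mult_ac)
  qed
  define \<phi> where "\<phi> k s = norm (remainder (a k) s) / \<Theta> k" for k s
  have le: "\<phi> k s \<le> CR * (w * (C * M))"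
    if s: "s \<in> {0..T}" and w: "0 \<le> w" "norm (f s (traj (a k) s) (u0 s) - f s (x0 s) (u0 s) - A s (traj (a k) s - x0 s)) \<le> w * norm (traj (a k) s - x0 s)" for k s w
  proof -
    have "norm (remainder (a k) s) \<le> norm (R s) * norm (f s (traj (a k) s) (u0 s) - f s (x0 s) (u0 s) - A s (traj (a k) s - x0 s))"
      unfolding remainder_def by (rule norm_blinfun)
    also have "\<dots> \<le> CR * (w * norm (traj (a k) s - x0 s))" using CR s w by (intro mult_mono) auto
    also have "\<dots> \<le> CR * (w * (\<Theta> k * (C * M)))" using CR w z[OF s] by (intro mult_left_mono) auto
    finally show ?thesis using \<Theta>(1)[of k] by (simp add: \<phi>_def field_simps)
  qed
  have "(\<lambda>k. integral {0..T} (\<phi> k)) \<longlonglongrightarrow> integral {0..T} (\<lambda>_. 0)"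
  proof (rule dominated_convergence(2)[where h="\<lambda>_. CR * ((L + CA) * (C * M))"])
    show "\<phi> k integrable_on {0..T}" for k
      unfolding \<phi>_def[abs_def] divide_inverse by (intro integrable_on_mult_left remainder_needle_term_int sm)
    show "(\<lambda>_. CR * ((L + CA) * (C * M))) integrable_on {0..T}"
      by (rule integrable_continuous_real[OF continuous_on_const])
  next
    fix k s assume s: "s \<in> {0..T}"
    have "norm (f s (traj (a k) s) (u0 s) - f s (x0 s) (u0 s)) \<le> L * norm (traj (a k) s - x0 s)"
      using r by (intro lip s traj(4)[OF sm s]) auto
    moreover have "norm (A s (traj (a k) s - x0 s)) \<le> CA * norm (traj (a k) s - x0 s)"
      by (rule order_trans[OF norm_blinfun mult_right_mono[OF CA(2)[OF s]]]) simp
    ultimately have "norm (f s (traj (a k) s) (u0 s) - f s (x0 s) (u0 s) - A s (traj (a k) s - x0 s)) \<le> (L + CA) * norm (traj (a k) s - x0 s)"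
      using norm_triangle_ineq4[of "f s (traj (a k) s) (u0 s) - f s (x0 s) (u0 s)" "A s (traj (a k) s - x0 s)"]
      by (simp add: algebra_simps)
    from le[OF s _ this] have "\<phi> k s \<le> CR * ((L + CA) * (C * M))" using L CA(1) by simp
    moreover have "0 \<le> \<phi> k s" using \<Theta>(1)[of k] by (simp add: \<phi>_def)
    ultimately show "norm (\<phi> k s) \<le> CR * ((L + CA) * (C * M))" by simp
  next
    fix s assume s: "s \<in> {0..T}"
    show "(\<lambda>k. \<phi> k s) \<longlonglongrightarrow> 0"
    proof (rule tendstoI)
      fix e :: real assume e: "0 < e"
      \<comment> \<open>The summand \<open>1\<close> only keeps the denominator positive.\<close>
      define w where "w = e / (CR * (C * M) + 1)"
      have c: "0 \<le> CR * (C * M)" using CR(1) C0 M0 by simp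
      then have w: "0 < w" "CR * (w * (C * M)) < e" using e by (auto simp: w_def field_simps add_pos_nonneg)
      obtain d where d: "0 < d" "\<And>y. norm (y - x0 s) < d \<Longrightarrow>
           norm (f s y (u0 s) - f s (x0 s) (u0 s) - A s (y - x0 s)) \<le> w * norm (y - x0 s)"
        using Ad[OF s] w(1) unfolding has_derivative_at_alt by blast
      have "(\<lambda>k. \<Theta> k * (C * M)) \<longlonglongrightarrow> 0 * (C * M)" by (intro tendsto_intros \<Theta>(2))
      then have "\<forall>\<^sub>F k in sequentially. \<Theta> k * (C * M) < d" using d(1) by (intro order_tendstoD(2)) auto
      then show "\<forall>\<^sub>F k in sequentially. dist (\<phi> k s) 0 < e"
      proof (rule eventually_mono)
        fix k assume "\<Theta> k * (C * M) < d"
        then have "norm (traj (a k) s - x0 s) < d" using z[OF s, of k] by linarith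
        from le[OF s _ d(2)[OF this]] have "\<phi> k s < e" using w by simp
        moreover have "0 \<le> \<phi> k s" using \<Theta>(1)[of k] by (simp add: \<phi>_def)
        ultimately show "dist (\<phi> k s) 0 < e" by simp
      qed
    qed
  qed
  then have lim: "(\<lambda>k. integral {0..T} (\<phi> k)) \<longlonglongrightarrow> 0" by simp
  have "norm (integral {0..T} (remainder (a k)) /\<^sub>R \<Theta> k) \<le> integral {0..T} (\<phi> k)" for k
  proof -
    have "norm (integral {0..T} (remainder (a k))) \<le> integral {0..T} (\<lambda>s. norm (remainder (a k) s))"
      by (rule integral_norm_bound_integral[OF remainder_needle_term_int(1)[OF sm] remainder_needle_term_int(2)[OF sm]]) simp
    then have "norm (integral {0..T} (remainder (a k))) / \<Theta> k \<le> integral {0..T} (\<lambda>s. norm (remainder (a k) s)) / \<Theta> k"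
      using \<Theta>(1)[of k] by (intro divide_right_mono) auto
    also have "\<dots> = integral {0..T} (\<phi> k)" unfolding \<phi>_def[abs_def] by simp
    finally show ?thesis using \<Theta>(1)[of k] by (simp add: divide_inverse mult.commute)
  qed
  then have "(\<lambda>k. integral {0..T} (remainder (a k)) /\<^sub>R \<Theta> k) \<longlonglongrightarrow> 0"
    by (intro Lim_null_comparison[OF _ lim] always_eventually allI)
  then show ?thesis by (simp add: a_def)
qed

lemma first_order_expansion:
  assumes \<Theta>: "\<And>k::nat. 0 < \<Theta> k" "\<Theta> \<longlonglongrightarrow> 0" and Q0: "\<And>k i. i < N \<Longrightarrow> 0 \<le> Q k i"
    and sm: "\<And>k. sm (\<lambda>i. \<Theta> k * Q k i)"
    and Q: "\<And>i. i < N \<Longrightarrow> (\<lambda>k. Q k i) \<longlonglongrightarrow> a i"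
  shows "(\<lambda>k. (traj (\<lambda>i. \<Theta> k * Q k i) T - x0 T) /\<^sub>R \<Theta> k) \<longlonglongrightarrow> (\<Sum>i<N. a i *\<^sub>R v i)"
proof -
  have sumQ: "(\<lambda>k. sum (Q k) {..<N}) \<longlonglongrightarrow> sum a {..<N}" by (intro tendsto_sum Q) simp
  then have "Bseq (\<lambda>k. sum (Q k) {..<N})" by (intro convergent_imp_Bseq convergentI)
  then obtain M where "\<And>k. norm (sum (Q k) {..<N}) \<le> M" unfolding Bseq_def by blast
  then have M: "sum (Q k) {..<N} \<le> M" for k by (metis real_norm_def abs_le_D1)
  have sQ0: "0 \<le> sum (Q k) {..<N}" for k using Q0 by (intro sum_nonneg) auto
  have M0: "0 \<le> M" using M[of 0] sQ0[of 0] by linarith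
  have sumt: "(\<Sum>i<N. \<Theta> k * Q k i) = \<Theta> k * sum (Q k) {..<N}" for k by (simp add: sum_distrib_left)
  have nd: "(\<lambda>k. (integral {0..T} (needle_term (\<lambda>i. \<Theta> k * Q k i)) - (\<Sum>i<N. (\<Theta> k * Q k i) *\<^sub>R v i)) /\<^sub>R \<Theta> k) \<longlonglongrightarrow> 0"
  proof (rule tendstoI)
    fix e :: real assume e: "0 < e"
    define \<epsilon> where "\<epsilon> = e / (M + 1)"
    have \<epsilon>: "0 < \<epsilon>" "\<epsilon> * M < e" using e M0 by (auto simp: \<epsilon>_def field_simps)
    obtain d where d: "0 < d" "\<And>a. sm a \<Longrightarrow> sum a {..<N} \<le> d \<Longrightarrow>
       norm (integral {0..T} (needle_term a) - (\<Sum>i<N. a i *\<^sub>R v i)) \<le> \<epsilon> * sum a {..<N}"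
      using needle_integral[OF \<epsilon>(1)] by blast
    have "(\<lambda>k. \<Theta> k * sum (Q k) {..<N}) \<longlonglongrightarrow> 0 * sum a {..<N}" by (intro tendsto_intros \<Theta>(2) sumQ)
    then have "\<forall>\<^sub>F k in sequentially. \<Theta> k * sum (Q k) {..<N} < d" using d(1) by (intro order_tendstoD(2)) auto
    then show "\<forall>\<^sub>F k in sequentially. dist ((integral {0..T} (needle_term (\<lambda>i. \<Theta> k * Q k i)) - (\<Sum>i<N. (\<Theta> k * Q k i) *\<^sub>R v i)) /\<^sub>R \<Theta> k) 0 < e"
    proof (rule eventually_mono)
      fix k assume "\<Theta> k * sum (Q k) {..<N} < d"
      then have "norm (integral {0..T} (needle_term (\<lambda>i. \<Theta> k * Q k i)) - (\<Sum>i<N. (\<Theta> k * Q k i) *\<^sub>R v i)) \<le> \<epsilon> * (\<Theta> k * sum (Q k) {..<N})"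
        using d(2)[OF sm, of k] by (simp add: sumt)
      then have "norm (integral {0..T} (needle_term (\<lambda>i. \<Theta> k * Q k i)) - (\<Sum>i<N. (\<Theta> k * Q k i) *\<^sub>R v i)) / \<Theta> k \<le> \<epsilon> * sum (Q k) {..<N}"
        using \<Theta>(1)[of k] by (simp add: field_simps)
      also have "\<dots> \<le> \<epsilon> * M" using \<epsilon>(1) M by (intro mult_left_mono) auto
      finally show "dist ((integral {0..T} (needle_term (\<lambda>i. \<Theta> k * Q k i)) - (\<Sum>i<N. (\<Theta> k * Q k i) *\<^sub>R v i)) /\<^sub>R \<Theta> k) 0 < e"
        using \<epsilon>(2) \<Theta>(1)[of k] by (simp add: divide_inverse mult.commute)
    qed
  qed
  have sc: "(\<Sum>i<N. (\<Theta> k * Q k i) *\<^sub>R v i) /\<^sub>R \<Theta> k = (\<Sum>i<N. Q k i *\<^sub>R v i)" for k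
    using \<Theta>(1)[of k] by (simp add: scaleR_sum_right mult.assoc[symmetric])
  have "(\<lambda>k. integral {0..T} (remainder (\<lambda>i. \<Theta> k * Q k i)) /\<^sub>R \<Theta> k +
       (integral {0..T} (needle_term (\<lambda>i. \<Theta> k * Q k i)) - (\<Sum>i<N. (\<Theta> k * Q k i) *\<^sub>R v i)) /\<^sub>R \<Theta> k +
       (\<Sum>i<N. Q k i *\<^sub>R v i)) \<longlonglongrightarrow> 0 + 0 + (\<Sum>i<N. a i *\<^sub>R v i)"
    by (intro tendsto_add remainder_integral[OF \<Theta> sm M] nd tendsto_sum tendsto_scaleR Q tendsto_const) auto
  moreover have "(traj (\<lambda>i. \<Theta> k * Q k i) T - x0 T) /\<^sub>R \<Theta> k = integral {0..T} (remainder (\<lambda>i. \<Theta> k * Q k i)) /\<^sub>R \<Theta> k +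
       (integral {0..T} (needle_term (\<lambda>i. \<Theta> k * Q k i)) - (\<Sum>i<N. (\<Theta> k * Q k i) *\<^sub>R v i)) /\<^sub>R \<Theta> k +
       (\<Sum>i<N. Q k i *\<^sub>R v i)" for k
    unfolding endpoint_representation[OF sm] sc[symmetric] by (simp add: scaleR_add_right scaleR_diff_right)
  ultimately show ?thesis by simp
qed

end

text \<open>Each vector of \<open>P\<close> is the direction of some needle; enumerating these in order of time gives the data
of a needle family. The compact set of control values consists of a compact hull of the range of \<open>u0\<close> and
the finitely many needle values.\<close>

lemma (in reference_process) variation_family_exists:
  assumes f_gateaux: "\<forall>t\<in>{0..T}. \<forall>\<xi>\<in>\<Omega>. \<forall>\<zeta>\<in>U. \<exists>D. has_gateaux_differential (\<lambda>y. f t y \<zeta>) D \<xi>"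
    and f_bdd: "\<forall>K M. compact K \<and> K \<noteq> {} \<and> K \<subseteq> \<Omega> \<and> compact M \<and> M \<noteq> {} \<and> M \<subseteq> U \<longrightarrow>
           bdd_above ((\<lambda>(t, \<xi>, \<zeta>). norm (gateaux_differential (\<lambda>y. f t y \<zeta>) \<xi>)) ` ({0..T} \<times> K \<times> M))"
    and P: "finite P" "P \<subseteq> {needle_direction s z |s z. s \<in> {0..<T} \<and> z \<in> U}"
  shows "\<exists>\<delta> y. variation_family {x T |x u. x \<in> PC1 T \<Omega> \<and> u \<in> NPC0_R T U \<and>
      (\<forall>t\<in>{0..T}. ext_deriv T x t = f t (x t) (u t)) \<and> x 0 = x0 0} (x0 T) P \<delta> y"
proof -
  have "\<forall>w\<in>P. \<exists>s z. s \<in> {0..<T} \<and> z \<in> U \<and> w = needle_direction s z" using P(2) by blast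
  then obtain st zt where stz: "\<And>w. w \<in> P \<Longrightarrow> st w \<in> {0..<T} \<and> zt w \<in> U \<and> w = needle_direction (st w) (zt w)" by metis
  obtain ws0 where ws0: "set ws0 = P" "distinct ws0" using finite_distinct_list[OF P(1)] by blast
  define ws where "ws = sort_key st ws0"
  have ws: "set ws = P" "distinct ws" "sorted (map st ws)" using ws0 by (simp_all add: ws_def)
  define N where "N = length ws"
  define \<tau> where "\<tau> i = st (ws ! i)" for i
  define \<zeta> where "\<zeta> i = zt (ws ! i)" for i
  have wsP: "ws ! i \<in> P" if "i < N" for i using that ws(1) by (auto simp: N_def)
  have bij: "bij_betw ((!) ws) {..<N} P" using bij_betw_nth[OF ws(2)] ws(1) by (simp add: N_def)
  have sumP: "sum g P = (\<Sum>i<N. g (ws ! i))" for g :: "'a \<Rightarrow> 'c::comm_monoid_add"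
    using sum.reindex_bij_betw[OF bij, of g] by simp
  have \<tau>: "\<tau> i \<in> {0..<T}" and \<zeta>: "\<zeta> i \<in> U" if "i < N" for i
    using stz[OF wsP[OF that]] by (simp_all add: \<tau>_def \<zeta>_def)
  have mono: "\<tau> i \<le> \<tau> j" if "i < j" "j < N" for i j
    using sorted_nth_mono[OF ws(3), of i j] that by (simp add: \<tau>_def N_def)
  obtain M0 where M0: "compact M0" "M0 \<subseteq> U" "u0 ` {0..T} \<subseteq> M0" using npc_compact_range[OF u0 T] .
  define M where "M = M0 \<union> \<zeta> ` {..<N}"
  have M: "compact M" "M \<noteq> {}" "M \<subseteq> U" "\<And>s. s \<in> {0..T} \<Longrightarrow> insert (u0 s) (\<zeta> ` {..<N}) \<subseteq> M"
  proof -
    show "compact M" unfolding M_def by (intro compact_Un M0(1) finite_imp_compact) simp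
  qed (use M0 \<zeta> T in \<open>auto simp: M_def\<close>)
  have Kc: "compact (x0 ` {0..T})" by (intro compact_continuous_image x0c compact_Icc)
  have Kne: "x0 ` {0..T} \<noteq> {}" using T by auto
  have KO: "x0 ` {0..T} \<subseteq> \<Omega>" using x0O by blast
  obtain r L B where r: "0 < r" "0 \<le> L" "0 \<le> B" and rO: "\<And>\<xi>. \<xi> \<in> x0 ` {0..T} \<Longrightarrow> cball \<xi> r \<subseteq> \<Omega>"
    and lip: "\<And>t \<xi> \<zeta> y z. t \<in> {0..T} \<Longrightarrow> \<xi> \<in> x0 ` {0..T} \<Longrightarrow> \<zeta> \<in> M \<Longrightarrow> y \<in> cball \<xi> r \<Longrightarrow> z \<in> cball \<xi> r \<Longrightarrow>
       norm (f t y \<zeta> - f t z \<zeta>) \<le> L * norm (y - z)"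
    and bnd: "\<And>t \<xi> \<zeta> y. t \<in> {0..T} \<Longrightarrow> \<xi> \<in> x0 ` {0..T} \<Longrightarrow> \<zeta> \<in> M \<Longrightarrow> y \<in> cball \<xi> r \<Longrightarrow> norm (f t y \<zeta>) \<le> B"
    by (rule lipschitz_tube[OF T Kc Kne KO opn M(1,2,3) f_cont f_gateaux f_bdd]) blast
  define c where "c = 2 * (2 * B * real (N * Suc N)) * exp (2 * L * T)"
  have c0: "0 \<le> c" using r by (simp add: c_def)
  define b where "b = Max (insert 0 (\<tau> ` {..<N}))"
  have b: "b < T" "\<And>i. i < N \<Longrightarrow> \<tau> i \<le> b" using \<tau> T by (auto simp: b_def)
  \<comment> \<open>\<open>b\<close> is the last nominal time and \<open>c\<close> the ratio between the distance from \<open>x0\<close> and the total weight.\<close>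
  define \<delta> where "\<delta> = min (r / (c + 1)) ((T - b) / 2)"
  have \<delta>0: "0 < \<delta>" using r c0 b(1) by (simp add: \<delta>_def)
  have \<delta>r: "c * \<delta> \<le> r"
  proof -
    have "c * \<delta> \<le> (c + 1) * (r / (c + 1))" using c0 \<delta>0 by (intro mult_mono) (auto simp: \<delta>_def)
    then show ?thesis using c0 by simp
  qed
  have \<delta>T: "\<tau> i + \<delta> < T" if "i < N" for i
  proof -
    have "\<delta> \<le> (T - b) / 2" unfolding \<delta>_def by (rule min.cobounded2)
    also have "\<dots> < T - b" using b(1) by simp
    finally have "\<delta> < T - b" .
    then show ?thesis using b(2)[OF that] by simp
  qed
  interpret needle_data T \<Omega> U f x0 u0 S0 Su SR A R N \<tau> \<zeta> r L B \<delta>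
  proof unfold_locales
    show "norm (f s y z - f s y' z) \<le> L * norm (y - y')"
      if "s \<in> {0..T}" "z \<in> insert (u0 s) (\<zeta> ` {..<N})" "norm (y - x0 s) \<le> r" "norm (y' - x0 s) \<le> r" for s z y y'
      by (rule lip[of s "x0 s"]) (use that M(4)[OF that(1)] in \<open>auto simp: dist_norm norm_minus_commute\<close>)
    show "norm (f s y z) \<le> B"
      if "s \<in> {0..T}" "z \<in> insert (u0 s) (\<zeta> ` {..<N})" "norm (y - x0 s) \<le> r" for s z y
      by (rule bnd[of s "x0 s"]) (use that M(4)[OF that(1)] in \<open>auto simp: dist_norm norm_minus_commute\<close>)
  qed (use \<tau> \<zeta> mono r rO \<delta>0 \<delta>r \<delta>T in \<open>simp_all add: c_def\<close>)
  define y where "y a = traj (\<lambda>i. a (ws ! i)) T" for a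
  have sm_iff: "weights P \<delta> a \<longleftrightarrow> sm (\<lambda>i. a (ws ! i))" for a
    unfolding weights_def sumP using bij by (auto simp: bij_betw_def)
  have "variation_family {x T |x u. x \<in> PC1 T \<Omega> \<and> u \<in> NPC0_R T U \<and>
      (\<forall>t\<in>{0..T}. ext_deriv T x t = f t (x t) (u t)) \<and> x 0 = x0 0} (x0 T) P \<delta> y"
    unfolding variation_family_def
  proof (intro conjI allI impI)
    fix a assume "weights P \<delta> a"
    then have "sm (\<lambda>i. a (ws ! i))" by (simp add: sm_iff)
    from traj_PC1[OF this] show "y a \<in> {x T |x u. x \<in> PC1 T \<Omega> \<and> u \<in> NPC0_R T U \<and>
      (\<forall>t\<in>{0..T}. ext_deriv T x t = f t (x t) (u t)) \<and> x 0 = x0 0}" unfolding y_def by blast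
  next
    fix Q :: "nat \<Rightarrow> 'a \<Rightarrow> real" and a
    assume *: "(\<forall>k. weights P \<delta> (Q k)) \<and> weights P \<delta> a \<and> (\<forall>w\<in>P. (\<lambda>k. Q k w) \<longlonglongrightarrow> a w)"
    have "(\<lambda>k. \<Sum>j<N. \<bar>Q k (ws ! j) - a (ws ! j)\<bar>) \<longlonglongrightarrow> (\<Sum>j<N. \<bar>a (ws ! j) - a (ws ! j)\<bar>)"
      by (intro tendsto_intros) (use * wsP in auto)
    then have "(\<lambda>k. \<Sum>j<N. \<bar>Q k (ws ! j) - a (ws ! j)\<bar>) \<longlonglongrightarrow> 0" by simp
    from tendsto_mult_right_zero[OF this, of C]
    have lim: "(\<lambda>k. C * (\<Sum>j<N. \<bar>Q k (ws ! j) - a (ws ! j)\<bar>)) \<longlonglongrightarrow> 0" .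
    have "(\<lambda>k. y (Q k) - y a) \<longlonglongrightarrow> 0"
    proof (rule Lim_null_comparison[OF always_eventually lim], rule allI)
      fix k
      have "sm (\<lambda>i. Q k (ws ! i))" "sm (\<lambda>i. a (ws ! i))" using * by (simp_all flip: sm_iff)
      from traj_continuous[OF this, of T] T
      show "norm (y (Q k) - y a) \<le> C * (\<Sum>j<N. \<bar>Q k (ws ! j) - a (ws ! j)\<bar>)" by (simp add: y_def)
    qed
    then show "(\<lambda>k. y (Q k)) \<longlonglongrightarrow> y a" by (rule LIM_zero_cancel)
  next
    fix \<Theta> :: "nat \<Rightarrow> real" and Q :: "nat \<Rightarrow> 'a \<Rightarrow> real" and a
    assume *: "(\<forall>k. 0 < \<Theta> k \<and> (\<forall>w\<in>P. 0 \<le> Q k w) \<and> weights P \<delta> (\<lambda>w. \<Theta> k * Q k w)) \<and> \<Theta> \<longlonglongrightarrow> 0 \<and>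
       (\<forall>w\<in>P. (\<lambda>k. Q k w) \<longlonglongrightarrow> a w)"
    have "(\<lambda>k. (traj (\<lambda>i. \<Theta> k * Q k (ws ! i)) T - x0 T) /\<^sub>R \<Theta> k) \<longlonglongrightarrow> (\<Sum>i<N. a (ws ! i) *\<^sub>R needle_direction (\<tau> i) (\<zeta> i))"
    proof (rule first_order_expansion)
      show "sm (\<lambda>i. \<Theta> k * Q k (ws ! i))" for k using * sm_iff[of "\<lambda>w. \<Theta> k * Q k w"] by blast
    qed (use * wsP in auto)
    moreover have "(\<Sum>i<N. a (ws ! i) *\<^sub>R needle_direction (\<tau> i) (\<zeta> i)) = (\<Sum>w\<in>P. a w *\<^sub>R w)"
      unfolding sumP by (rule sum.cong) (use stz[OF wsP] in \<open>auto simp: \<tau>_def \<zeta>_def\<close>)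
    ultimately show "(\<lambda>k. (y (\<lambda>w. \<Theta> k * Q k w) - x0 T) /\<^sub>R \<Theta> k) \<longlonglongrightarrow> (\<Sum>w\<in>P. a w *\<^sub>R w)"
      by (simp add: y_def)
  qed (rule \<delta>0)
  then show ?thesis by blast
qed

section \<open>The maximum principle\<close>

theorem theorem2p4:
  fixes T :: real
    and \<Omega> :: "'a::banach set"
    and \<xi>\<^sub>0 :: 'a
    and U :: "'u::t2_space set"
    and m q :: nat
    and f :: "real \<Rightarrow> 'a \<Rightarrow> 'u \<Rightarrow> 'a"
    and g h :: "nat \<Rightarrow> 'a \<Rightarrow> real"
    and x\<^sub>0 :: "real \<Rightarrow> 'a"
    and u\<^sub>0 :: "real \<Rightarrow> 'u"
  assumes "T > 0" and "open \<Omega>" and "\<Omega> \<noteq> {}" and "\<xi>\<^sub>0 \<in> \<Omega>" and "m \<ge> 1" and "q \<ge> 1"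
    and solution: "mayer_solution T \<Omega> U \<xi>\<^sub>0 f m g q h x\<^sub>0 u\<^sub>0"
    and f_cont: "continuous_on ({0..T} \<times> \<Omega> \<times> U) (\<lambda>(t, \<xi>, \<zeta>). f t \<xi> \<zeta>)"
    and f_gateaux: "\<forall>t\<in>{0..T}. \<forall>\<xi>\<in>\<Omega>. \<forall>\<zeta>\<in>U. \<exists>D. has_gateaux_differential (\<lambda>y. f t y \<zeta>) D \<xi>"
    and f_frechet: "\<forall>t\<in>{0..T}. \<forall>\<zeta>\<in>U. (\<lambda>y. f t y \<zeta>) differentiable (at (x\<^sub>0 t))"
    and f_frechet_cont: "continuous_on ({0..T} \<times> U)
           (\<lambda>(t, \<zeta>). frechet_differential (\<lambda>y. f t y \<zeta>) (x\<^sub>0 t))"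
    and f_gateaux_bdd: "\<forall>K M. compact K \<and> K \<noteq> {} \<and> K \<subseteq> \<Omega> \<and> compact M \<and> M \<noteq> {} \<and> M \<subseteq> U \<longrightarrow>
           bdd_above ((\<lambda>(t, \<xi>, \<zeta>). norm (gateaux_differential (\<lambda>y. f t y \<zeta>) \<xi>)) ` ({0..T} \<times> K \<times> M))"
    and g_hadamard: "\<forall>\<alpha>\<in>{0..m}. \<exists>D. has_hadamard_differential (g \<alpha>) D (x\<^sub>0 T)"
    and h_cont: "\<forall>\<beta>\<in>{1..q}. \<exists>V. open V \<and> x\<^sub>0 T \<in> V \<and> V \<subseteq> \<Omega> \<and> continuous_on V (h \<beta>)"
    and h_hadamard: "\<forall>\<beta>\<in>{1..q}. \<exists>D. has_hadamard_differential (h \<beta>) D (x\<^sub>0 T)"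
  shows "\<exists>(l :: nat \<Rightarrow> real) (\<mu> :: nat \<Rightarrow> real) (p :: real \<Rightarrow> 'a \<Rightarrow>\<^sub>L real).
     p \<in> PC1 T UNIV \<and>
     ((\<exists>\<alpha>\<in>{0..m}. l \<alpha> \<noteq> 0) \<or> (\<exists>\<beta>\<in>{1..q}. \<mu> \<beta> \<noteq> 0)) \<and>
     (\<forall>\<alpha>\<in>{0..m}. l \<alpha> \<ge> 0) \<and>
     (\<forall>\<alpha>\<in>{1..m}. l \<alpha> * g \<alpha> (x\<^sub>0 T) = 0) \<and>
     (\<Sum>\<alpha>=0..m. l \<alpha> *\<^sub>R hadamard_differential (g \<alpha>) (x\<^sub>0 T)) +
       (\<Sum>\<beta>=1..q. \<mu> \<beta> *\<^sub>R hadamard_differential (h \<beta>) (x\<^sub>0 T)) = p T \<and>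
     (\<forall>t\<in>{0..T}. (\<lambda>\<xi>. hamiltonian f t \<xi> (u\<^sub>0 t) (p t)) differentiable (at (x\<^sub>0 t)) \<and>
        ext_deriv T p t = - frechet_differential (\<lambda>\<xi>. hamiltonian f t \<xi> (u\<^sub>0 t) (p t)) (x\<^sub>0 t)) \<and>
     (\<forall>t\<in>{0..T}. \<forall>\<zeta>\<in>U. hamiltonian f t (x\<^sub>0 t) (u\<^sub>0 t) (p t) \<ge> hamiltonian f t (x\<^sub>0 t) \<zeta> (p t)) \<and>
     continuous_on {0..T} (\<lambda>t. hamiltonian f t (x\<^sub>0 t) (u\<^sub>0 t) (p t))"
proof -
  note T = \<open>T > 0\<close>
  have adm: "admissible T \<Omega> U \<xi>\<^sub>0 f m g q h x\<^sub>0 u\<^sub>0"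
    and opt: "\<And>x u. admissible T \<Omega> U \<xi>\<^sub>0 f m g q h x u \<Longrightarrow> g 0 (x T) \<le> g 0 (x\<^sub>0 T)"
    using solution unfolding mayer_solution_def by blast+
  have x0: "x\<^sub>0 \<in> PC1 T \<Omega>" and u0: "u\<^sub>0 \<in> NPC0_R T U" and ode: "\<forall>t\<in>{0..T}. ext_deriv T x\<^sub>0 t = f t (x\<^sub>0 t) (u\<^sub>0 t)"
    and x00: "x\<^sub>0 0 = \<xi>\<^sub>0" and g0: "\<forall>\<alpha>\<in>{1..m}. g \<alpha> (x\<^sub>0 T) \<ge> 0" and h0: "\<forall>\<beta>\<in>{1..q}. h \<beta> (x\<^sub>0 T) = 0"
    using adm unfolding admissible_def by blast+
  have x0c: "continuous_on {0..T} x\<^sub>0" and x0O: "\<And>s. s \<in> {0..T} \<Longrightarrow> x\<^sub>0 s \<in> \<Omega>" using x0 unfolding PC1_def by blast+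
  obtain Su where Su: "npc T U Su u\<^sub>0" using NPC0_R_imp_npc[OF u0 T] by blast
  have u0U: "\<And>s. s \<in> {0..T} \<Longrightarrow> u\<^sub>0 s \<in> U" using Su unfolding npc_def by blast
  obtain S0 where S0: "finite S0" "\<And>t. t \<in> {0..T} - S0 \<Longrightarrow> (x\<^sub>0 has_vector_derivative ext_deriv T x\<^sub>0 t) (at t within {0..T})"
    using PC1_has_vector_derivative[OF x0 T] by blast
  define A where "A t = frechet_differential (\<lambda>y. f t y (u\<^sub>0 t)) (x\<^sub>0 t)" for t
  have A: "npc T UNIV Su A" unfolding A_def by (rule npc_comp[OF Su f_frechet_cont _ T]) simp
  have Ad: "((\<lambda>y. f t y (u\<^sub>0 t)) has_derivative blinfun_apply (A t)) (at (x\<^sub>0 t))" if t: "t \<in> {0..T}" for t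
  proof -
    have "((\<lambda>y. f t y (u\<^sub>0 t)) has_derivative frechet_derivative (\<lambda>y. f t y (u\<^sub>0 t)) (at (x\<^sub>0 t))) (at (x\<^sub>0 t))"
      using f_frechet t u0U[OF t] by (simp add: frechet_derivative_works[symmetric])
    moreover from has_derivative_bounded_linear[OF this]
    have "blinfun_apply (A t) = frechet_derivative (\<lambda>y. f t y (u\<^sub>0 t)) (at (x\<^sub>0 t))"
      by (simp add: A_def frechet_differential_def bounded_linear_Blinfun_apply)
    ultimately show ?thesis by simp
  qed
  obtain R where R: "continuous_on {0..T} R" "R T = id_blinfun"
    "\<And>t. t \<in> {0<..<T} - Su \<Longrightarrow> (R has_vector_derivative - (R t o\<^sub>L A t)) (at t)"
    using backward_resolvent[OF T A] by blast
  have finSu: "finite Su" using Su by (simp add: npc_def)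
  interpret reference_process T \<Omega> U f x\<^sub>0 u\<^sub>0 S0 Su Su A R
  proof unfold_locales
    show "(x\<^sub>0 has_vector_derivative f s (x\<^sub>0 s) (u\<^sub>0 s)) (at s)" if "s \<in> {0<..<T} - S0" for s
    proof -
      have "(x\<^sub>0 has_vector_derivative f s (x\<^sub>0 s) (u\<^sub>0 s)) (at s within {0..T})" using S0(2)[of s] ode that by auto
      moreover have "at s within {0..T} = at s" using that by (intro at_within_interior) simp
      ultimately show ?thesis by simp
    qed
  qed (use T \<open>open \<Omega>\<close> x0c x0O Su S0 f_cont A Ad R finSu in simp_all)
  \<comment> \<open>End points of processes satisfying all the constraints except those at the end point.\<close>
  define E where "E = {x T |x u. x \<in> PC1 T \<Omega> \<and> u \<in> NPC0_R T U \<and>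
      (\<forall>t\<in>{0..T}. ext_deriv T x t = f t (x t) (u t)) \<and> x 0 = x\<^sub>0 0}"
  define V where "V = {needle_direction s z |s z. s \<in> {0..<T} \<and> z \<in> U}"
  define Dg where "Dg \<alpha> = hadamard_differential (g \<alpha>) (x\<^sub>0 T)" for \<alpha>
  define Dh where "Dh \<beta> = hadamard_differential (h \<beta>) (x\<^sub>0 T)" for \<beta>
  have "\<exists>l \<mu> :: nat \<Rightarrow> real. ((\<exists>\<alpha>\<in>{0..m}. l \<alpha> \<noteq> 0) \<or> (\<exists>\<beta>\<in>{1..q}. \<mu> \<beta> \<noteq> 0)) \<and>
     (\<forall>\<alpha>\<in>{0..m}. 0 \<le> l \<alpha>) \<and> (\<forall>\<alpha>\<in>{1..m}. l \<alpha> * g \<alpha> (x\<^sub>0 T) = 0) \<and>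
     (\<forall>v\<in>V. (\<Sum>\<alpha>=0..m. l \<alpha> * Dg \<alpha> v) + (\<Sum>\<beta>=1..q. \<mu> \<beta> * Dh \<beta> v) \<le> 0)"
  proof (rule multiplier_rule[OF \<open>q \<ge> 1\<close>])
    show "has_hadamard_differential (g \<alpha>) (Dg \<alpha>) (x\<^sub>0 T)" if "\<alpha> \<in> {0..m}" for \<alpha>
      using g_hadamard that unfolding Dg_def by (metis hadamard_differential_eq)
    show "has_hadamard_differential (h \<beta>) (Dh \<beta>) (x\<^sub>0 T)" if "\<beta> \<in> {1..q}" for \<beta>
      using h_hadamard that unfolding Dh_def by (metis hadamard_differential_eq)
    show "\<exists>V. open V \<and> x\<^sub>0 T \<in> V \<and> continuous_on V (h \<beta>)" if "\<beta> \<in> {1..q}" for \<beta>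
      using h_cont that by blast
    show "g 0 x \<le> g 0 (x\<^sub>0 T)"
      if xE: "x \<in> E" and feas: "\<And>\<alpha>. \<alpha> \<in> {1..m} \<Longrightarrow> 0 \<le> g \<alpha> x" "\<And>\<beta>. \<beta> \<in> {1..q} \<Longrightarrow> h \<beta> x = 0" for x
    proof -
      obtain X u where X: "x = X T" "X \<in> PC1 T \<Omega>" "u \<in> NPC0_R T U" "\<forall>t\<in>{0..T}. ext_deriv T X t = f t (X t) (u t)" "X 0 = x\<^sub>0 0"
        using xE unfolding E_def by blast
      have "admissible T \<Omega> U \<xi>\<^sub>0 f m g q h X u"
        unfolding admissible_def using X feas x00 by simp
      from opt[OF this] show ?thesis by (simp add: X(1))
    qed
    show "\<exists>\<delta> y. variation_family E (x\<^sub>0 T) P \<delta> y" if "finite P" "P \<subseteq> V" for P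
      unfolding E_def by (rule variation_family_exists[OF f_gateaux f_gateaux_bdd that[unfolded V_def]])
  qed (use g0 h0 in simp_all)
  then obtain l \<mu> :: "nat \<Rightarrow> real" where nz: "(\<exists>\<alpha>\<in>{0..m}. l \<alpha> \<noteq> 0) \<or> (\<exists>\<beta>\<in>{1..q}. \<mu> \<beta> \<noteq> 0)"
    and l0: "\<forall>\<alpha>\<in>{0..m}. 0 \<le> l \<alpha>" and slack: "\<forall>\<alpha>\<in>{1..m}. l \<alpha> * g \<alpha> (x\<^sub>0 T) = 0"
    and dual: "\<And>v. v \<in> V \<Longrightarrow> (\<Sum>\<alpha>=0..m. l \<alpha> * Dg \<alpha> v) + (\<Sum>\<beta>=1..q. \<mu> \<beta> * Dh \<beta> v) \<le> 0"
    by blast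
  define \<pi> where "\<pi> = (\<Sum>\<alpha>=0..m. l \<alpha> *\<^sub>R Dg \<alpha>) + (\<Sum>\<beta>=1..q. \<mu> \<beta> *\<^sub>R Dh \<beta>)"
  have \<pi>V: "\<pi> v \<le> 0" if "v \<in> V" for v
    using dual[OF that] by (simp add: \<pi>_def blinfun.add_left blinfun.sum_left blinfun.scaleR_left)
  define p where "p t = \<pi> o\<^sub>L R t" for t
  have bl: "bounded_linear (\<lambda>Z :: 'a \<Rightarrow>\<^sub>L 'a. \<pi> o\<^sub>L Z)"
    by (rule bounded_bilinear.bounded_linear_right[OF bounded_bilinear_blinfun_compose])
  have pc: "continuous_on {0..T} p"
    unfolding p_def by (rule bounded_linear.continuous_on[OF bl R(1)])
  have pA: "npc T UNIV Su (\<lambda>t. - (p t o\<^sub>L A t))"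
  proof (rule npc_comp[OF A _ _ T])
    have "continuous_on ({0..T} \<times> UNIV) (\<lambda>x::real \<times> ('a \<Rightarrow>\<^sub>L 'a). p (fst x))"
      by (rule continuous_on_compose2[OF pc continuous_on_fst[OF continuous_on_id]]) auto
    then have "continuous_on ({0..T} \<times> UNIV) (\<lambda>x::real \<times> ('a \<Rightarrow>\<^sub>L 'a). - (p (fst x) o\<^sub>L snd x))"
      by (intro continuous_on_minus bounded_bilinear.continuous_on[OF bounded_bilinear_blinfun_compose _ continuous_on_snd[OF continuous_on_id]])
    then show "continuous_on ({0..T} \<times> UNIV) (\<lambda>(t, Z :: 'a \<Rightarrow>\<^sub>L 'a). - (p t o\<^sub>L Z))" by (simp add: case_prod_beta)
  qed simp
  have pd: "(p has_vector_derivative - (p t o\<^sub>L A t)) (at t)" if t: "t \<in> {0<..<T} - Su" for t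
  proof -
    have "(p has_vector_derivative \<pi> o\<^sub>L (- (R t o\<^sub>L A t))) (at t)"
      unfolding p_def by (rule bounded_linear.has_vector_derivative[OF bl R(3)[OF t]])
    moreover have "\<pi> o\<^sub>L (- (R t o\<^sub>L A t)) = - (p t o\<^sub>L A t)"
      by (rule blinfun_eqI) (simp add: p_def blinfun.minus_left blinfun.minus_right)
    ultimately show ?thesis by simp
  qed
  have pPC1: "p \<in> PC1 T UNIV" and pext: "\<And>t. t \<in> {0..T} \<Longrightarrow> ext_deriv T p t = - (p t o\<^sub>L A t)"
    using PC1I_npc[OF T _ pc finSu pd pA, of UNIV] by simp_all
  define H where "H t z = hamiltonian f t (x\<^sub>0 t) z (p t)" for t z
  have H: "continuous_on ({0..T} \<times> U) (\<lambda>(t, z). H t z)"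
  proof -
    have "continuous_on ({0..T} \<times> U) (\<lambda>x. f (fst x) (x\<^sub>0 (fst x)) (snd x))"
      using f_cont_along[OF x0c x0O] by (simp add: case_prod_beta)
    moreover have "continuous_on ({0..T} \<times> U) (\<lambda>x::real \<times> 'u. p (fst x))"
      by (rule continuous_on_compose2[OF pc continuous_on_fst[OF continuous_on_id]]) auto
    ultimately have "continuous_on ({0..T} \<times> U) (\<lambda>x. blinfun_apply (p (fst x)) (f (fst x) (x\<^sub>0 (fst x)) (snd x)))"
      by (intro bounded_bilinear.continuous_on[OF bounded_bilinear_blinfun_apply])
    then show ?thesis by (simp add: H_def hamiltonian_def case_prod_beta)
  qed
  have Hu: "npc T UNIV Su (\<lambda>t. H t (u\<^sub>0 t))" by (rule npc_comp[OF Su H _ T]) simp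
  \<comment> \<open>For \<open>t < T\<close> the maximum condition is \<open>\<pi> v \<le> 0\<close> for the needle with value \<open>z\<close> at time \<open>t\<close>.\<close>
  have max': "H t z \<le> H t (u\<^sub>0 t)" if "t \<in> {0..<T}" "z \<in> U" for t z
  proof -
    have "needle_direction t z \<in> V" using that unfolding V_def by blast
    from \<pi>V[OF this] show ?thesis
      by (simp add: needle_direction_def H_def hamiltonian_def p_def blinfun.diff_right)
  qed
  have Hz: "continuous_on {0..T} (\<lambda>t. H t z)" if "z \<in> U" for z
  proof -
    have "continuous_on {0..T} (\<lambda>t. (\<lambda>(t, z). H t z) (t, z))"
      by (rule continuous_on_compose2[OF H]) (use that in \<open>auto intro!: continuous_intros\<close>)
    then show ?thesis by simp
  qed
  have leftlim: "((\<lambda>s. H s z) \<longlongrightarrow> H t z) (at_left t)" if "z \<in> U" "t \<in> {0<..T}" for z t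
    using Hz[OF that(1)] that(2)
    by (intro tendsto_at_left_if_continuous) (auto simp: continuous_on_eq_continuous_within)
  have ev_left: "eventually (\<lambda>s. s \<in> {0..<T}) (at_left t)" if "t \<in> {0<..T}" for t
    using that by (auto simp: eventually_at_left_field intro!: exI[of _ 0])
  have max: "H t z \<le> H t (u\<^sub>0 t)" if t: "t \<in> {0..T}" and z: "z \<in> U" for t z
  proof (cases "t < T")
    case True
    then show ?thesis using max' t z by auto
  next
    case False
    then have tT: "t = T" using t by auto
    have "((\<lambda>s. H s (u\<^sub>0 s)) \<longlongrightarrow> H T (u\<^sub>0 T)) (at_left T)" using Hu by (simp add: npc_def)
    moreover have "((\<lambda>s. H s z) \<longlongrightarrow> H T z) (at_left T)" using leftlim[OF z] T by auto
    moreover have "eventually (\<lambda>s. H s z \<le> H s (u\<^sub>0 s)) (at_left T)"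
      using ev_left[of T] T by (auto elim!: eventually_mono intro!: max' z)
    ultimately show ?thesis unfolding tT by (rule tendsto_le[OF trivial_limit_at_left_real])
  qed
  have Hcont: "continuous_on {0..T} (\<lambda>t. H t (u\<^sub>0 t))"
    unfolding continuous_on_eq_continuous_within
  proof
    fix t assume t: "t \<in> {0..T}"
    have right: "((\<lambda>s. H s (u\<^sub>0 s)) \<longlongrightarrow> H t (u\<^sub>0 t)) (at_right t)" if "t < T"
      using Hu t that by (simp add: npc_def)
    \<comment> \<open>The left limit is the Hamiltonian at the left limit \<open>z\<close> of the control. It is at most \<open>H t (u\<^sub>0 t)\<close> by
      maximality at \<open>t\<close>, and at least that by maximality at earlier times with the value \<open>u\<^sub>0 t\<close>.\<close>
    have left: "((\<lambda>s. H s (u\<^sub>0 s)) \<longlongrightarrow> H t (u\<^sub>0 t)) (at_left t)" if "0 < t"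
    proof -
      have t': "t \<in> {0<..T}" using t that by simp
      obtain z where z: "z \<in> U" "(u\<^sub>0 \<longlongrightarrow> z) (at_left t)" using Su t' unfolding npc_def by blast
      have ev: "eventually (\<lambda>s. s \<in> {0..T}) (at_left t)" using t' by (intro eventually_at_left_mem) auto
      have lim: "((\<lambda>s. H s (u\<^sub>0 s)) \<longlongrightarrow> H t z) (at_left t)"
        by (rule tendsto_comp_pair[OF H z(2) eventually_mono[OF ev u0U] z(1) tendsto_ident_at ev t])
      have "eventually (\<lambda>s. H s (u\<^sub>0 t) \<le> H s (u\<^sub>0 s)) (at_left t)"
        using ev by (rule eventually_mono) (intro max u0U t)
      then have "H t (u\<^sub>0 t) \<le> H t z"
        by (rule tendsto_le[OF trivial_limit_at_left_real lim leftlim[OF u0U[OF t] t']])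
      then have "H t z = H t (u\<^sub>0 t)" using max[OF t z(1)] by simp
      then show ?thesis using lim by simp
    qed
    show "continuous (at t within {0..T}) (\<lambda>t. H t (u\<^sub>0 t))"
    proof -
      consider "t = 0" | "t = T" | "t \<in> {0<..<T}" using t by force
      then show ?thesis
      proof cases
        case 1
        then show ?thesis using right T at_within_Icc_at_right[of 0 T] by (simp add: continuous_within)
      next
        case 2
        then show ?thesis using left T at_within_Icc_at_left[of 0 T] by (simp add: continuous_within)
      next
        case 3
        then have "((\<lambda>s. H s (u\<^sub>0 s)) \<longlongrightarrow> H t (u\<^sub>0 t)) (at t)" using left right by (intro filterlim_split_at_real) auto
        then show ?thesis unfolding continuous_within by (rule tendsto_within_subset) simp
      qed
    qed
  qed
  have adjoint: "(\<lambda>\<xi>. hamiltonian f t \<xi> (u\<^sub>0 t) (p t)) differentiable (at (x\<^sub>0 t)) \<and>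
        ext_deriv T p t = - frechet_differential (\<lambda>\<xi>. hamiltonian f t \<xi> (u\<^sub>0 t) (p t)) (x\<^sub>0 t)" if t: "t \<in> {0..T}" for t
  proof -
    have "((\<lambda>\<xi>. p t (f t \<xi> (u\<^sub>0 t))) has_derivative (\<lambda>y. p t (A t y))) (at (x\<^sub>0 t))"
      by (rule bounded_linear.has_derivative[OF blinfun.bounded_linear_right Ad[OF t]])
    then have d: "((\<lambda>\<xi>. hamiltonian f t \<xi> (u\<^sub>0 t) (p t)) has_derivative blinfun_apply (p t o\<^sub>L A t)) (at (x\<^sub>0 t))"
      by (simp add: hamiltonian_def o_def blinfun_compose.rep_eq)
    then show ?thesis using frechet_differential_eq[OF d] pext[OF t] by (auto simp: differentiable_def)
  qed
  have pT: "p T = \<pi>" by (rule blinfun_eqI) (simp add: p_def R(2))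
  show ?thesis
    by (intro exI[of _ l] exI[of _ \<mu>] exI[of _ p] conjI pPC1 nz l0 slack ballI adjoint[THEN conjunct1] adjoint[THEN conjunct2])
      (use pT max Hcont in \<open>auto simp: \<pi>_def Dg_def Dh_def H_def\<close>)
qed

end
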